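(* Let $S$ be a surface with a smooth Riemannian metric $g$ and let $s_0\in S$. Suppose that the geodesic flow of $g$ admits a fractional-linear integral in a neighborhood of $s_0$. Then the dimension of the space of fractional-linear integrals (near $s_0$) is $3$ if and only if the gaussian curvature $K$ of $g$ is not constant (near $s_0$, i.e. $K$ is not constant on any neighborhood of $s_0$).
   Context: Everything is local and smooth. Let $(x,y)$ be local coordinates on $S$ and $p,q$ the conjugate momenta on $T^*S$ with the symplectic form $dp\wedge dx+dq\wedge dy$. In conformal coordinates $g=\Lambda(x,y)(dx^2+dy^2)$ the geodesic flow is the Hamiltonian flow of $H=\dfrac{p^2+q^2}{2\Lambda}$. A fractional-linear integral near $s_0$ is a function $$I=\frac{A(x,y)p+B(x,y)q}{C(x,y)p+E(x,y)q}$$ with smooth real functions $A,B,C,E$ defined in a neighborhood of $s_0$, with $AE-BC$ nowhere zero, such that the Poisson bracket $\{I,H\}$ vanishes identically wherever $Cp+Eq\neq 0$. It is normalized if $AE-BC=1$ (this can be achieved by multiplying numerator and denominator by a common function, after replacing $I$ by $-I$ if necessary). Dimension of the space of integrals near $s_0$: let $\mathcal J$ be the set of all $1$-jets at $s_0$ of the coefficient quadruples $(A,B,C,E)$, $AE-BC=1$, of germs at $s_0$ of normalized fractional-linear integrals; $\mathcal J$ is a subset of the finite-dimensional vector space of $1$-jets at $s_0$ of maps to $\mathbb R^4$. The space of fractional-linear integrals has dimension $d$ if $\mathcal J$ is a $d$-dimensional embedded submanifold of this jet space. *)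

theory Defs
  imports "HOL-Analysis.Analysis"
begin

(* All notions below are stated in a coordinate chart: the surface is an open set of real^2,
   a point is s with s $ 1 = x, s $ 2 = y, and a covector is v with v $ 1 = p, v $ 2 = q. *)

(* C^k for maps on an open set: the derivative at x is the full (two-sided) one, so these
   predicates are only meaningful for open S. *)

fun Ck_on :: "nat \<Rightarrow> 'a::real_normed_vector set \<Rightarrow> ('a \<Rightarrow> 'b::real_normed_vector) \<Rightarrow> bool" where
  "Ck_on 0 S f \<longleftrightarrow> continuous_on S f"
| "Ck_on (Suc k) S f \<longleftrightarrow>
     (\<forall>x\<in>S. f differentiable at x) \<and> (\<forall>v. Ck_on k S (\<lambda>x. frechet_derivative f (at x) v))"

definition smooth_on :: "'a::real_normed_vector set \<Rightarrow> ('a \<Rightarrow> 'b::real_normed_vector) \<Rightarrow> bool" where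
  "smooth_on S f \<longleftrightarrow> (\<forall>k. Ck_on k S f)"

definition diffeomorphism_on ::
    "'a::real_normed_vector set \<Rightarrow> 'b::real_normed_vector set \<Rightarrow> ('a \<Rightarrow> 'b) \<Rightarrow> ('b \<Rightarrow> 'a) \<Rightarrow> bool" where
  "diffeomorphism_on U V f h \<longleftrightarrow>
     open U \<and> open V \<and> homeomorphism U V f h \<and> smooth_on U f \<and> smooth_on V h"

(* Local slice (flattening chart) definition. *)

definition embedded_submanifold :: "nat \<Rightarrow> 'a::euclidean_space set \<Rightarrow> bool" where
  "embedded_submanifold d M \<longleftrightarrow>
     (\<forall>x\<in>M. \<exists>U V f h (L :: 'a set). x \<in> U \<and> diffeomorphism_on U V f h \<and>
        subspace L \<and> dim L = d \<and> f ` (M \<inter> U) = V \<inter> L)"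


definition riemannian_metric_on :: "(real^2) set \<Rightarrow> (real^2 \<Rightarrow> real^2^2) \<Rightarrow> bool" where
  "riemannian_metric_on S g \<longleftrightarrow> smooth_on S g \<and>
     (\<forall>s\<in>S. transpose (g s) = g s \<and> (\<forall>v. v \<noteq> 0 \<longrightarrow> v \<bullet> (g s *v v) > 0))"

definition pderiv_at :: "2 \<Rightarrow> (real^2 \<Rightarrow> real) \<Rightarrow> real^2 \<Rightarrow> real" where
  "pderiv_at i f s = frechet_derivative f (at s) (axis i 1)"

(* christoffel g k i j is Gamma^k_{ij} *)

definition christoffel :: "(real^2 \<Rightarrow> real^2^2) \<Rightarrow> 2 \<Rightarrow> 2 \<Rightarrow> 2 \<Rightarrow> real^2 \<Rightarrow> real" where
  "christoffel g k i j s =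
     (1/2) * (\<Sum>l\<in>UNIV. matrix_inv (g s) $ k $ l *
       (pderiv_at i (\<lambda>t. g t $ j $ l) s + pderiv_at j (\<lambda>t. g t $ i $ l) s
        - pderiv_at l (\<lambda>t. g t $ i $ j) s))"

(* riemann_curv g l i j k is the l-th component of R(d_i, d_j) d_k, with
   R(X,Y)Z = nabla_X nabla_Y Z - nabla_Y nabla_X Z - nabla_[X,Y] Z. *)

definition riemann_curv :: "(real^2 \<Rightarrow> real^2^2) \<Rightarrow> 2 \<Rightarrow> 2 \<Rightarrow> 2 \<Rightarrow> 2 \<Rightarrow> real^2 \<Rightarrow> real" where
  "riemann_curv g l i j k s =
     pderiv_at i (christoffel g l j k) s - pderiv_at j (christoffel g l i k) s
     + (\<Sum>m\<in>UNIV. christoffel g l i m s * christoffel g m j k s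
                 - christoffel g l j m s * christoffel g m i k s)"

definition gauss_curvature :: "(real^2 \<Rightarrow> real^2^2) \<Rightarrow> real^2 \<Rightarrow> real" where
  "gauss_curvature g s =
     (\<Sum>l\<in>UNIV. g s $ 1 $ l * riemann_curv g l 1 2 2 s) / det (g s)"


(* Functions on the cotangent bundle are functions of (s, v) in real^2 \<times> real^2. *)

definition geodesic_hamiltonian :: "(real^2 \<Rightarrow> real^2^2) \<Rightarrow> (real^2) \<times> (real^2) \<Rightarrow> real" where
  "geodesic_hamiltonian g = (\<lambda>(s, v). (v \<bullet> (matrix_inv (g s) *v v)) / 2)"

(* Poisson bracket of the symplectic form dp \<and> dx + dq \<and> dy. *)

definition poisson_bracket ::
    "((real^2) \<times> (real^2) \<Rightarrow> real) \<Rightarrow> ((real^2) \<times> (real^2) \<Rightarrow> real) \<Rightarrow> (real^2) \<times> (real^2) \<Rightarrow> real" where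
  "poisson_bracket F G z =
     (\<Sum>i\<in>UNIV. frechet_derivative F (at z) (0, axis i 1) * frechet_derivative G (at z) (axis i 1, 0)
               - frechet_derivative F (at z) (axis i 1, 0) * frechet_derivative G (at z) (0, axis i 1))"

definition frac_lin ::
    "(real^2 \<Rightarrow> real) \<Rightarrow> (real^2 \<Rightarrow> real) \<Rightarrow> (real^2 \<Rightarrow> real) \<Rightarrow> (real^2 \<Rightarrow> real) \<Rightarrow> (real^2) \<times> (real^2) \<Rightarrow> real" where
  "frac_lin A B C E =
     (\<lambda>(s, v). (A s * v $ 1 + B s * v $ 2) / (C s * v $ 1 + E s * v $ 2))"

definition frac_lin_integral_on ::
    "(real^2) set \<Rightarrow> (real^2 \<Rightarrow> real^2^2) \<Rightarrow>
     (real^2 \<Rightarrow> real) \<Rightarrow> (real^2 \<Rightarrow> real) \<Rightarrow> (real^2 \<Rightarrow> real) \<Rightarrow> (real^2 \<Rightarrow> real) \<Rightarrow> bool" where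
  "frac_lin_integral_on U g A B C E \<longleftrightarrow>
     smooth_on U A \<and> smooth_on U B \<and> smooth_on U C \<and> smooth_on U E \<and>
     (\<forall>s\<in>U. A s * E s - B s * C s \<noteq> 0) \<and>
     (\<forall>s\<in>U. \<forall>v. C s * v $ 1 + E s * v $ 2 \<noteq> 0 \<longrightarrow>
        poisson_bracket (frac_lin A B C E) (geodesic_hamiltonian g) (s, v) = 0)"

definition normalized_on ::
    "(real^2) set \<Rightarrow> (real^2 \<Rightarrow> real) \<Rightarrow> (real^2 \<Rightarrow> real) \<Rightarrow> (real^2 \<Rightarrow> real) \<Rightarrow> (real^2 \<Rightarrow> real) \<Rightarrow> bool" where
  "normalized_on U A B C E \<longleftrightarrow> (\<forall>s\<in>U. A s * E s - B s * C s = 1)"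

definition jet1 :: "real^2 \<Rightarrow> (real^2 \<Rightarrow> real^4) \<Rightarrow> (real^4) \<times> (real^2^4)" where
  "jet1 s F = (F s, matrix (frechet_derivative F (at s)))"

definition integral_jets :: "(real^2) set \<Rightarrow> (real^2 \<Rightarrow> real^2^2) \<Rightarrow> real^2 \<Rightarrow> ((real^4) \<times> (real^2^4)) set" where
  "integral_jets S g s0 =
     {jet1 s0 (\<lambda>s. vector [A s, B s, C s, E s]) | A B C E.
        \<exists>U. open U \<and> s0 \<in> U \<and> U \<subseteq> S \<and> frac_lin_integral_on U g A B C E \<and> normalized_on U A B C E}"

definition integrals_have_dim :: "(real^2) set \<Rightarrow> (real^2 \<Rightarrow> real^2^2) \<Rightarrow> real^2 \<Rightarrow> nat \<Rightarrow> bool" where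
  "integrals_have_dim S g s0 d \<longleftrightarrow> embedded_submanifold d (integral_jets S g s0)"

(* For g = L (dx^2 + dy^2) the definitions give the usual expressions
   H = (p^2 + q^2) / (2 L) and K = - (Laplacian of ln L) / (2 L). *)

lemma matrix_inv_conformal:
  fixes a :: real
  assumes "a \<noteq> 0"
  shows "matrix_inv (mat a :: real^2^2) = mat (1 / a)"
proof -
  let ?A = "mat a :: real^2^2" and ?B = "mat (1 / a) :: real^2^2"
  have AB: "?A ** ?B = mat 1" "?B ** ?A = mat 1"
    using assms by (simp_all add: matrix_matrix_mult_def mat_def vec_eq_iff forall_2 UNIV_2)
  have "matrix_inv ?A = X" if "?A ** X = mat 1" "X ** ?A = mat 1" for X
    unfolding matrix_inv_def
    by (rule some_equality) (use that in \<open>auto, metis matrix_mul_assoc matrix_mul_lid matrix_mul_rid\<close>)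
  then show ?thesis using AB by blast
qed

lemma mat_nth: "(mat a :: real^2^2) $ i $ j = (if i = j then a else 0)"
  by (simp add: mat_def)

lemma geodesic_hamiltonian_conformal:
  assumes "L s > 0"
  shows "geodesic_hamiltonian (\<lambda>s. mat (L s)) (s, v) = ((v $ 1)\<^sup>2 + (v $ 2)\<^sup>2) / (2 * L s)"
proof -
  have "L s \<noteq> 0" using assms by simp
  then show ?thesis
    by (simp add: geodesic_hamiltonian_def matrix_inv_conformal inner_vec_def
        matrix_vector_mult_def mat_nth UNIV_2 power2_eq_square field_simps)
qed

lemma pderiv_at_cong:
  assumes "open S" "s \<in> S" "\<And>t. t \<in> S \<Longrightarrow> f t = h t"
  shows "pderiv_at i f s = pderiv_at i h s"
proof -
  have "(f has_derivative D) (at s) \<longleftrightarrow> (h has_derivative D) (at s)" for D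
    using has_derivative_transform_within_open[OF _ assms(1,2), of f D UNIV h]
      has_derivative_transform_within_open[OF _ assms(1,2), of h D UNIV f] assms(3) by auto
  then show ?thesis by (simp add: pderiv_at_def frechet_derivative_def)
qed

lemma pderiv_at_zero [simp]: "pderiv_at i (\<lambda>_. 0) s = 0"
  by (simp add: pderiv_at_def)

lemma pderiv_at_cmult:
  assumes "f differentiable at s"
  shows "pderiv_at i (\<lambda>t. c * f t) s = c * pderiv_at i f s"
proof -
  have "((\<lambda>t. c * f t) has_derivative (\<lambda>v. c * frechet_derivative f (at s) v)) (at s)"
    using assms by (auto intro!: derivative_eq_intros simp: frechet_derivative_works)
  then show ?thesis
    unfolding pderiv_at_def by (metis frechet_derivative_at)
qed

lemma pderiv_at_ln:
  assumes "f differentiable at s" "f s > 0"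
  shows "pderiv_at i (\<lambda>t. ln (f t)) s = pderiv_at i f s / f s"
proof -
  have "(f has_derivative frechet_derivative f (at s)) (at s)"
    using assms by (simp add: frechet_derivative_works)
  then have "((\<lambda>t. ln (f t)) has_derivative (\<lambda>v. frechet_derivative f (at s) v / f s)) (at s)"
    using DERIV_compose_FDERIV[where f = ln and g = f and x = s, OF DERIV_ln[OF assms(2)]] by (simp add: divide_inverse)
  then show ?thesis
    unfolding pderiv_at_def by (metis frechet_derivative_at)
qed

lemma gauss_curvature_conformal:
  fixes L :: "real^2 \<Rightarrow> real"
  assumes S: "open S" and L: "smooth_on S L" and pos: "\<And>t. t \<in> S \<Longrightarrow> L t > 0" and s: "s \<in> S"
  shows "gauss_curvature (\<lambda>t. mat (L t)) s =
    - (pderiv_at 1 (pderiv_at 1 (\<lambda>t. ln (L t))) s + pderiv_at 2 (pderiv_at 2 (\<lambda>t. ln (L t))) s)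
      / (2 * L s)"
proof -
  let ?g = "\<lambda>t. mat (L t) :: real^2^2"
  let ?w = "\<lambda>i. pderiv_at i (\<lambda>t. ln (L t))"
  have "Ck_on (Suc 1) S L" using L unfolding smooth_on_def by blast
  then have d1: "\<And>t. t \<in> S \<Longrightarrow> L differentiable at t"
    and d2: "\<And>t v. t \<in> S \<Longrightarrow> (\<lambda>x. frechet_derivative L (at x) v) differentiable at t"
    by auto
  have w: "?w i t = pderiv_at i L t / L t" if "t \<in> S" for i t
    using that d1 pos by (simp add: pderiv_at_ln)
  have w_diff: "?w i differentiable at s" for i
  proof -
    have "(\<lambda>t. pderiv_at i L t / L t) differentiable at s"
      using d1[OF s] d2[OF s] pos[OF s] unfolding pderiv_at_def
      by (intro differentiable_divide) auto
    then obtain D where D: "((\<lambda>t. pderiv_at i L t / L t) has_derivative D) (at s)"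
      unfolding differentiable_def by blast
    have "(?w i has_derivative D) (at s)"
      by (rule has_derivative_transform_within_open[OF D S s]) (simp add: w)
    then show ?thesis unfolding differentiable_def by blast
  qed
  have c: "christoffel ?g 1 1 1 t = 1/2 * ?w 1 t" "christoffel ?g 1 1 2 t = 1/2 * ?w 2 t"
    "christoffel ?g 1 2 1 t = 1/2 * ?w 2 t" "christoffel ?g 1 2 2 t = (-1/2) * ?w 1 t"
    "christoffel ?g 2 1 1 t = (-1/2) * ?w 2 t" "christoffel ?g 2 1 2 t = 1/2 * ?w 1 t"
    "christoffel ?g 2 2 1 t = 1/2 * ?w 1 t" "christoffel ?g 2 2 2 t = 1/2 * ?w 2 t"
    if t: "t \<in> S" for t
    using pos[OF t] by (simp_all add: christoffel_def matrix_inv_conformal mat_nth UNIV_2 w[OF t])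
  have p: "pderiv_at i (christoffel ?g k j l) s = c * pderiv_at i (?w m) s"
    if "\<And>t. t \<in> S \<Longrightarrow> christoffel ?g k j l t = c * ?w m t" for i j k l m c
    using pderiv_at_cong[OF S s, of "christoffel ?g k j l" "\<lambda>t. c * ?w m t" i] that
    by (simp add: pderiv_at_cmult[OF w_diff])
  have "riemann_curv ?g 1 1 2 2 s = - (pderiv_at 1 (?w 1) s + pderiv_at 2 (?w 2) s) / 2"
    using p[OF c(4)] p[OF c(2)] by (simp add: riemann_curv_def UNIV_2 c[OF s] field_simps)
  then show ?thesis
    using pos[OF s] by (simp add: gauss_curvature_def UNIV_2 det_2 mat_nth field_simps)
qed

end

theory Submission
  imports Defs
begin

text \<open>
  \<^bold>\<open>Reduction.\<close> Regard the numerator and the denominator of a fractional-linear integral as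
  vector fields X and Y. They are coprime linear forms in the momenta, so \<open>{X/Y, H} = 0\<close> means that
  \<open>{X, H}\<close> and \<open>{Y, H}\<close> are the products of X and of Y with one common linear form: both fields
  satisfy Killing's equation twisted by the same one-form \<open>\<alpha>\<close> (\<open>integral_imp_killing\<close>,
  \<open>killing_imp_integral\<close>). Two independent solutions determine a second one-form \<open>\<beta>\<close> with
  \<open>\<nabla>\<^sub>v W = - \<alpha>(v) W + \<beta>(J W) J v\<close> for W = X and W = Y, where J is the rotation by a right angle
  (\<open>twisted_parallel_of_killing\<close>). Equality of mixed derivatives amounts to
  \<open>d\<alpha> = - d\<beta> / 2\<close> and to the Riccati system \<open>sym \<nabla>\<beta> = \<beta> \<otimes> \<beta> + K g\<close>
  (\<open>parallel_pair_riccati\<close>). For a normalized integral \<open>\<alpha>\<close> is a function of \<open>\<beta>\<close> and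
  the metric. Hence the 1-jet at s0 is determined by the 0-jet, a matrix F in SL(2), and by the
  value b of \<open>\<beta>\<close> at s0, and the set of jets is a union of graphs of linear maps
  \<open>F \<mapsto> T\<^sub>b F\<close> over SL(2), one for each value b that occurs (\<open>integral_jets_graphs\<close>). The question is how
  many values occur.

  \<^bold>\<open>Nonconstant curvature.\<close> Let \<open>\<omega>\<close> be half the exterior derivative of \<open>\<beta>\<close>. Prolonging the Riccati
  system gives \<open>d\<omega> = 3 \<omega> \<beta> + *dK\<close>, then the algebraic relation
  \<open>6 \<omega>\<^sup>2 - 3 \<beta>(grad K) + \<Delta>K = 0\<close>, and after one more differentiation two equations that are linear
  in \<open>\<beta>\<close>. Eliminating \<open>\<beta>\<close>, the number \<open>\<omega>(s)\<close> is a root of a polynomial of degree 6 that depends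
  only on the metric (\<open>skew_poly_root\<close>). Two solutions with the same \<open>\<omega>\<close> on an open set satisfy
  \<open>\<omega> (\<beta> - \<beta>') = 0\<close> there, and if they differ everywhere then \<open>\<omega> = 0\<close> and \<open>dK = 0\<close>. So there
  are at most six values b (\<open>finite_riccati_values\<close>), and a finite union of disjoint graphs over
  SL(2) is a submanifold of dimension 3 (\<open>graphs_over_unimodular_submanifold\<close>).

  \<^bold>\<open>Constant curvature.\<close> Now \<open>\<omega> = 0\<close>, so \<open>\<alpha>\<close> and \<open>\<beta>\<close> are closed, and integrating closed
  forms produces a third solution \<open>Z = m1 X + m2 Y\<close> of the same twisted equation, with m1 and m2
  vanishing at s0 (\<open>third_killing_field\<close>). The integrals \<open>(X + t Z) / Y\<close> move the 1-jet along a line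
  with fixed 0-jet. Together with three lines inside an orbit of SL(2) this makes four independent
  tangent directions, which rules out dimension 3 (\<open>not_dimension_three_if_constant\<close>).

  All computations use derivatives along an orthonormal frame obtained from the coordinate coframe by
  the Gram-Schmidt process; the curvature of the Christoffel symbols is identified with that of
  the frame in \<open>gauss_curvature_frame\<close>.
\<close>

section \<open>Calculus of smooth functions\<close>

lemma Ck_on_cong:
  assumes "open S" "\<And>x. x \<in> S \<Longrightarrow> f x = g x" "Ck_on k S f"
  shows "Ck_on k S g"
  using assms(2,3)
proof (induction k arbitrary: f g)
  case 0
  then show ?case by (simp cong: continuous_on_cong)
next
  case (Suc k)
  have fd: "\<And>x. x \<in> S \<Longrightarrow> (f has_derivative frechet_derivative f (at x)) (at x)"
    using Suc.prems(2) frechet_derivative_works by auto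
  have gd: "(g has_derivative frechet_derivative f (at x)) (at x)" if "x \<in> S" for x
    using has_derivative_transform_within_open[OF fd[OF that] assms(1) that] Suc.prems(1) by blast
  then have eq: "\<And>x. x \<in> S \<Longrightarrow> frechet_derivative f (at x) = frechet_derivative g (at x)"
    using frechet_derivative_at by blast
  have "Ck_on k S (\<lambda>x. frechet_derivative g (at x) v)" for v
    using Suc.IH[of "\<lambda>x. frechet_derivative f (at x) v" "\<lambda>x. frechet_derivative g (at x) v"]
      Suc.prems(2) eq by simp
  moreover have "\<forall>x\<in>S. g differentiable at x"
    using gd differentiable_def by blast
  ultimately show ?case by simp
qed

lemma Ck_on_SucI:
  assumes "open S" "\<And>x. x \<in> S \<Longrightarrow> (f has_derivative f' x) (at x)" "\<And>v. Ck_on k S (\<lambda>x. f' x v)"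
  shows "Ck_on (Suc k) S f"
proof -
  have "frechet_derivative f (at x) = f' x" if "x \<in> S" for x
    using frechet_derivative_at[OF assms(2)[OF that]] by simp
  then have "Ck_on k S (\<lambda>x. frechet_derivative f (at x) v)" for v
    using Ck_on_cong[OF assms(1) _ assms(3)[of v]] by simp
  then show ?thesis
    using assms(2) by (auto intro: differentiableI)
qed

lemma Ck_on_has_derivative:
  assumes "Ck_on (Suc k) S f" "x \<in> S"
  shows "(f has_derivative frechet_derivative f (at x)) (at x)"
  using assms frechet_derivative_works by auto

text \<open>The recursion defining the predicate demands only differentiability at each stage;
  that the classes decrease needs that differentiable functions are continuous.\<close>

lemma Ck_on_SucD: "Ck_on (Suc k) S f \<Longrightarrow> Ck_on k S f"
proof (induction k arbitrary: f)
  case 0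
  then show ?case
    by (auto intro!: continuous_at_imp_continuous_on differentiable_imp_continuous_within)
next
  case (Suc k)
  then show ?case by auto
qed

lemma Ck_on_subset: "Ck_on k S f \<Longrightarrow> T \<subseteq> S \<Longrightarrow> Ck_on k T f"
  by (induction k arbitrary: f) (auto intro: continuous_on_subset)

lemma Ck_on_const: "Ck_on k S (\<lambda>x. c)"
  by (induction k arbitrary: c) auto

lemma Ck_on_add:
  assumes "open S" "Ck_on k S f" "Ck_on k S g"
  shows "Ck_on k S (\<lambda>x. f x + g x)"
  using assms(2,3)
proof (induction k arbitrary: f g)
  case 0
  then show ?case by (auto intro: continuous_intros)
next
  case (Suc k)
  show ?case
    by (rule Ck_on_SucI[OF assms(1) has_derivative_add[OF Suc.prems[THEN Ck_on_has_derivative]]])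
      (use Suc in auto)
qed

lemma (in bounded_linear) Ck_on_comp:
  assumes "open S" "Ck_on k S g"
  shows "Ck_on k S (\<lambda>x. f (g x))"
  using assms(2)
proof (induction k arbitrary: g)
  case 0
  then show ?case by (auto intro: continuous_on)
next
  case (Suc k)
  show ?case
    by (rule Ck_on_SucI[OF assms(1) has_derivative[OF Suc.prems[THEN Ck_on_has_derivative]]])
      (use Suc in auto)
qed

lemma bounded_linear_Ck_on:
  assumes "open S" "bounded_linear f"
  shows "Ck_on k S f"
proof (cases k)
  case 0
  then show ?thesis using assms by (simp add: linear_continuous_on)
next
  case (Suc j)
  show ?thesis unfolding Suc
    by (rule Ck_on_SucI[OF assms(1) bounded_linear_imp_has_derivative[OF assms(2)]])
      (rule Ck_on_const)
qed

lemma (in bounded_bilinear) Ck_on_prod: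
  assumes "open S" "Ck_on k S f" "Ck_on k S g"
  shows "Ck_on k S (\<lambda>x. prod (f x) (g x))"
  using assms(2,3)
proof (induction k arbitrary: f g)
  case 0
  then show ?case by (auto intro: continuous_on)
next
  case (Suc k)
  have "Ck_on k S f" "Ck_on k S g" using Suc.prems by (auto dest: Ck_on_SucD simp del: Ck_on.simps)
  then have "Ck_on k S (\<lambda>x. prod (f x) (frechet_derivative g (at x) v) + prod (frechet_derivative f (at x) v) (g x))" for v
    using Suc by (intro Ck_on_add assms(1)) auto
  then show ?case
    by (intro Ck_on_SucI[OF assms(1) FDERIV[OF Suc.prems[THEN Ck_on_has_derivative]]])
qed

lemmas Ck_on_mult = bounded_bilinear.Ck_on_prod[OF bounded_bilinear_mult]
lemmas Ck_on_scaleR = bounded_bilinear.Ck_on_prod[OF bounded_bilinear_scaleR]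

lemma Ck_on_inverse:
  fixes f :: "'a::real_normed_vector \<Rightarrow> real"
  assumes "open S" "Ck_on k S f" "\<And>x. x \<in> S \<Longrightarrow> f x \<noteq> 0"
  shows "Ck_on k S (\<lambda>x. inverse (f x))"
  using assms(2)
proof (induction k)
  case 0
  then show ?case using assms(3) by (auto intro!: continuous_intros)
next
  case (Suc k)
  then have "Ck_on k S (\<lambda>x. inverse (f x))" by (auto dest: Ck_on_SucD simp del: Ck_on.simps)
  then have "Ck_on k S (\<lambda>x. - 1 * (inverse (f x) * frechet_derivative f (at x) v * inverse (f x)))" for v
    using Suc.prems by (intro Ck_on_mult Ck_on_const assms(1)) auto
  then show ?case
    by (intro Ck_on_SucI[OF assms(1) Deriv.has_derivative_inverse[OF _ Suc.prems[THEN Ck_on_has_derivative]]])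
      (auto simp: assms(3))
qed

lemma Ck_on_sqrt:
  fixes f :: "'a::real_normed_vector \<Rightarrow> real"
  assumes "open S" "Ck_on k S f" "\<And>x. x \<in> S \<Longrightarrow> f x > 0"
  shows "Ck_on k S (\<lambda>x. sqrt (f x))"
  using assms(2)
proof (induction k)
  case 0
  then show ?case by (auto intro!: continuous_intros)
next
  case (Suc k)
  then have *: "Ck_on k S (\<lambda>x. sqrt (f x))" by (auto dest: Ck_on_SucD simp del: Ck_on.simps)
  have "Ck_on k S (\<lambda>x. frechet_derivative f (at x) v * (1/2 * inverse (sqrt (f x))))" for v
    using Suc.prems assms(3) by (intro Ck_on_mult Ck_on_const Ck_on_inverse assms(1) *) force+
  moreover have "((\<lambda>x. sqrt (f x)) has_derivative
      (\<lambda>v. frechet_derivative f (at x) v * (1/2 * inverse (sqrt (f x))))) (at x)" if "x \<in> S" for x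
    using DERIV_compose_FDERIV[where f=sqrt and g=f and x=x, OF DERIV_real_sqrt[OF assms(3)[OF that]]
        Ck_on_has_derivative[OF Suc.prems that]] by (simp add: mult.commute)
  ultimately show ?case
    by (intro Ck_on_SucI[OF assms(1)])
qed

lemma Ck_on_exp:
  fixes f :: "'a::real_normed_vector \<Rightarrow> real"
  assumes "open S" "Ck_on k S f"
  shows "Ck_on k S (\<lambda>x. exp (f x))"
  using assms(2)
proof (induction k)
  case 0
  then show ?case by (auto intro!: continuous_intros)
next
  case (Suc k)
  then have *: "Ck_on k S (\<lambda>x. exp (f x))" by (auto dest: Ck_on_SucD simp del: Ck_on.simps)
  have "Ck_on k S (\<lambda>x. frechet_derivative f (at x) v * exp (f x))" for v
    using Suc.prems by (intro Ck_on_mult assms(1) *) auto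
  moreover have "((\<lambda>x. exp (f x)) has_derivative
      (\<lambda>v. frechet_derivative f (at x) v * exp (f x))) (at x)" if "x \<in> S" for x
    using DERIV_compose_FDERIV[where f=exp and g=f and x=x, OF DERIV_exp
        Ck_on_has_derivative[OF Suc.prems that]] by (simp add: mult.commute)
  ultimately show ?case
    by (intro Ck_on_SucI[OF assms(1)])
qed

lemma smooth_on_cong:
  "open S \<Longrightarrow> (\<And>x. x \<in> S \<Longrightarrow> f x = g x) \<Longrightarrow> smooth_on S f \<Longrightarrow> smooth_on S g"
  unfolding smooth_on_def using Ck_on_cong by blast

lemma smooth_on_subset: "smooth_on S f \<Longrightarrow> T \<subseteq> S \<Longrightarrow> smooth_on T f"
  unfolding smooth_on_def using Ck_on_subset by blast

lemma smooth_on_const: "smooth_on S (\<lambda>x. c)"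
  by (simp add: smooth_on_def Ck_on_const)

lemma smooth_on_add:
  "open S \<Longrightarrow> smooth_on S f \<Longrightarrow> smooth_on S g \<Longrightarrow> smooth_on S (\<lambda>x. f x + g x)"
  by (simp add: smooth_on_def Ck_on_add)

lemma smooth_on_linear_comp:
  "bounded_linear L \<Longrightarrow> open S \<Longrightarrow> smooth_on S g \<Longrightarrow> smooth_on S (\<lambda>x. L (g x))"
  by (simp add: smooth_on_def bounded_linear.Ck_on_comp)

lemma smooth_on_linear: "open S \<Longrightarrow> bounded_linear f \<Longrightarrow> smooth_on S f"
  by (simp add: smooth_on_def bounded_linear_Ck_on)

lemma smooth_on_scaleR:
  "open S \<Longrightarrow> smooth_on S f \<Longrightarrow> smooth_on S g \<Longrightarrow> smooth_on S (\<lambda>x. f x *\<^sub>R g x)"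
  by (simp add: smooth_on_def Ck_on_scaleR)

lemma smooth_on_mult:
  fixes f g :: "'a::real_normed_vector \<Rightarrow> real"
  shows "open S \<Longrightarrow> smooth_on S f \<Longrightarrow> smooth_on S g \<Longrightarrow> smooth_on S (\<lambda>x. f x * g x)"
  by (simp add: smooth_on_def Ck_on_mult)

lemma smooth_on_uminus:
  "open S \<Longrightarrow> smooth_on S f \<Longrightarrow> smooth_on S (\<lambda>x. - f x)"
  by (rule smooth_on_linear_comp[OF bounded_linear_minus[OF bounded_linear_ident]])

lemma smooth_on_diff:
  "open S \<Longrightarrow> smooth_on S f \<Longrightarrow> smooth_on S g \<Longrightarrow> smooth_on S (\<lambda>x. f x - g x)"
  using smooth_on_add[of S f "\<lambda>x. - g x"] smooth_on_uminus[of S g] by simp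

lemma smooth_on_inverse:
  fixes f :: "'a::real_normed_vector \<Rightarrow> real"
  shows "open S \<Longrightarrow> smooth_on S f \<Longrightarrow> (\<And>x. x \<in> S \<Longrightarrow> f x \<noteq> 0) \<Longrightarrow> smooth_on S (\<lambda>x. inverse (f x))"
  by (simp add: smooth_on_def Ck_on_inverse)

lemma smooth_on_divide:
  fixes f g :: "'a::real_normed_vector \<Rightarrow> real"
  shows "open S \<Longrightarrow> smooth_on S f \<Longrightarrow> smooth_on S g \<Longrightarrow> (\<And>x. x \<in> S \<Longrightarrow> g x \<noteq> 0)
    \<Longrightarrow> smooth_on S (\<lambda>x. f x / g x)"
  using smooth_on_mult[of S f "\<lambda>x. inverse (g x)"] smooth_on_inverse[of S g]
  by (simp add: divide_inverse)

lemma smooth_on_sqrt: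
  fixes f :: "'a::real_normed_vector \<Rightarrow> real"
  shows "open S \<Longrightarrow> smooth_on S f \<Longrightarrow> (\<And>x. x \<in> S \<Longrightarrow> f x > 0) \<Longrightarrow> smooth_on S (\<lambda>x. sqrt (f x))"
  by (simp add: smooth_on_def Ck_on_sqrt)

lemma smooth_on_exp:
  fixes f :: "'a::real_normed_vector \<Rightarrow> real"
  shows "open S \<Longrightarrow> smooth_on S f \<Longrightarrow> smooth_on S (\<lambda>x. exp (f x))"
  by (simp add: smooth_on_def Ck_on_exp)

lemma smooth_on_power2:
  fixes f :: "'a::real_normed_vector \<Rightarrow> real"
  shows "open S \<Longrightarrow> smooth_on S f \<Longrightarrow> smooth_on S (\<lambda>x. (f x)\<^sup>2)"
  by (simp add: power2_eq_square smooth_on_mult)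

lemmas smooth_intros = smooth_on_const smooth_on_add smooth_on_mult smooth_on_uminus smooth_on_diff
  smooth_on_divide smooth_on_inverse smooth_on_power2

lemma smooth_on_continuous_on:
  assumes "smooth_on S f"
  shows "continuous_on S f"
proof -
  have "Ck_on 0 S f" using assms unfolding smooth_on_def by (rule spec)
  then show ?thesis by simp
qed

lemma open_superlevel:
  fixes f :: "'a::topological_space \<Rightarrow> real"
  assumes "open U" "continuous_on U f"
  shows "open {s \<in> U. 0 < f s}"
proof -
  have "open (U \<inter> f -` {0<..})"
    using continuous_openin_preimage_gen[OF assms(2) open_greaterThan] assms(1)
    by (simp add: openin_open_eq)
  also have "U \<inter> f -` {0<..} = {s \<in> U. 0 < f s}" by auto
  finally show ?thesis .
qed

lemma smooth_on_has_derivative: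
  assumes "smooth_on S f" "s \<in> S"
  shows "(f has_derivative frechet_derivative f (at s)) (at s)"
proof -
  have "Ck_on (Suc 0) S f" using assms(1) unfolding smooth_on_def by (rule spec)
  then show ?thesis using assms(2) by (rule Ck_on_has_derivative)
qed

lemma smooth_on_differentiable:
  assumes "smooth_on S f" "s \<in> S"
  shows "f differentiable at s"
  using smooth_on_has_derivative[OF assms] by (rule differentiableI)

lemma smooth_on_frechet:
  assumes "smooth_on S f"
  shows "smooth_on S (\<lambda>x. frechet_derivative f (at x) v)"
  unfolding smooth_on_def
proof
  fix k
  have "Ck_on (Suc k) S f" using assms unfolding smooth_on_def by (rule spec)
  then show "Ck_on k S (\<lambda>x. frechet_derivative f (at x) v)" by simp
qed

lemma smooth_onI:
  assumes "\<And>x. x \<in> S \<Longrightarrow> f differentiable at x"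
    and "\<And>v. smooth_on S (\<lambda>x. frechet_derivative f (at x) v)"
  shows "smooth_on S f"
  unfolding smooth_on_def
proof
  fix k
  have "Ck_on k S (\<lambda>x. frechet_derivative f (at x) v)" for v
    using assms(2)[of v] unfolding smooth_on_def by (rule spec)
  then show "Ck_on k S f"
    using assms(1) by - (rule Ck_on_SucD, simp)
qed

text \<open>Both orders of differentiation compute the limit of the same second difference quotient:
  the mean value theorem, applied twice, expresses it by either of the mixed derivatives.\<close>

lemma second_difference_mean_value:
  fixes f :: "'a::real_normed_vector \<Rightarrow> real"
  assumes f: "\<And>x. x \<in> ball s (r * (norm v + norm w)) \<Longrightarrow> f differentiable at x"
    and f': "\<And>x. x \<in> ball s (r * (norm v + norm w)) \<Longrightarrow>
      (\<lambda>x. frechet_derivative f (at x) v) differentiable at x"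
    and t: "0 < t" "t < r" and vw: "norm v + norm w > 0"
  obtains a b where "0 < a" "a < t" "0 < b" "b < t"
    "f (s + t *\<^sub>R v + t *\<^sub>R w) - f (s + t *\<^sub>R v) - f (s + t *\<^sub>R w) + f s
     = t\<^sup>2 * frechet_derivative (\<lambda>x. frechet_derivative f (at x) v) (at (s + a *\<^sub>R v + b *\<^sub>R w)) w"
proof -
  have inB: "s + a *\<^sub>R v + b *\<^sub>R w \<in> ball s (r * (norm v + norm w))" if "0 \<le> a" "a \<le> t" "0 \<le> b" "b \<le> t" for a b
  proof -
    have "norm (a *\<^sub>R v + b *\<^sub>R w) \<le> a * norm v + b * norm w"
      using that by (intro norm_triangle_le) simp
    also have "\<dots> \<le> t * (norm v + norm w)"
      using that unfolding distrib_left by (intro add_mono mult_right_mono) auto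
    also have "\<dots> < r * (norm v + norm w)" using t vw by simp
    finally have "dist (s + (a *\<^sub>R v + b *\<^sub>R w)) s < r * (norm v + norm w)"
      by (simp add: dist_norm)
    then show ?thesis by (simp add: dist_commute add.assoc)
  qed
  have line: "((\<lambda>a. h (p + a *\<^sub>R u)) has_real_derivative frechet_derivative h (at (p + a *\<^sub>R u)) u) (at a)"
    if h: "h differentiable at (p + a *\<^sub>R u)" for h :: "'a \<Rightarrow> real" and p u a
  proof -
    have h': "(h has_derivative frechet_derivative h (at (p + a *\<^sub>R u))) (at (p + a *\<^sub>R u))"
      using h frechet_derivative_works by blast
    have "((\<lambda>a. p + a *\<^sub>R u) has_derivative (\<lambda>x. x *\<^sub>R u)) (at a)"
      by (auto intro!: derivative_eq_intros)
    from has_derivative_compose[OF this h']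
    have "((\<lambda>a. h (p + a *\<^sub>R u)) has_derivative (\<lambda>x. frechet_derivative h (at (p + a *\<^sub>R u)) (x *\<^sub>R u))) (at a)" .
    moreover have "frechet_derivative h (at (p + a *\<^sub>R u)) (x *\<^sub>R u) = frechet_derivative h (at (p + a *\<^sub>R u)) u * x" for x
      using linear_cmul[OF linear_frechet_derivative[OF h]] by simp
    ultimately show ?thesis by (simp add: has_field_derivative_def)
  qed
  define \<phi> where "\<phi> a = f ((s + t *\<^sub>R w) + a *\<^sub>R v) - f (s + a *\<^sub>R v)" for a
  have "\<exists>a>0. a < t \<and> \<phi> t - \<phi> 0 = (t - 0) *
      (frechet_derivative f (at ((s + t *\<^sub>R w) + a *\<^sub>R v)) v - frechet_derivative f (at (s + a *\<^sub>R v)) v)"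
  proof (rule MVT2[OF t(1)])
    fix a assume a: "0 \<le> a" "a \<le> t"
    show "(\<phi> has_real_derivative frechet_derivative f (at ((s + t *\<^sub>R w) + a *\<^sub>R v)) v
        - frechet_derivative f (at (s + a *\<^sub>R v)) v) (at a)"
      unfolding \<phi>_def
    proof (rule DERIV_diff[OF line[OF f] line[OF f]])
      show "s + t *\<^sub>R w + a *\<^sub>R v \<in> ball s (r * (norm v + norm w))"
        using inB[OF a, of t] t by (simp add: add.assoc add.commute add.left_commute)
      show "s + a *\<^sub>R v \<in> ball s (r * (norm v + norm w))"
        using inB[OF a, of 0] t by simp
    qed
  qed
  then obtain a where a: "0 < a" "a < t" "\<phi> t - \<phi> 0 = (t - 0) *
      (frechet_derivative f (at ((s + t *\<^sub>R w) + a *\<^sub>R v)) v - frechet_derivative f (at (s + a *\<^sub>R v)) v)"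
    by auto
  define \<psi> where "\<psi> b = frechet_derivative f (at ((s + a *\<^sub>R v) + b *\<^sub>R w)) v" for b
  have "\<exists>b>0. b < t \<and> \<psi> t - \<psi> 0 = (t - 0) *
      frechet_derivative (\<lambda>x. frechet_derivative f (at x) v) (at ((s + a *\<^sub>R v) + b *\<^sub>R w)) w"
  proof (rule MVT2[OF t(1)])
    fix b assume "0 \<le> b" "b \<le> t"
    then have "s + a *\<^sub>R v + b *\<^sub>R w \<in> ball s (r * (norm v + norm w))"
      using inB[of a b] a(1,2) by simp
    then show "(\<psi> has_real_derivative
        frechet_derivative (\<lambda>x. frechet_derivative f (at x) v) (at ((s + a *\<^sub>R v) + b *\<^sub>R w)) w) (at b)"
      unfolding \<psi>_def by (rule line[OF f'])
  qed
  then obtain b where b: "0 < b" "b < t" "\<psi> t - \<psi> 0 = (t - 0) *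
      frechet_derivative (\<lambda>x. frechet_derivative f (at x) v) (at ((s + a *\<^sub>R v) + b *\<^sub>R w)) w"
    by auto
  have "f (s + t *\<^sub>R v + t *\<^sub>R w) - f (s + t *\<^sub>R v) - f (s + t *\<^sub>R w) + f s = \<phi> t - \<phi> 0"
    by (simp add: \<phi>_def algebra_simps)
  also have "\<dots> = t * (\<psi> t - \<psi> 0)"
    using a(3) by (simp add: \<psi>_def algebra_simps)
  also have "\<dots> = t\<^sup>2 * frechet_derivative (\<lambda>x. frechet_derivative f (at x) v) (at (s + a *\<^sub>R v + b *\<^sub>R w)) w"
    using b(3) by (simp add: power2_eq_square)
  finally show ?thesis
    by (rule that[OF a(1,2) b(1,2)])
qed

lemma frechet_derivative_mixed_symmetric:
  fixes f :: "'a::real_normed_vector \<Rightarrow> real"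
  assumes S: "open S" "s \<in> S" and f: "smooth_on S f"
  shows "frechet_derivative (\<lambda>x. frechet_derivative f (at x) v) (at s) w
       = frechet_derivative (\<lambda>x. frechet_derivative f (at x) w) (at s) v"
proof (cases "v = 0 \<and> w = 0")
  case True
  then show ?thesis by simp
next
  case False
  then have vw: "norm v + norm w > 0" by (auto intro: add_nonneg_pos add_pos_nonneg)
  define n where "n = norm v + norm w"
  define G where "G v w x = frechet_derivative (\<lambda>x. frechet_derivative f (at x) v) (at x) w" for v w x
  have cont: "isCont (G v w) s" for v w
    using smooth_on_continuous_on[OF smooth_on_frechet[OF smooth_on_frechet[OF f, of v], of w]] S
    unfolding G_def by (simp add: continuous_on_eq_continuous_at)
  obtain R where R: "R > 0" "ball s R \<subseteq> S" using S openE by blast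
  have n: "n > 0" using vw by (simp add: n_def)
  have diff: "f differentiable at x" "(\<lambda>x. frechet_derivative f (at x) u) differentiable at x"
    if "x \<in> ball s R" for x u
    using that R f smooth_on_frechet[OF f] smooth_on_differentiable by blast+
  have "dist (G v w s) (G w v s) \<le> e" if e: "e > 0" for e
  proof -
    obtain d1 where d1: "d1 > 0" "\<And>x. dist x s < d1 \<Longrightarrow> dist (G v w x) (G v w s) < e/2"
      using cont[of v w, unfolded continuous_at_eps_delta] e half_gt_zero by blast
    obtain d2 where d2: "d2 > 0" "\<And>x. dist x s < d2 \<Longrightarrow> dist (G w v x) (G w v s) < e/2"
      using cont[of w v, unfolded continuous_at_eps_delta] e half_gt_zero by blast
    define r where "r = min R (min d1 d2) / n"
    have r: "r > 0" "r * n = min R (min d1 d2)" using R d1 d2 n by (auto simp: r_def)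
    define t where "t = r / 2"
    have t: "0 < t" "t < r" using r by (auto simp: t_def)
    have rn: "ball s (r * (norm v + norm w)) \<subseteq> ball s R"
      using r(2) by (auto simp: n_def)
    have rn': "ball s (r * (norm w + norm v)) \<subseteq> ball s R"
      using rn by (simp add: add.commute)
    have near: "dist (s + a *\<^sub>R x + b *\<^sub>R y) s < min d1 d2" if "0 < a" "a < t" "0 < b" "b < t" "norm x + norm y = n"
      for a b x y
    proof -
      have "norm (a *\<^sub>R x + b *\<^sub>R y) \<le> a * norm x + b * norm y"
        using that by (intro norm_triangle_le) simp
      also have "\<dots> \<le> t * n" using that(1-4) unfolding that(5)[symmetric]
        unfolding distrib_left by (intro add_mono mult_right_mono) auto
      also have "\<dots> < r * n" using t n by simp
      finally show ?thesis using r(2) by (simp add: dist_norm add.assoc)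
    qed
    obtain a b where ab: "0 < a" "a < t" "0 < b" "b < t"
      "f (s + t *\<^sub>R v + t *\<^sub>R w) - f (s + t *\<^sub>R v) - f (s + t *\<^sub>R w) + f s = t\<^sup>2 * G v w (s + a *\<^sub>R v + b *\<^sub>R w)"
      unfolding G_def
      by (rule second_difference_mean_value[of s r v w f t]) (use diff rn t vw in auto)
    obtain a' b' where ab': "0 < a'" "a' < t" "0 < b'" "b' < t"
      "f (s + t *\<^sub>R w + t *\<^sub>R v) - f (s + t *\<^sub>R w) - f (s + t *\<^sub>R v) + f s = t\<^sup>2 * G w v (s + a' *\<^sub>R w + b' *\<^sub>R v)"
      unfolding G_def
      by (rule second_difference_mean_value[of s r w v f t]) (use diff rn' t vw in auto)
    have swap: "s + t *\<^sub>R w + t *\<^sub>R v = s + t *\<^sub>R v + t *\<^sub>R w" by simp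
    have "t\<^sup>2 * G v w (s + a *\<^sub>R v + b *\<^sub>R w) = t\<^sup>2 * G w v (s + a' *\<^sub>R w + b' *\<^sub>R v)"
      using ab(5) ab'(5)[unfolded swap] by linarith
    then have eq: "G v w (s + a *\<^sub>R v + b *\<^sub>R w) = G w v (s + a' *\<^sub>R w + b' *\<^sub>R v)" using t by simp
    have "dist (G v w (s + a *\<^sub>R v + b *\<^sub>R w)) (G v w s) < e/2"
      using near[of a b v w] ab d1 by (auto simp: n_def)
    moreover have "dist (G w v (s + a' *\<^sub>R w + b' *\<^sub>R v)) (G w v s) < e/2"
      using near[of a' b' w v] ab' d2 by (auto simp: n_def)
    ultimately show ?thesis unfolding eq
      using dist_triangle_half_r[of "G w v (s + a' *\<^sub>R w + b' *\<^sub>R v)" "G v w s" e "G w v s"] by (simp add: dist_commute)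
  qed
  then have "dist (G v w s) (G w v s) = 0"
    using dense_eq0_I[of "dist (G v w s) (G w v s)"] by simp
  then show ?thesis by (simp add: G_def)
qed

section \<open>Derivatives along vector fields\<close>

definition along :: "('a::real_normed_vector \<Rightarrow> 'a) \<Rightarrow> ('a \<Rightarrow> real) \<Rightarrow> 'a \<Rightarrow> real" where
  "along e f s = frechet_derivative f (at s) (e s)"

lemma along_eqI: "(f has_derivative f') (at s) \<Longrightarrow> along e f s = f' (e s)"
  unfolding along_def by (drule frechet_derivative_at) simp

lemma along_const [simp]: "along e (\<lambda>x. c) s = 0"
  using along_eqI[OF has_derivative_const[of c "at s"], of e] by simp

lemma differentiable_has_derivative:
  "f differentiable at s \<Longrightarrow> (f has_derivative frechet_derivative f (at s)) (at s)"
  by (rule iffD1[OF frechet_derivative_works])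

lemma along_add:
  assumes "f differentiable at s" "g differentiable at s"
  shows "along e (\<lambda>x. f x + g x) s = along e f s + along e g s"
  using along_eqI[OF has_derivative_add[OF assms[THEN differentiable_has_derivative]]]
  unfolding along_def .

lemma along_diff:
  assumes "f differentiable at s" "g differentiable at s"
  shows "along e (\<lambda>x. f x - g x) s = along e f s - along e g s"
  using along_eqI[OF has_derivative_diff[OF assms[THEN differentiable_has_derivative]]]
  unfolding along_def .

lemma along_mult:
  assumes "f differentiable at s" "g differentiable at s"
  shows "along e (\<lambda>x. f x * g x) s = f s * along e g s + along e f s * g s"
  using along_eqI[OF has_derivative_mult[OF assms[THEN differentiable_has_derivative]]]
  unfolding along_def .

lemma along_divide:
  assumes "f differentiable at s" "g differentiable at s" "g s \<noteq> 0"
  shows "along e (\<lambda>x. f x / g x) s = (along e f s * g s - f s * along e g s) / (g s)\<^sup>2"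
  using along_eqI[OF has_derivative_divide'[OF assms(1,2)[THEN differentiable_has_derivative] assms(3)]]
  unfolding along_def power2_eq_square .

lemma along_uminus:
  assumes "f differentiable at s"
  shows "along e (\<lambda>x. - f x) s = - along e f s"
  using along_eqI[OF has_derivative_minus[OF assms[THEN differentiable_has_derivative]]]
  unfolding along_def .

lemma along_power2:
  assumes "f differentiable at s"
  shows "along e (\<lambda>x. (f x)\<^sup>2) s = 2 * f s * along e f s"
  unfolding power2_eq_square along_mult[OF assms assms] by simp

lemma along_sqrt:
  assumes "f differentiable at s" "f s > 0"
  shows "along e (\<lambda>x. sqrt (f x)) s = along e f s / (2 * sqrt (f s))"
proof -
  have "((\<lambda>x. sqrt (f x)) has_derivative
      (\<lambda>v. frechet_derivative f (at s) v * (inverse (sqrt (f s)) / 2))) (at s)"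
    by (rule DERIV_compose_FDERIV[OF DERIV_real_sqrt[OF assms(2)]
          differentiable_has_derivative[OF assms(1)]])
  from along_eqI[OF this, of e] show ?thesis
    unfolding along_def by (simp add: field_simps)
qed

lemma along_exp:
  assumes "f differentiable at s"
  shows "along e (\<lambda>x. exp (f x)) s = exp (f s) * along e f s"
proof -
  have "((\<lambda>x. exp (f x)) has_derivative (\<lambda>v. frechet_derivative f (at s) v * exp (f s))) (at s)"
    by (rule DERIV_compose_FDERIV[OF DERIV_exp differentiable_has_derivative[OF assms]])
  from along_eqI[OF this, of e] show ?thesis
    unfolding along_def by (simp add: mult.commute)
qed

lemmas along_simps = along_const along_add along_diff along_mult along_uminus along_power2
  differentiable_add differentiable_diff differentiable_mult differentiable_minus differentiable_const
  differentiable_power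

lemma along_cong:
  assumes "open U" "s \<in> U" "\<And>t. t \<in> U \<Longrightarrow> f t = h t"
  shows "along e f s = along e h s"
proof -
  have "(f has_derivative D) (at s) \<longleftrightarrow> (h has_derivative D) (at s)" for D
    using has_derivative_transform_within_open[OF _ assms(1,2), of f D UNIV h]
      has_derivative_transform_within_open[OF _ assms(1,2), of h D UNIV f] assms(3) by auto
  then show ?thesis by (simp add: along_def frechet_derivative_def)
qed

lemma smooth_on_coord: "open S \<Longrightarrow> smooth_on S (\<lambda>s. s $ i)" for S :: "(real^'n) set"
  by (rule smooth_on_linear) (auto simp: bounded_linear_vec_nth)

lemma along_components:
  fixes s :: "real^2"
  assumes "f differentiable at s"
  shows "along e f s = e s $ 1 * pderiv_at 1 f s + e s $ 2 * pderiv_at 2 f s"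
proof -
  have "e s = e s $ 1 *\<^sub>R axis 1 1 + e s $ 2 *\<^sub>R axis 2 1"
    by (simp add: vec_eq_iff forall_2 axis_def)
  then have "along e f s = frechet_derivative f (at s) (e s $ 1 *\<^sub>R axis 1 1 + e s $ 2 *\<^sub>R axis 2 1)"
    unfolding along_def by metis
  also have "\<dots> = e s $ 1 * pderiv_at 1 f s + e s $ 2 * pderiv_at 2 f s"
    unfolding pderiv_at_def
    by (simp add: linear_add linear_cmul linear_frechet_derivative[OF assms])
  finally show ?thesis .
qed

lemma smooth_on_pderiv_at: "smooth_on S f \<Longrightarrow> smooth_on S (pderiv_at i f)"
  unfolding pderiv_at_def by (rule smooth_on_frechet)

lemma smooth_on_along:
  fixes S :: "(real^2) set"
  assumes "open S" "smooth_on S (\<lambda>s. e s $ 1)" "smooth_on S (\<lambda>s. e s $ 2)" "smooth_on S f"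
  shows "smooth_on S (along e f)"
proof -
  have "smooth_on S (\<lambda>s. e s $ 1 * pderiv_at 1 f s + e s $ 2 * pderiv_at 2 f s)"
    using assms smooth_on_pderiv_at by (intro smooth_intros) auto
  then show ?thesis
    by (rule smooth_on_cong[OF assms(1), rotated])
      (simp add: along_components smooth_on_differentiable[OF assms(4)])
qed

section \<open>Moving frames and the Riccati system\<close>

text \<open>The fields e1, e2 are thought of as an orthonormal frame of a metric on S, and c1, c2
  as the components of its connection form: the derivative of e1 along a vector v is \<open>c(v)
  e2\<close>, that of e2 is \<open>- c(v) e1\<close>. The bracket relation says that the
  connection has no torsion; it is stated by the action of the commutator on functions.\<close>

locale moving_frame =
  fixes S :: "(real^2) set" and e1 e2 :: "real^2 \<Rightarrow> real^2" and c1 c2 :: "real^2 \<Rightarrow> real"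
  assumes open_S: "open S"
    and smooth_e: "smooth_on S (\<lambda>s. e1 s $ i)" "smooth_on S (\<lambda>s. e2 s $ i)"
    and smooth_c: "smooth_on S c1" "smooth_on S c2"
    and frame_independent: "s \<in> S \<Longrightarrow> e1 s $ 1 * e2 s $ 2 - e1 s $ 2 * e2 s $ 1 \<noteq> 0"
    and bracket: "\<lbrakk>open U; U \<subseteq> S; smooth_on U f; s \<in> U\<rbrakk> \<Longrightarrow>
      along e1 (along e2 f) s - along e2 (along e1 f) s = - c1 s * along e1 f s - c2 s * along e2 f s"
begin

abbreviation "D1 \<equiv> along e1"
abbreviation "D2 \<equiv> along e2"

text \<open>Gaussian curvature by the second structure equation of the frame.\<close>

definition K :: "real^2 \<Rightarrow> real" where
  "K s = - (D1 c2 s - D2 c1 s + (c1 s)\<^sup>2 + (c2 s)\<^sup>2)"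

lemma smooth_D:
  assumes "open U" "U \<subseteq> S" "smooth_on U f"
  shows "smooth_on U (D1 f)" "smooth_on U (D2 f)"
  using assms(1,3) smooth_e[THEN smooth_on_subset[OF _ assms(2)]]
  by (auto intro: smooth_on_along)

lemma smooth_K: "smooth_on S K"
  unfolding K_def[abs_def] using open_S smooth_c
  by (intro smooth_intros smooth_D) auto

text \<open>With \<open>J e1 = e2\<close>, \<open>J e2 = - e1\<close> and one-forms
  \<open>\<alpha> = (a1, a2)\<close>, \<open>\<beta> = (b1, b2)\<close>, these are the frame
  components of the equation \<open>\<nabla>\<^sub>v W = - \<alpha>(v) W + \<beta>(J W) J
  v\<close>. It is a connection whose parallel fields are the solutions: \<open>\<alpha>\<close>
  only rescales W, while \<open>\<beta>\<close> is invariant under rescaling.\<close>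

definition twisted_parallel ::
    "(real^2) set \<Rightarrow> (real^2 \<Rightarrow> real) \<Rightarrow> (real^2 \<Rightarrow> real) \<Rightarrow> (real^2 \<Rightarrow> real) \<Rightarrow> (real^2 \<Rightarrow> real)
      \<Rightarrow> (real^2 \<Rightarrow> real) \<Rightarrow> (real^2 \<Rightarrow> real) \<Rightarrow> bool" where
  "twisted_parallel U a1 a2 b1 b2 W1 W2 \<longleftrightarrow> (\<forall>s\<in>U.
      D1 W1 s = - a1 s * W1 s + c1 s * W2 s \<and>
      D1 W2 s = (b2 s - c1 s) * W1 s - (a1 s + b1 s) * W2 s \<and>
      D2 W1 s = - (a2 s + b2 s) * W1 s + (c2 s + b1 s) * W2 s \<and>
      D2 W2 s = - c2 s * W1 s - a2 s * W2 s)"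

text \<open>The equation \<open>sym \<nabla>\<beta> = \<beta> \<otimes> \<beta> + K g\<close> in
  frame components. Its three equations prescribe all first derivatives of \<open>\<beta>\<close>
  except the skew-symmetric combination defined next.\<close>

definition riccati_form :: "(real^2) set \<Rightarrow> (real^2 \<Rightarrow> real) \<Rightarrow> (real^2 \<Rightarrow> real) \<Rightarrow> bool" where
  "riccati_form U b1 b2 \<longleftrightarrow> smooth_on U b1 \<and> smooth_on U b2 \<and> (\<forall>s\<in>U.
      D1 b1 s = c1 s * b2 s + (b1 s)\<^sup>2 + K s \<and>
      D2 b2 s = - c2 s * b1 s + (b2 s)\<^sup>2 + K s \<and>
      D1 b2 s + D2 b1 s = c2 s * b2 s - c1 s * b1 s + 2 * b1 s * b2 s)"

text \<open>Half of the exterior derivative of \<open>\<beta>\<close>, evaluated on (e1, e2). On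
  solutions of the Riccati system this agrees with \<open>(D1 b2 - D2 b1 + c1 b1 + c2 b2) /
  2\<close>.\<close>

definition skew_part :: "(real^2 \<Rightarrow> real) \<Rightarrow> (real^2 \<Rightarrow> real) \<Rightarrow> real^2 \<Rightarrow> real" where
  "skew_part b1 b2 s = D1 b2 s + c1 s * b1 s - b1 s * b2 s"

text \<open>Two independent parallel fields force the connection they are parallel for to be flat.
  Commuting the two derivatives of each field gives a linear relation between its components;
  since it holds for two independent fields, its four coefficients vanish. The coefficients are
  the Riccati system together with \<open>d\<alpha> = - d\<beta> / 2\<close>.\<close>

lemma parallel_pair_riccati:
  assumes U: "open U" "U \<subseteq> S"
    and sm: "smooth_on U a1" "smooth_on U a2" "smooth_on U b1" "smooth_on U b2"
      "smooth_on U X1" "smooth_on U X2" "smooth_on U Y1" "smooth_on U Y2"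
    and X: "twisted_parallel U a1 a2 b1 b2 X1 X2" and Y: "twisted_parallel U a1 a2 b1 b2 Y1 Y2"
    and det: "\<And>s. s \<in> U \<Longrightarrow> X1 s * Y2 s - X2 s * Y1 s \<noteq> 0"
  shows "riccati_form U b1 b2"
    and "s \<in> U \<Longrightarrow> D1 a2 s - D2 a1 s + c1 s * a1 s + c2 s * a2 s = - skew_part b1 b2 s"
proof -
  have zero: "p = 0 \<and> q = 0"
    if "p * X1 s + q * X2 s = 0" "p * Y1 s + q * Y2 s = 0" "s \<in> U" for p q s
  proof -
    have "p * (X1 s * Y2 s - X2 s * Y1 s) = 0" "q * (X1 s * Y2 s - X2 s * Y1 s) = 0"
      using that(1,2) by algebra+
    then show ?thesis using det[OF that(3)] by simp
  qed
  have rel: "(- D1 a2 s - D1 b2 s + D2 a1 s + b1 s * b2 s - b1 s * c1 s - c1 s * a1 s - c2 s * a2 s) * W1 s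
      + (D1 b1 s - (b1 s)\<^sup>2 - c1 s * b2 s - K s) * W2 s = 0 \<and>
     (D2 b2 s - (b2 s)\<^sup>2 + c2 s * b1 s - K s) * W1 s +
     (D1 a2 s - D2 a1 s - D2 b1 s + b1 s * b2 s + c2 s * b2 s + c1 s * a1 s + c2 s * a2 s) * W2 s = 0"
    if W: "twisted_parallel U a1 a2 b1 b2 W1 W2" "smooth_on U W1" "smooth_on U W2" and s: "s \<in> U" for W1 W2 s
  proof -
    have d [simp]: "a1 differentiable at s" "a2 differentiable at s" "b1 differentiable at s"
      "b2 differentiable at s" "c1 differentiable at s" "c2 differentiable at s"
      "W1 differentiable at s" "W2 differentiable at s"
      using sm W(2,3) s U smooth_c by (auto intro: smooth_on_differentiable)
    note w = W(1)[unfolded twisted_parallel_def, rule_format]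
    have 1: "D1 (D2 W1) s = D1 (\<lambda>s. - (a2 s + b2 s) * W1 s + (c2 s + b1 s) * W2 s) s"
      "D2 (D1 W1) s = D2 (\<lambda>s. - a1 s * W1 s + c1 s * W2 s) s"
      "D1 (D2 W2) s = D1 (\<lambda>s. - c2 s * W1 s - a2 s * W2 s) s"
      "D2 (D1 W2) s = D2 (\<lambda>s. (b2 s - c1 s) * W1 s - (a1 s + b1 s) * W2 s) s"
      using w by (intro along_cong[OF U(1) s]; simp)+
    have 2: "D1 (D2 W1) s - D2 (D1 W1) s = - c1 s * D1 W1 s - c2 s * D2 W1 s"
      "D1 (D2 W2) s - D2 (D1 W2) s = - c1 s * D1 W2 s - c2 s * D2 W2 s"
      using bracket[OF U W(2) s] bracket[OF U W(3) s] by auto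
    show ?thesis
      using 2 w[OF s] unfolding 1 K_def by (simp add: along_simps) algebra
  qed
  have eqs: "- D1 a2 s - D1 b2 s + D2 a1 s + b1 s * b2 s - b1 s * c1 s - c1 s * a1 s - c2 s * a2 s = 0"
      "D1 b1 s - (b1 s)\<^sup>2 - c1 s * b2 s - K s = 0"
      "D2 b2 s - (b2 s)\<^sup>2 + c2 s * b1 s - K s = 0"
      "D1 a2 s - D2 a1 s - D2 b1 s + b1 s * b2 s + c2 s * b2 s + c1 s * a1 s + c2 s * a2 s = 0"
    if "s \<in> U" for s
    using zero[OF _ _ that] rel[OF X sm(5,6) that] rel[OF Y sm(7,8) that] by blast+
  show "riccati_form U b1 b2"
    unfolding riccati_form_def
  proof (intro conjI ballI sm)
    fix s assume "s \<in> U"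
    note eqs = eqs[OF this]
    show "D1 b1 s = c1 s * b2 s + (b1 s)\<^sup>2 + K s" "D2 b2 s = - c2 s * b1 s + (b2 s)\<^sup>2 + K s"
      using eqs(2,3) by (simp_all add: algebra_simps)
    show "D1 b2 s + D2 b1 s = c2 s * b2 s - c1 s * b1 s + 2 * b1 s * b2 s"
      using eqs(1,4) by (simp add: algebra_simps)
  qed
  show "s \<in> U \<Longrightarrow> D1 a2 s - D2 a1 s + c1 s * a1 s + c2 s * a2 s = - skew_part b1 b2 s"
    using eqs(1)[of s] by (simp add: skew_part_def algebra_simps)
qed

lemma riccati_formD:
  assumes "riccati_form U b1 b2" "s \<in> U"
  shows "D1 b1 s = c1 s * b2 s + (b1 s)\<^sup>2 + K s"
    and "D2 b2 s = - c2 s * b1 s + (b2 s)\<^sup>2 + K s"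
    and "D1 b2 s = - c1 s * b1 s + b1 s * b2 s + skew_part b1 b2 s"
    and "D2 b1 s = c2 s * b2 s + b1 s * b2 s - skew_part b1 b2 s"
  using assms unfolding riccati_form_def skew_part_def by (auto simp: algebra_simps)

lemma smooth_skew_part:
  assumes "open U" "U \<subseteq> S" "riccati_form U b1 b2"
  shows "smooth_on U (skew_part b1 b2)"
proof -
  have "smooth_on U b1" "smooth_on U b2" using assms(3) by (auto simp: riccati_form_def)
  then show ?thesis
    unfolding skew_part_def[abs_def] using assms(1,2) smooth_c[THEN smooth_on_subset[OF _ assms(2)]]
    by (intro smooth_intros smooth_D) auto
qed

text \<open>Prolongation: commuting the derivatives of \<open>\<beta>\<close> expresses the
  derivative of its skew part \<open>\<omega>\<close> by \<open>3 \<omega> \<beta>\<close> plus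
  the rotated differential of K. From here on the system is closed, and further integrability
  conditions are algebraic.\<close>

lemma skew_part_derivative:
  assumes U: "open U" "U \<subseteq> S" and b: "riccati_form U b1 b2" and s: "s \<in> U"
  shows "D1 (skew_part b1 b2) s = 3 * b1 s * skew_part b1 b2 s - D2 K s"
    and "D2 (skew_part b1 b2) s = 3 * b2 s * skew_part b1 b2 s + D1 K s"
proof -
  let ?w = "skew_part b1 b2"
  have sm: "smooth_on U b1" "smooth_on U b2" using b by (auto simp: riccati_form_def)
  have d: "b1 differentiable at s" "b2 differentiable at s" "c1 differentiable at s"
    "c2 differentiable at s" "?w differentiable at s" "K differentiable at s"
    using sm s U smooth_c smooth_K smooth_skew_part[OF U b] by (auto intro: smooth_on_differentiable)
  note r = riccati_formD[OF b]
  have 1: "D1 (D2 b1) s = D1 (\<lambda>s. c2 s * b2 s + b1 s * b2 s - ?w s) s"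
    "D2 (D1 b1) s = D2 (\<lambda>s. c1 s * b2 s + (b1 s)\<^sup>2 + K s) s"
    "D1 (D2 b2) s = D1 (\<lambda>s. - c2 s * b1 s + (b2 s)\<^sup>2 + K s) s"
    "D2 (D1 b2) s = D2 (\<lambda>s. - c1 s * b1 s + b1 s * b2 s + ?w s) s"
    by (rule along_cong[OF U(1) s], simp only: r)+
  have K: "D1 c2 s = D2 c1 s - (c1 s)\<^sup>2 - (c2 s)\<^sup>2 - K s" by (simp add: K_def)
  show "D1 ?w s = 3 * b1 s * ?w s - D2 K s"
    using bracket[OF U sm(1) s] unfolding 1 r[OF s]
    by (simp add: along_simps d r[OF s] K) algebra
  show "D2 ?w s = 3 * b2 s * ?w s + D1 K s"
    using bracket[OF U sm(2) s] unfolding 1 r[OF s]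
    by (simp add: along_simps d r[OF s] K) algebra
qed

text \<open>The Laplacian of K; the terms with c1 and c2 come from differentiating the
  frame.\<close>

definition laplace_K :: "real^2 \<Rightarrow> real" where
  "laplace_K s = D1 (D1 K) s + D2 (D2 K) s - c1 s * D2 K s + c2 s * D1 K s"

lemma smooth_laplace_K: "smooth_on S laplace_K"
  unfolding laplace_K_def[abs_def] using open_S smooth_c smooth_K
  by (intro smooth_intros smooth_D) auto

text \<open>The derivatives of \<open>\<omega>\<close> must commute as well; all derivatives of
  \<open>\<beta>\<close> cancel and an algebraic relation between \<open>\<omega>\<close> and
  \<open>\<beta>\<close> remains.\<close>

lemma skew_part_constraint:
  assumes U: "open U" "U \<subseteq> S" and b: "riccati_form U b1 b2" and s: "s \<in> U"
  shows "6 * (skew_part b1 b2 s)\<^sup>2 - 3 * (b1 s * D1 K s + b2 s * D2 K s) + laplace_K s = 0"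
proof -
  let ?w = "skew_part b1 b2"
  have sm: "smooth_on U b1" "smooth_on U b2" using b by (auto simp: riccati_form_def)
  have d: "b1 differentiable at s" "b2 differentiable at s" "?w differentiable at s"
    "D1 K differentiable at s" "D2 K differentiable at s"
    using sm s U smooth_D[OF open_S subset_refl smooth_K] smooth_skew_part[OF U b]
    by (auto intro: smooth_on_differentiable)
  note r = riccati_formD[OF b s] and w = skew_part_derivative[OF U b]
  have 1: "D1 (D2 ?w) s = D1 (\<lambda>s. 3 * b2 s * ?w s + D1 K s) s"
    "D2 (D1 ?w) s = D2 (\<lambda>s. 3 * b1 s * ?w s - D2 K s) s"
    by (rule along_cong[OF U(1) s], simp only: w)+
  show ?thesis
    using bracket[OF U smooth_skew_part[OF U b] s] unfolding 1 w[OF s] laplace_K_def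
    by (simp add: along_simps d r w[OF s]) algebra
qed

text \<open>The constraint says that \<open>\<beta>\<close> applied to the gradient of K is a
  quadratic polynomial in \<open>\<omega>\<close>. Its two derivatives are linear equations for
  \<open>\<beta>\<close> with the matrix \<open>((A, h12), (h21, B))\<close> and the right-hand
  side \<open>- (p, q)\<close>, where A and B are quadratic in \<open>\<omega>\<close> with
  leading coefficient 30. Solving by Cramer's rule and inserting the solution in the constraint,
  multiplied by the determinant, gives this polynomial in \<open>\<omega>\<close>. It depends on
  the frame only.\<close>

definition skew_poly :: "real^2 \<Rightarrow> real poly" where
  "skew_poly s = (let
      k1 = D1 K s; k2 = D2 K s; m = laplace_K s;
      h11 = - m - 3 * D1 (D1 K) s + 3 * c1 s * k2; h12 = - 3 * c1 s * k1 - 3 * D1 (D2 K) s;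
      h21 = - 3 * D2 (D1 K) s + 3 * c2 s * k2; h22 = - m - 3 * D2 (D2 K) s - 3 * c2 s * k1;
      l1 = D1 laplace_K s - 3 * K s * k1; l2 = D2 laplace_K s - 3 * K s * k2;
      A = [:h11, 0, 30:]; B = [:h22, 0, 30:]; p = [:l1, - 15 * k2:]; q = [:l2, 15 * k1:]
    in [:m, 0, 6:] * (A * B - [:h12 * h21:])
       - [:3 * k1:] * ([:h12:] * q - p * B) - [:3 * k2:] * ([:h21:] * p - A * q))"

text \<open>The leading coefficient is \<open>6 * 30 * 30\<close>, since the terms with p and q
  have degree at most 3.\<close>

lemma skew_poly_nonzero: "skew_poly s \<noteq> 0" and degree_skew_poly: "degree (skew_poly s) \<le> 6"
proof -
  obtain a0 a1 a2 a3 a4 a5 where p: "skew_poly s = [:a0, a1, a2, a3, a4, a5, 5400:]"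
    unfolding skew_poly_def Let_def by simp
  show "skew_poly s \<noteq> 0" "degree (skew_poly s) \<le> 6"
    unfolding p by simp_all
qed

lemma skew_poly_root:
  assumes U: "open U" "U \<subseteq> S" and b: "riccati_form U b1 b2" and s: "s \<in> U"
  shows "poly (skew_poly s) (skew_part b1 b2 s) = 0"
proof -
  let ?w = "skew_part b1 b2"
  let ?c = "\<lambda>s. 6 * (?w s)\<^sup>2 - 3 * (b1 s * D1 K s + b2 s * D2 K s) + laplace_K s"
  have sm: "smooth_on U b1" "smooth_on U b2" using b by (auto simp: riccati_form_def)
  have d: "b1 differentiable at s" "b2 differentiable at s" "?w differentiable at s"
    "D1 K differentiable at s" "D2 K differentiable at s" "laplace_K differentiable at s"
    using sm s U smooth_D[OF open_S subset_refl smooth_K] smooth_skew_part[OF U b] smooth_laplace_K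
    by (auto intro: smooth_on_differentiable)
  note r = riccati_formD[OF b s] and w = skew_part_derivative[OF U b s]
    and c0 = skew_part_constraint[OF U b]
  have "D1 ?c s = D1 (\<lambda>s. 0) s" "D2 ?c s = D2 (\<lambda>s. 0) s"
    by (rule along_cong[OF U(1) s], simp only: c0)+
  then have lin: "(30 * (?w s)\<^sup>2 - laplace_K s - 3 * D1 (D1 K) s + 3 * c1 s * D2 K s) * b1 s
      + (- 3 * c1 s * D1 K s - 3 * D1 (D2 K) s) * b2 s
      - 15 * D2 K s * ?w s + D1 laplace_K s - 3 * K s * D1 K s = 0"
    "(- 3 * D2 (D1 K) s + 3 * c2 s * D2 K s) * b1 s
      + (30 * (?w s)\<^sup>2 - laplace_K s - 3 * D2 (D2 K) s - 3 * c2 s * D1 K s) * b2 s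
      + 15 * D1 K s * ?w s + D2 laplace_K s - 3 * K s * D2 K s = 0"
    using c0[OF s] by (simp_all add: along_simps d r w) algebra+
  show ?thesis
    using lin c0[OF s] unfolding skew_poly_def Let_def
    by simp algebra
qed

end

section \<open>Finiteness of the initial values when the curvature varies\<close>

text \<open>A finite form of the Baire category theorem: the open set is shrunk once for each
  index.\<close>

lemma dense_open_finite_intersection:
  fixes Ob :: "'a::topological_space set"
  assumes "finite I" "open Ob" "Ob \<noteq> {}"
    and dense: "\<And>i W. i \<in> I \<Longrightarrow> open W \<Longrightarrow> W \<noteq> {} \<Longrightarrow> W \<subseteq> Ob \<Longrightarrow> \<exists>s\<in>W. s \<in> G i"
    and op: "\<And>i. i \<in> I \<Longrightarrow> open (G i \<inter> Ob)"
  shows "\<exists>W. open W \<and> W \<noteq> {} \<and> W \<subseteq> Ob \<and> (\<forall>i\<in>I. W \<subseteq> G i)"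
  using assms(1) dense op
proof (induction I rule: finite_induct)
  case empty
  then show ?case using assms(2,3) by blast
next
  case (insert i I)
  then obtain W where W: "open W" "W \<noteq> {}" "W \<subseteq> Ob" "\<forall>i\<in>I. W \<subseteq> G i"
    by (metis insertCI)
  then obtain s where "s \<in> W" "s \<in> G i" using insert.prems(1)[of i W] by auto
  moreover have "W \<inter> G i = W \<inter> (G i \<inter> Ob)" using W(3) by auto
  ultimately have "open (W \<inter> G i)" "W \<inter> G i \<noteq> {}"
    using W(1) insert.prems(2)[of i] by auto
  then show ?case
    using W by (intro exI[of _ "W \<inter> G i"]) auto
qed

context moving_frame
begin

lemma riccati_form_subset: "riccati_form U b1 b2 \<Longrightarrow> W \<subseteq> U \<Longrightarrow> riccati_form W b1 b2"
  unfolding riccati_form_def by (auto intro: smooth_on_subset)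

lemma derivative_eq_0I:
  assumes "f differentiable at s" "s \<in> S" "D1 f s = 0" "D2 f s = 0"
  shows "(f has_derivative (\<lambda>v. 0)) (at s)"
proof -
  have 1: "e1 s $ 1 * pderiv_at 1 f s + e1 s $ 2 * pderiv_at 2 f s = 0"
    "e2 s $ 1 * pderiv_at 1 f s + e2 s $ 2 * pderiv_at 2 f s = 0"
    using assms by (simp_all add: along_components)
  then have "(e1 s $ 1 * e2 s $ 2 - e1 s $ 2 * e2 s $ 1) * pderiv_at 1 f s = 0"
    "(e1 s $ 1 * e2 s $ 2 - e1 s $ 2 * e2 s $ 1) * pderiv_at 2 f s = 0"
    by algebra+
  then have 0: "pderiv_at 1 f s = 0" "pderiv_at 2 f s = 0"
    using frame_independent[OF assms(2)] by simp_all
  have "frechet_derivative f (at s) v = 0" for v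
    using along_components[OF assms(1), of "\<lambda>_. v"] 0 by (simp add: along_def)
  then have "frechet_derivative f (at s) = (\<lambda>v. 0)" by auto
  then show ?thesis using differentiable_has_derivative[OF assms(1)] by simp
qed

lemma constant_K_iff:
  assumes U: "open U" "U \<subseteq> S" "convex U"
  shows "K constant_on U \<longleftrightarrow> (\<forall>s\<in>U. D1 K s = 0 \<and> D2 K s = 0)"
proof
  assume "K constant_on U"
  then obtain k where "\<And>s. s \<in> U \<Longrightarrow> K s = k" by (auto simp: constant_on_def)
  then show "\<forall>s\<in>U. D1 K s = 0 \<and> D2 K s = 0"
    using along_cong[OF U(1), of _ K "\<lambda>_. k"] by simp
next
  assume *: "\<forall>s\<in>U. D1 K s = 0 \<and> D2 K s = 0"
  have "(K has_derivative (\<lambda>v. 0)) (at s within U)" if "s \<in> U" for s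
    using * U(2) that smooth_on_differentiable[OF smooth_K, of s]
    by - (rule has_derivative_at_withinI, rule derivative_eq_0I, auto)
  from has_derivative_zero_constant[OF U(3) this]
  show "K constant_on U" by (auto simp: constant_on_def)
qed

text \<open>When K is constant the algebraic constraint reduces to \<open>6 \<omega>\<^sup>2 =
  0\<close>.\<close>

lemma skew_part_vanishes:
  assumes U: "open U" "U \<subseteq> S" and K: "\<And>s. s \<in> U \<Longrightarrow> D1 K s = 0 \<and> D2 K s = 0"
    and b: "riccati_form U b1 b2" and s: "s \<in> U"
  shows "skew_part b1 b2 s = 0"
proof -
  have "D1 (D1 K) s = 0" "D2 (D2 K) s = 0"
    using along_cong[OF U(1) s, of "D1 K" "\<lambda>_. 0"] along_cong[OF U(1) s, of "D2 K" "\<lambda>_. 0"] K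
    by simp_all
  then show ?thesis
    using skew_part_constraint[OF U b s] K[OF s] by (simp add: laplace_K_def)
qed

text \<open>If two solutions share \<open>\<omega>\<close>, subtracting the formulas for its
  derivative leaves \<open>3 \<omega> (\<beta> - \<beta>') = 0\<close>. Where the forms differ
  everywhere, \<open>\<omega>\<close> vanishes identically, and then the same formulas say that
  the differential of K vanishes.\<close>

lemma equal_skew_part_imp_flat_K:
  assumes W: "open W" "W \<subseteq> S" and b: "riccati_form W b1 b2" and b': "riccati_form W b1' b2'"
    and eq: "\<And>s. s \<in> W \<Longrightarrow> skew_part b1 b2 s = skew_part b1' b2' s"
    and neq: "\<And>s. s \<in> W \<Longrightarrow> b1 s \<noteq> b1' s \<or> b2 s \<noteq> b2' s" and s: "s \<in> W"
  shows "D1 K s = 0 \<and> D2 K s = 0"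
proof -
  have 0: "skew_part b1 b2 s = 0" if s: "s \<in> W" for s
  proof -
    have "D1 (skew_part b1 b2) s = D1 (skew_part b1' b2') s" "D2 (skew_part b1 b2) s = D2 (skew_part b1' b2') s"
      by (rule along_cong[OF W(1) s eq], assumption)+
    then show ?thesis
      using skew_part_derivative[OF W b s] skew_part_derivative[OF W b' s] eq[OF s] neq[OF s] by auto
  qed
  have "D1 (skew_part b1 b2) s = D1 (\<lambda>_. 0) s" "D2 (skew_part b1 b2) s = D2 (\<lambda>_. 0) s"
    by (rule along_cong[OF W(1) s 0], assumption)+
  then show ?thesis
    using skew_part_derivative[OF W b s] 0[OF s] by simp
qed

text \<open>Suppose seven solutions have different values at s0. They stay different near s0, and
  K is not constant there, so they can be compared on an open set where the differential of K does
  not vanish. On no open part of it can two of them share \<open>\<omega>\<close>, so at some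
  point the seven values of \<open>\<omega>\<close> are distinct. But they are roots of one
  polynomial of degree at most 6.\<close>

lemma finite_riccati_values:
  assumes s0: "s0 \<in> S" and nc: "\<not> (\<exists>U. open U \<and> s0 \<in> U \<and> U \<subseteq> S \<and> K constant_on U)"
  shows "finite {(b1 s0, b2 s0) | b1 b2. \<exists>U. open U \<and> s0 \<in> U \<and> U \<subseteq> S \<and> riccati_form U b1 b2}"
    (is "finite ?B")
proof (rule ccontr)
  assume "infinite ?B"
  then obtain T where T: "finite T" "card T = 7" "T \<subseteq> ?B"
    using infinite_arbitrarily_large by blast
  define data where "data t z \<longleftrightarrow> (case z of (U, b1, b2) \<Rightarrow>
      t = (b1 s0, b2 s0) \<and> open U \<and> s0 \<in> U \<and> U \<subseteq> S \<and> riccati_form U b1 b2)" for t z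
  define z where "z t = (SOME z. data t z)" for t
  have z: "data t (z t)" if "t \<in> T" for t
  proof -
    obtain b1 b2 U where "t = (b1 s0, b2 s0)" "open U" "s0 \<in> U" "U \<subseteq> S" "riccati_form U b1 b2"
      using \<open>t \<in> T\<close> T(3) by blast
    then have "data t (U, b1, b2)" by (simp add: data_def)
    then show ?thesis unfolding z_def by (rule someI)
  qed
  define U b1 b2 where "U t = fst (z t)" and "b1 t = fst (snd (z t))" and "b2 t = snd (snd (z t))" for t
  have zT: "t = (b1 t s0, b2 t s0)" "open (U t)" "s0 \<in> U t" "U t \<subseteq> S" "riccati_form (U t) (b1 t) (b2 t)"
    if "t \<in> T" for t
    using z[OF that] by (auto simp: data_def U_def b1_def b2_def split: prod.splits)
  define V where "V = S \<inter> (\<Inter>t\<in>T. U t)"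
  have V: "open V" "s0 \<in> V" "V \<subseteq> S" "\<And>t. t \<in> T \<Longrightarrow> V \<subseteq> U t"
    using zT T(1) s0 open_S by (auto simp: V_def intro!: open_Int open_INT)
  have ric: "riccati_form V (b1 t) (b2 t)" if "t \<in> T" for t
    using riccati_form_subset zT(5) V(4) that by blast
  have cont: "continuous_on V (b1 t)" "continuous_on V (b2 t)" if "t \<in> T" for t
    using ric[OF that] by (auto simp: riccati_form_def intro: smooth_on_continuous_on)
  have sep: "open {s \<in> V. (b1 t s, b2 t s) \<noteq> (b1 t' s, b2 t' s)}" if "t \<in> T" "t' \<in> T" for t t'
  proof -
    have "open {s \<in> V. f s \<noteq> g s}" if "continuous_on V f" "continuous_on V g" for f g :: "real^2 \<Rightarrow> real \<times> real"
    proof -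
      have "continuous_on V (\<lambda>s. dist (f s) (g s))" using that by (intro continuous_intros)
      from open_superlevel[OF V(1) this] show ?thesis by simp
    qed
    from this[OF continuous_on_Pair[OF cont[OF that(1)]] continuous_on_Pair[OF cont[OF that(2)]]]
    show ?thesis .
  qed
  define V' where "V' = V \<inter> (\<Inter>(t, t') \<in> {(t, t') \<in> T \<times> T. t \<noteq> t'}. {s \<in> V. (b1 t s, b2 t s) \<noteq> (b1 t' s, b2 t' s)})"
  have fin: "finite {(t, t') \<in> T \<times> T. t \<noteq> t'}" by (rule finite_subset[of _ "T \<times> T"]) (use T(1) in auto)
  have "open V'" unfolding V'_def using V(1) fin sep by (intro open_Int open_INT) auto
  moreover have "s0 \<in> V'" unfolding V'_def using V(2) zT(1) by auto
  ultimately obtain r where r: "r > 0" "ball s0 r \<subseteq> V'" using openE by blast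
  have neq: "b1 t s \<noteq> b1 t' s \<or> b2 t s \<noteq> b2 t' s" if "s \<in> ball s0 r" "t \<in> T" "t' \<in> T" "t \<noteq> t'" for s t t'
    using that r(2) unfolding V'_def by blast
  have BS: "ball s0 r \<subseteq> V" using r(2) by (auto simp: V'_def)
  define Ob where "Ob = {s \<in> ball s0 r. (D1 K s, D2 K s) \<noteq> (0, 0)}"
  have "continuous_on S (\<lambda>s. norm (D1 K s, D2 K s))"
    using smooth_D[OF open_S subset_refl smooth_K, THEN smooth_on_continuous_on]
    by (rule continuous_on_norm[OF continuous_on_Pair])
  from continuous_on_subset[OF this subset_trans[OF BS V(3)]]
  have "continuous_on (ball s0 r) (\<lambda>s. norm (D1 K s, D2 K s))" .
  from open_superlevel[OF open_ball this] have oO: "open Ob"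
    by (simp only: Ob_def zero_less_norm_iff zero_prod_def)
  have "\<not> K constant_on ball s0 r"
    using nc r(1) BS V(3) by (metis centre_in_ball open_ball subset_trans)
  then have nO: "Ob \<noteq> {}"
    using constant_K_iff[OF open_ball _ convex_ball, of s0 r] BS V(3) by (auto simp: Ob_def)
  define w where "w t = skew_part (b1 t) (b2 t)" for t
  have OV: "Ob \<subseteq> V" using BS by (auto simp: Ob_def)
  have "\<exists>W. open W \<and> W \<noteq> {} \<and> W \<subseteq> Ob \<and> (\<forall>i\<in>{(t, t') \<in> T \<times> T. t \<noteq> t'}. W \<subseteq> {s. w (fst i) s \<noteq> w (snd i) s})"
  proof (rule dense_open_finite_intersection[OF fin oO nO])
    fix i W assume i: "i \<in> {(t, t') \<in> T \<times> T. t \<noteq> t'}" and W: "open W" "W \<noteq> {}" "W \<subseteq> Ob"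
    show "\<exists>s\<in>W. s \<in> {s. w (fst i) s \<noteq> w (snd i) s}"
    proof (rule ccontr)
      assume "\<not> ?thesis"
      then have eq: "\<And>s. s \<in> W \<Longrightarrow> w (fst i) s = w (snd i) s" by auto
      obtain s where s: "s \<in> W" using W(2) by auto
      have WV: "W \<subseteq> V" "W \<subseteq> S" using W(3) OV V(3) by auto
      obtain t t' where t: "i = (t, t')" "t \<in> T" "t' \<in> T" "t \<noteq> t'" using i by blast
      have WB: "W \<subseteq> ball s0 r" using W(3) by (auto simp: Ob_def)
      have "D1 K s = 0 \<and> D2 K s = 0"
      proof (rule equal_skew_part_imp_flat_K[OF W(1) WV(2) _ _ _ _ s])
        show "riccati_form W (b1 t) (b2 t)" "riccati_form W (b1 t') (b2 t')"
          using riccati_form_subset[OF ric WV(1)] t by blast+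
        show "skew_part (b1 t) (b2 t) x = skew_part (b1 t') (b2 t') x" if "x \<in> W" for x
          using eq[OF that] by (simp add: w_def t(1))
        show "b1 t x \<noteq> b1 t' x \<or> b2 t x \<noteq> b2 t' x" if "x \<in> W" for x
          using neq t(2-4) WB that by blast
      qed
      then show False using s W(3) by (auto simp: Ob_def)
    qed
  next
    fix i assume i: "i \<in> {(t, t') \<in> T \<times> T. t \<noteq> t'}"
    have "continuous_on Ob (w t)" if "t \<in> T" for t
      using smooth_skew_part[OF V(1,3) ric[OF that]] OV unfolding w_def
      by (meson smooth_on_continuous_on smooth_on_subset)
    then have "continuous_on Ob (\<lambda>s. dist (w (fst i) s) (w (snd i) s))" using i by (intro continuous_intros) auto
    from open_superlevel[OF oO this]
    show "open ({s. w (fst i) s \<noteq> w (snd i) s} \<inter> Ob)" by (simp add: Int_def conj_commute)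
  qed
  then obtain s where s: "s \<in> Ob" "\<And>t t'. t \<in> T \<Longrightarrow> t' \<in> T \<Longrightarrow> t \<noteq> t' \<Longrightarrow> w t s \<noteq> w t' s" by fastforce
  then have "inj_on (\<lambda>t. w t s) T" by (meson inj_onI)
  then have "card ((\<lambda>t. w t s) ` T) = 7" using T(2) by (simp add: card_image)
  moreover have "(\<lambda>t. w t s) ` T \<subseteq> {x. poly (skew_poly s) x = 0}"
    using skew_poly_root[OF V(1,3) ric] s(1) OV by (auto simp: w_def)
  ultimately have "7 \<le> card {x. poly (skew_poly s) x = 0}"
    using card_mono[OF poly_roots_finite[OF skew_poly_nonzero]] by metis
  also have "\<dots> \<le> 6"
    using card_poly_roots_bound[OF skew_poly_nonzero, of s] degree_skew_poly[of s] by simp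
  finally show False by simp
qed

end

section \<open>Closed one-forms\<close>

text \<open>The primitive is the integral of the form along the segments from s0. Differentiating
  under the integral sign and using closedness turns the i-th partial derivative of the integrand
  into the derivative of \<open>t\<close> times the i-th component along the segment.\<close>

lemma poincare_plane:
  fixes p q :: "real^2 \<Rightarrow> real"
  assumes U: "open U" "convex U" "s0 \<in> U" and p: "smooth_on U p" and q: "smooth_on U q"
    and closed: "\<And>s. s \<in> U \<Longrightarrow> pderiv_at 1 q s = pderiv_at 2 p s"
  obtains h where "\<And>s. s \<in> U \<Longrightarrow> (h has_derivative (\<lambda>v. p s * v $ 1 + q s * v $ 2)) (at s)" "h s0 = 0"
proof -
  define \<gamma> where "\<gamma> s t = s0 + t *\<^sub>R (s - s0)" for s :: "real^2" and t :: real
  have \<gamma>: "\<gamma> s t \<in> U" if "s \<in> U" "t \<in> cbox 0 1" for s t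
  proof -
    have "\<gamma> s t = (1 - t) *\<^sub>R s0 + t *\<^sub>R s" by (simp add: \<gamma>_def algebra_simps)
    then show ?thesis using that convexD[OF U(2,3) that(1), of "1 - t" t] by simp
  qed
  have cont: "continuous_on (U \<times> cbox 0 1) (\<lambda>(s, t). f (\<gamma> s t))" if "continuous_on U f" for f :: "real^2 \<Rightarrow> real"
  proof -
    have "continuous_on (U \<times> cbox 0 1) (\<lambda>z. f (\<gamma> (fst z) (snd z)))"
      by (rule continuous_on_compose2[OF that]) (auto simp: \<gamma>_def intro!: continuous_intros \<gamma>[unfolded \<gamma>_def])
    then show ?thesis by (simp add: split_beta)
  qed
  have der: "((\<lambda>t. f (\<gamma> s t)) has_real_derivative
      (s - s0) $ 1 * pderiv_at 1 f (\<gamma> s t) + (s - s0) $ 2 * pderiv_at 2 f (\<gamma> s t)) (at t within A)"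
    if "smooth_on U f" "s \<in> U" "t \<in> cbox 0 1" for f s t A
  proof -
    have f: "(f has_derivative frechet_derivative f (at (\<gamma> s t))) (at (\<gamma> s t))"
      using smooth_on_has_derivative[OF that(1) \<gamma>[OF that(2,3)]] .
    have "((\<lambda>t. \<gamma> s t) has_derivative (\<lambda>x. x *\<^sub>R (s - s0))) (at t within A)"
      unfolding \<gamma>_def by (auto intro!: derivative_eq_intros)
    from has_derivative_compose[OF this f]
    have 1: "((\<lambda>t. f (\<gamma> s t)) has_derivative (\<lambda>x. frechet_derivative f (at (\<gamma> s t)) (x *\<^sub>R (s - s0)))) (at t within A)" .
    have "frechet_derivative f (at (\<gamma> s t)) (x *\<^sub>R (s - s0)) =
      ((s - s0) $ 1 * pderiv_at 1 f (\<gamma> s t) + (s - s0) $ 2 * pderiv_at 2 f (\<gamma> s t)) * x" for x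
      using along_components[OF differentiableI[OF f], of "\<lambda>_. s - s0"]
        linear_cmul[OF has_derivative_linear[OF f], of x "s - s0"]
      by (simp add: along_def mult.commute)
    then show ?thesis using 1 by (simp add: has_field_derivative_def)
  qed
  have der2: "((\<lambda>s. f (\<gamma> s t)) has_derivative
      (\<lambda>v. t * (v $ 1 * pderiv_at 1 f (\<gamma> s t) + v $ 2 * pderiv_at 2 f (\<gamma> s t)))) (at s within A)"
    if "smooth_on U f" "s \<in> U" "t \<in> cbox 0 1" for f s t A
  proof -
    have f: "(f has_derivative frechet_derivative f (at (\<gamma> s t))) (at (\<gamma> s t))"
      using smooth_on_has_derivative[OF that(1) \<gamma>[OF that(2,3)]] .
    have "((\<lambda>s. \<gamma> s t) has_derivative (\<lambda>x. t *\<^sub>R x)) (at s within A)"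
      unfolding \<gamma>_def by (auto intro!: derivative_eq_intros)
    from has_derivative_compose[OF this f]
    have 1: "((\<lambda>s. f (\<gamma> s t)) has_derivative (\<lambda>x. frechet_derivative f (at (\<gamma> s t)) (t *\<^sub>R x))) (at s within A)" .
    have "frechet_derivative f (at (\<gamma> s t)) (t *\<^sub>R v) =
      t * (v $ 1 * pderiv_at 1 f (\<gamma> s t) + v $ 2 * pderiv_at 2 f (\<gamma> s t))" for v
      using along_components[OF differentiableI[OF f], of "\<lambda>_. v"]
        linear_cmul[OF has_derivative_linear[OF f], of t v]
      by (simp add: along_def)
    then show ?thesis using 1 by simp
  qed
  define B where "B i = blinfun_inner_right (axis i 1 :: real^2)" for i
  have B: "blinfun_apply (B i) v = v $ i" for i v
    by (simp add: B_def inner_axis' )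
  define F where "F s t = p (\<gamma> s t) * (s - s0) $ 1 + q (\<gamma> s t) * (s - s0) $ 2" for s t
  define a where "a f i s t = f (\<gamma> s t) + t * ((s - s0) $ 1 * pderiv_at i p (\<gamma> s t) + (s - s0) $ 2 * pderiv_at i q (\<gamma> s t))"
    for f i s t
  define h where "h s = integral (cbox 0 1) (F s)" for s
  have contp: "continuous_on U p" "continuous_on U q" "\<And>i. continuous_on U (pderiv_at i p)" "\<And>i. continuous_on U (pderiv_at i q)"
    using p q smooth_on_continuous_on smooth_on_pderiv_at by blast+
  have conta: "continuous_on (U \<times> cbox 0 1) (\<lambda>(s, t). a f i s t)" if "continuous_on U f" for f i
    using cont[OF that] contp(3,4)[THEN cont, of i] unfolding a_def split_beta
    by (intro continuous_intros) (auto simp: split_beta)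
  have inta: "integral (cbox 0 1) (a p 1 s) = p s" "integral (cbox 0 1) (a q 2 s) = q s" if "s \<in> U" for s
  proof -
    have "((\<lambda>t. a f i s t) has_integral 1 * f (\<gamma> s 1) - 0 * f (\<gamma> s 0)) (cbox 0 1)"
      if f: "smooth_on U f" and i: "\<And>z. z \<in> U \<Longrightarrow> pderiv_at i p z = pderiv_at 1 f z" "\<And>z. z \<in> U \<Longrightarrow> pderiv_at i q z = pderiv_at 2 f z" for f i
      unfolding cbox_interval
    proof (rule fundamental_theorem_of_calculus)
      fix t :: real assume t: "t \<in> {0..1}"
      have "((\<lambda>t. t * f (\<gamma> s t)) has_real_derivative
          t * ((s - s0) $ 1 * pderiv_at 1 f (\<gamma> s t) + (s - s0) $ 2 * pderiv_at 2 f (\<gamma> s t)) + 1 * f (\<gamma> s t)) (at t within {0..1})"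
        by (rule DERIV_mult'[OF DERIV_ident der[OF f \<open>s \<in> U\<close>]]) (use t in auto)
      then show "((\<lambda>t. t * f (\<gamma> s t)) has_vector_derivative a f i s t) (at t within {0..1})"
        using i[OF \<gamma>[OF \<open>s \<in> U\<close>]] t
        by (simp add: a_def has_real_derivative_iff_has_vector_derivative add.commute)
    qed simp
    from this[OF p, of 1] this[OF q, of 2] closed
    have "(a p 1 s has_integral p s) (cbox 0 1)" "(a q 2 s has_integral q s) (cbox 0 1)"
      by (auto simp: \<gamma>_def)
    then show "integral (cbox 0 1) (a p 1 s) = p s" "integral (cbox 0 1) (a q 2 s) = q s"
      by (auto intro: integral_unique)
  qed
  have "(h has_derivative (\<lambda>v. p s * v $ 1 + q s * v $ 2)) (at s)" if s: "s \<in> U" for s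
  proof -
    have "((\<lambda>s. integral (cbox 0 1) (F s)) has_derivative
      blinfun_apply (integral (cbox 0 1) (\<lambda>t. a p 1 s t *\<^sub>R B 1 + a q 2 s t *\<^sub>R B 2))) (at s within U)"
    proof (rule leibniz_rule[OF _ _ _ s U(2)])
      fix s t assume st: "s \<in> U" "t \<in> cbox (0::real) 1"
      show "((\<lambda>s. F s t) has_derivative blinfun_apply (a p 1 s t *\<^sub>R B 1 + a q 2 s t *\<^sub>R B 2)) (at s within U)"
      proof -
        have c: "((\<lambda>s. (s - s0) $ i) has_derivative (\<lambda>v. v $ i)) (at s within U)" for i
          by (auto intro!: derivative_eq_intros bounded_linear.has_derivative[OF bounded_linear_vec_nth])
        show ?thesis
          unfolding F_def
          by (rule has_derivative_eq_rhs[OF has_derivative_add[OF has_derivative_mult[OF der2[OF p st] c]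
                  has_derivative_mult[OF der2[OF q st] c]]])
            (simp only: fun_eq_iff blinfun.add_left blinfun.scaleR_left B,
              simp add: a_def closed \<gamma>[OF st] algebra_simps)
      qed
    next
      fix s assume "s \<in> U"
      then have "continuous_on (cbox 0 1) (\<lambda>t. f (\<gamma> s t))" if "continuous_on U f" for f :: "real^2 \<Rightarrow> real"
        by (intro continuous_on_compose2[OF that]) (auto simp: \<gamma>_def intro!: continuous_intros \<gamma>[unfolded \<gamma>_def])
      then show "F s integrable_on cbox 0 1"
        unfolding F_def[abs_def] using contp by (intro integrable_continuous continuous_intros) auto
    next
      show "continuous_on (U \<times> cbox 0 1) (\<lambda>(s, t). a p 1 s t *\<^sub>R B 1 + a q 2 s t *\<^sub>R B 2)"
        using conta[OF contp(1), of 1] conta[OF contp(2), of 2] unfolding split_beta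
        by (intro continuous_intros)
    qed
    moreover have "integral (cbox 0 1) (\<lambda>t. a p 1 s t *\<^sub>R B 1 + a q 2 s t *\<^sub>R B 2) = p s *\<^sub>R B 1 + q s *\<^sub>R B 2"
    proof -
      have "continuous_on (cbox 0 1) (a f i s)" if "continuous_on U f" for f i
        using continuous_on_compose2[OF conta[OF that, of i], of "cbox 0 1" "\<lambda>t. (s, t)"] s
        by (simp add: continuous_on_Pair[OF continuous_on_const continuous_on_id, unfolded id_def] image_subset_iff)
      then have "a p 1 s integrable_on cbox 0 1" "a q 2 s integrable_on cbox 0 1"
        using contp(1,2) by (blast intro: integrable_continuous)+
      then have "((\<lambda>t. a p 1 s t *\<^sub>R B 1 + a q 2 s t *\<^sub>R B 2) has_integral (p s *\<^sub>R B 1 + q s *\<^sub>R B 2)) (cbox 0 1)"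
        using inta[OF s] by (intro has_integral_add has_integral_scaleR_left) (auto simp: has_integral_integral)
      then show ?thesis by (rule integral_unique)
    qed
    moreover have "blinfun_apply (p s *\<^sub>R B 1 + q s *\<^sub>R B 2) = (\<lambda>v. p s * v $ 1 + q s * v $ 2)"
      by (auto simp: fun_eq_iff blinfun.add_left blinfun.scaleR_left B)
    ultimately have "(h has_derivative (\<lambda>v. p s * v $ 1 + q s * v $ 2)) (at s within U)"
      unfolding h_def by (simp only:)
    then show ?thesis
      by (simp only: at_within_open[OF s U(1)])
  qed
  moreover have "h s0 = 0" by (simp add: h_def F_def[abs_def])
  ultimately show ?thesis using that by blast
qed

text \<open>The closedness condition is the bracket relation that a primitive would have to
  satisfy; it is translated to the coordinate components p and q of the form.\<close>

lemma (in moving_frame) poincare_frame: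
  assumes U: "open U" "convex U" "s0 \<in> U" "U \<subseteq> S" and f: "smooth_on U f1" "smooth_on U f2"
    and closed: "\<And>s. s \<in> U \<Longrightarrow> D1 f2 s - D2 f1 s = - c1 s * f1 s - c2 s * f2 s"
  obtains h where "smooth_on U h" "\<And>s. s \<in> U \<Longrightarrow> D1 h s = f1 s" "\<And>s. s \<in> U \<Longrightarrow> D2 h s = f2 s" "h s0 = 0"
proof -
  define d where "d s = e1 s $ 1 * e2 s $ 2 - e1 s $ 2 * e2 s $ 1" for s
  define p where "p s = (f1 s * e2 s $ 2 - f2 s * e1 s $ 2) / d s" for s
  define q where "q s = (e1 s $ 1 * f2 s - e2 s $ 1 * f1 s) / d s" for s
  have d: "d s \<noteq> 0" if "s \<in> U" for s using frame_independent that U(4) by (auto simp: d_def)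
  note e = smooth_e[THEN smooth_on_subset[OF _ U(4)]]
  have sd: "smooth_on U d" unfolding d_def[abs_def] using e U(1) by (intro smooth_intros)
  have sp: "smooth_on U p" "smooth_on U q"
    unfolding p_def[abs_def] q_def[abs_def] using e U(1) sd d f by (intro smooth_intros; simp)+
  have f12: "f1 s = p s * e1 s $ 1 + q s * e1 s $ 2" "f2 s = p s * e2 s $ 1 + q s * e2 s $ 2"
    if "s \<in> U" for s
    using d[OF that] by (simp_all add: p_def q_def field_simps) (simp_all add: d_def algebra_simps)
  have e_bracket: "D1 (\<lambda>s. e2 s $ i) s - D2 (\<lambda>s. e1 s $ i) s = - c1 s * e1 s $ i - c2 s * e2 s $ i" if "s \<in> U" for s i
  proof -
    have "along e (\<lambda>s. s $ i) = (\<lambda>s. e s $ i)" for e :: "real^2 \<Rightarrow> real^2"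
      by (rule ext, rule along_eqI) (simp add: bounded_linear_imp_has_derivative bounded_linear_vec_nth)
    then show ?thesis using bracket[OF U(1,4) smooth_on_coord[OF U(1)] that, of i] by simp
  qed
  have "pderiv_at 1 q s = pderiv_at 2 p s" if s: "s \<in> U" for s
  proof -
    have diff: "p differentiable at s" "q differentiable at s" "(\<lambda>s. e1 s $ i) differentiable at s"
       "(\<lambda>s. e2 s $ i) differentiable at s" for i
      using sp e smooth_on_differentiable s by blast+
    have "D1 f2 s = D1 (\<lambda>s. p s * e2 s $ 1 + q s * e2 s $ 2) s" "D2 f1 s = D2 (\<lambda>s. p s * e1 s $ 1 + q s * e1 s $ 2) s"
      by (rule along_cong[OF U(1) s], simp only: f12)+
    then have "d s * (pderiv_at 1 q s - pderiv_at 2 p s) = 0"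
      using closed[OF s] e_bracket[OF s, of 1] e_bracket[OF s, of 2] f12[OF s]
      by (simp add: along_simps diff along_components[OF diff(1)] along_components[OF diff(2)] d_def) algebra
    then show ?thesis using d[OF s] by simp
  qed
  from poincare_plane[OF U(1-3) sp this] obtain h where
    h: "\<And>s. s \<in> U \<Longrightarrow> (h has_derivative (\<lambda>v. p s * v $ 1 + q s * v $ 2)) (at s)" "h s0 = 0" by blast
  have "smooth_on U h"
  proof (rule smooth_onI)
    show "h differentiable at s" if "s \<in> U" for s using h(1)[OF that] by (rule differentiableI)
    fix v :: "real^2"
    have "smooth_on U (\<lambda>s. p s * v $ 1 + q s * v $ 2)" using sp U(1) by (intro smooth_intros)
    then show "smooth_on U (\<lambda>s. frechet_derivative h (at s) v)"
      by (rule smooth_on_cong[OF U(1), rotated]) (simp add: frechet_derivative_at[OF h(1), symmetric])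
  qed
  moreover have "D1 h s = f1 s" "D2 h s = f2 s" if "s \<in> U" for s
    using along_eqI[OF h(1)[OF that]] f12[OF that] by simp_all
  ultimately show ?thesis using that h(2) by blast
qed

section \<open>Twisted Killing fields\<close>

context moving_frame
begin

text \<open>The quadratic form of the symmetrized covariant derivative of W, evaluated on the
  vector with components u, v. Up to the sign it is the Poisson bracket of the linear momentum
  function of W with the geodesic Hamiltonian.\<close>

definition sym_derivative :: "(real^2 \<Rightarrow> real) \<Rightarrow> (real^2 \<Rightarrow> real) \<Rightarrow> real^2 \<Rightarrow> real \<Rightarrow> real \<Rightarrow> real" where
  "sym_derivative W1 W2 s u v = (D1 W1 s - c1 s * W2 s) * u\<^sup>2
     + (D1 W2 s + D2 W1 s + c1 s * W1 s - c2 s * W2 s) * (u * v) + (D2 W2 s + c2 s * W1 s) * v\<^sup>2"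

text \<open>The symmetrized derivative of W is minus the symmetric product of the one-form (a1,
  a2) with W; for \<open>a1 = a2 = 0\<close> this is Killing's equation.\<close>

definition twisted_killing ::
    "(real^2) set \<Rightarrow> (real^2 \<Rightarrow> real) \<Rightarrow> (real^2 \<Rightarrow> real) \<Rightarrow> (real^2 \<Rightarrow> real) \<Rightarrow> (real^2 \<Rightarrow> real) \<Rightarrow> bool" where
  "twisted_killing U a1 a2 W1 W2 \<longleftrightarrow> (\<forall>s\<in>U. \<forall>u v.
     sym_derivative W1 W2 s u v = - (a1 s * u + a2 s * v) * (W1 s * u + W2 s * v))"

lemma quadratic_form_eq_0:
  fixes a b c :: real
  assumes "\<And>u v. a * u\<^sup>2 + b * (u * v) + c * v\<^sup>2 = 0"
  shows "a = 0 \<and> b = 0 \<and> c = 0"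
  using assms[of 1 0] assms[of 0 1] assms[of 1 1] by simp

lemma twisted_killing_iff:
  "twisted_killing U a1 a2 W1 W2 \<longleftrightarrow> (\<forall>s\<in>U.
     D1 W1 s = - a1 s * W1 s + c1 s * W2 s \<and>
     D2 W2 s = - c2 s * W1 s - a2 s * W2 s \<and>
     D1 W2 s + D2 W1 s = - (a1 s * W2 s + a2 s * W1 s) - c1 s * W1 s + c2 s * W2 s)"
proof -
  have "(\<forall>u v. sym_derivative W1 W2 s u v = - (a1 s * u + a2 s * v) * (W1 s * u + W2 s * v)) \<longleftrightarrow>
     D1 W1 s = - a1 s * W1 s + c1 s * W2 s \<and>
     D2 W2 s = - c2 s * W1 s - a2 s * W2 s \<and>
     D1 W2 s + D2 W1 s = - (a1 s * W2 s + a2 s * W1 s) - c1 s * W1 s + c2 s * W2 s" (is "?L \<longleftrightarrow> ?R") for s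
  proof
    assume ?L
    then have "(D1 W1 s - c1 s * W2 s + a1 s * W1 s) * u\<^sup>2
        + (D1 W2 s + D2 W1 s + c1 s * W1 s - c2 s * W2 s + a1 s * W2 s + a2 s * W1 s) * (u * v)
        + (D2 W2 s + c2 s * W1 s + a2 s * W2 s) * v\<^sup>2 = 0" for u v
      unfolding sym_derivative_def by (simp add: algebra_simps power2_eq_square)
    from quadratic_form_eq_0[OF this] show ?R by (simp add: algebra_simps)
  next
    assume R: ?R
    show ?L
    proof (intro allI)
      fix u v
      show "sym_derivative W1 W2 s u v = - (a1 s * u + a2 s * v) * (W1 s * u + W2 s * v)"
        using R unfolding sym_derivative_def by (elim conjE) algebra
    qed
  qed
  then show ?thesis unfolding twisted_killing_def by simp
qed

lemma twisted_killing_subset: "twisted_killing U a1 a2 W1 W2 \<Longrightarrow> V \<subseteq> U \<Longrightarrow> twisted_killing V a1 a2 W1 W2"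
  unfolding twisted_killing_def by blast

lemma twisted_killing_add:
  assumes W: "twisted_killing U a1 a2 W1 W2" and Z: "twisted_killing U a1 a2 Z1 Z2" and U: "open U"
    and sm: "smooth_on U W1" "smooth_on U W2" "smooth_on U Z1" "smooth_on U Z2"
  shows "twisted_killing U a1 a2 (\<lambda>s. m * W1 s + n * Z1 s) (\<lambda>s. m * W2 s + n * Z2 s)"
  unfolding twisted_killing_iff
proof (intro ballI)
  fix s assume s: "s \<in> U"
  have d: "W1 differentiable at s" "W2 differentiable at s" "Z1 differentiable at s" "Z2 differentiable at s"
    using sm s by (auto intro: smooth_on_differentiable)
  note w = W[unfolded twisted_killing_iff, rule_format, OF s] Z[unfolded twisted_killing_iff, rule_format, OF s]
  show "D1 (\<lambda>s. m * W1 s + n * Z1 s) s = - a1 s * (m * W1 s + n * Z1 s) + c1 s * (m * W2 s + n * Z2 s) \<and>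
      D2 (\<lambda>s. m * W2 s + n * Z2 s) s = - c2 s * (m * W1 s + n * Z1 s) - a2 s * (m * W2 s + n * Z2 s) \<and>
      D1 (\<lambda>s. m * W2 s + n * Z2 s) s + D2 (\<lambda>s. m * W1 s + n * Z1 s) s =
      - (a1 s * (m * W2 s + n * Z2 s) + a2 s * (m * W1 s + n * Z1 s)) - c1 s * (m * W1 s + n * Z1 s) + c2 s * (m * W2 s + n * Z2 s)"
    using w by (simp only: along_simps d mult_zero_left add_0_right) (elim conjE, intro conjI; (algebra | simp add: algebra_simps))
qed

text \<open>The one-form changes by the logarithmic differential of the factor, so a pair of
  fields with a common one-form keeps this property when both are multiplied by the same
  function.\<close>

lemma twisted_killing_scale:
  assumes W: "twisted_killing U a1 a2 W1 W2"
    and sm: "smooth_on U f" "smooth_on U W1" "smooth_on U W2" and f: "\<And>s. s \<in> U \<Longrightarrow> f s \<noteq> 0"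
  shows "twisted_killing U (\<lambda>s. a1 s - D1 f s / f s) (\<lambda>s. a2 s - D2 f s / f s) (\<lambda>s. f s * W1 s) (\<lambda>s. f s * W2 s)"
  unfolding twisted_killing_iff
proof (intro ballI)
  fix s assume s: "s \<in> U"
  have d: "f differentiable at s" "W1 differentiable at s" "W2 differentiable at s"
    using sm s by (auto intro: smooth_on_differentiable)
  note w = W[unfolded twisted_killing_iff, rule_format, OF s]
  define q1 q2 where "q1 = D1 f s / f s" and "q2 = D2 f s / f s"
  have q: "D1 f s = q1 * f s" "D2 f s = q2 * f s" using f[OF s] by (simp_all add: q1_def q2_def)
  show "D1 (\<lambda>s. f s * W1 s) s = - (a1 s - D1 f s / f s) * (f s * W1 s) + c1 s * (f s * W2 s) \<and>
      D2 (\<lambda>s. f s * W2 s) s = - c2 s * (f s * W1 s) - (a2 s - D2 f s / f s) * (f s * W2 s) \<and>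
      D1 (\<lambda>s. f s * W2 s) s + D2 (\<lambda>s. f s * W1 s) s =
      - ((a1 s - D1 f s / f s) * (f s * W2 s) + (a2 s - D2 f s / f s) * (f s * W1 s)) - c1 s * (f s * W1 s) + c2 s * (f s * W2 s)"
    unfolding q1_def[symmetric] q2_def[symmetric]
    using w by (simp only: along_simps d q) (elim conjE, intro conjI; (algebra | simp add: algebra_simps))
qed

text \<open>The identity says that \<open>Y T\<^sub>X = X T\<^sub>Y\<close> as cubic forms, with
  linear forms X and Y without common zero. Hence X divides \<open>T\<^sub>X\<close>, Y divides
  \<open>T\<^sub>Y\<close>, and the quotients coincide; the common quotient is the twisting
  form.\<close>

lemma twisted_killing_of_cubic:
  assumes U: "open U" "U \<subseteq> S"
    and sm: "smooth_on U X1" "smooth_on U X2" "smooth_on U Y1" "smooth_on U Y2"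
    and det: "\<And>s. s \<in> U \<Longrightarrow> X1 s * Y2 s - X2 s * Y1 s \<noteq> 0"
    and cubic: "\<And>s u v. s \<in> U \<Longrightarrow> (Y1 s * u + Y2 s * v) * sym_derivative X1 X2 s u v
        = (X1 s * u + X2 s * v) * sym_derivative Y1 Y2 s u v"
  obtains a1 a2 where "smooth_on U a1" "smooth_on U a2"
    "twisted_killing U a1 a2 X1 X2" "twisted_killing U a1 a2 Y1 Y2"
proof -
  define rX rY where "rX s = D1 X1 s - c1 s * X2 s" and "rY s = D1 Y1 s - c1 s * Y2 s" for s
  define nX nY where "nX s = D2 X2 s + c2 s * X1 s" and "nY s = D2 Y2 s + c2 s * Y1 s" for s
  define mX mY where "mX s = D1 X2 s + D2 X1 s + c1 s * X1 s - c2 s * X2 s"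
    and "mY s = D1 Y2 s + D2 Y1 s + c1 s * Y1 s - c2 s * Y2 s" for s
  \<comment> \<open>(rX, rY) is a multiple of (X1, Y1); projecting gives the factor by one formula
    that is smooth even where X1 or Y1 vanishes\<close>
  define a1 where "a1 s = - (rX s * X1 s + rY s * Y1 s) / ((X1 s)\<^sup>2 + (Y1 s)\<^sup>2)" for s
  define a2 where "a2 s = - (nX s * X2 s + nY s * Y2 s) / ((X2 s)\<^sup>2 + (Y2 s)\<^sup>2)" for s
  have pos: "(X1 s)\<^sup>2 + (Y1 s)\<^sup>2 \<noteq> 0" "(X2 s)\<^sup>2 + (Y2 s)\<^sup>2 \<noteq> 0" if "s \<in> U" for s
    using det[OF that] by (auto simp: sum_power2_eq_zero_iff)
  note D = smooth_D[OF U] and c = smooth_c[THEN smooth_on_subset[OF _ U(2)]]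
  have sr: "smooth_on U rX" "smooth_on U rY" "smooth_on U nX" "smooth_on U nY"
    unfolding rX_def[abs_def] rY_def[abs_def] nX_def[abs_def] nY_def[abs_def]
    by (intro smooth_intros D sm c U(1))+
  have sa: "smooth_on U a1" "smooth_on U a2"
    unfolding a1_def[abs_def] a2_def[abs_def] using pos
    by (intro smooth_intros sr sm U(1); simp)+
  have main: "rX s = - a1 s * X1 s \<and> rY s = - a1 s * Y1 s \<and> nX s = - a2 s * X2 s \<and> nY s = - a2 s * Y2 s
      \<and> mX s = - (a1 s * X2 s + a2 s * X1 s) \<and> mY s = - (a1 s * Y2 s + a2 s * Y1 s)" if s: "s \<in> U" for s
  proof -
    have cub: "(Y1 s * u + Y2 s * v) * (rX s * u\<^sup>2 + mX s * (u * v) + nX s * v\<^sup>2)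
        = (X1 s * u + X2 s * v) * (rY s * u\<^sup>2 + mY s * (u * v) + nY s * v\<^sup>2)" for u v
      using cubic[OF s, of u v] unfolding sym_derivative_def rX_def rY_def nX_def nY_def mX_def mY_def .
    have 0: "Y1 s * rX s = X1 s * rY s" "Y2 s * nX s = X2 s * nY s"
      using cub[of 1 0] cub[of 0 1] by simp_all
    have 1: "Y1 s * mX s + Y2 s * rX s = X1 s * mY s + X2 s * rY s"
      "Y1 s * nX s + Y2 s * mX s = X1 s * nY s + X2 s * mY s"
      using cub[of 1 1] cub[of 1 "-1"] 0 by (simp_all add: algebra_simps)
    have r: "rX s = - a1 s * X1 s" "rY s = - a1 s * Y1 s"
      using pos(1)[OF s] 0(1) by (simp_all add: a1_def field_simps power2_eq_square)
    have n: "nX s = - a2 s * X2 s" "nY s = - a2 s * Y2 s"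
      using pos(2)[OF s] 0(2) by (simp_all add: a2_def field_simps power2_eq_square)
    define p q where "p = mX s + a1 s * X2 s + a2 s * X1 s" and "q = mY s + a1 s * Y2 s + a2 s * Y1 s"
    have "Y1 s * p = X1 s * q" "Y2 s * p = X2 s * q"
      using 1 unfolding r n p_def q_def by algebra+
    then have "(X1 s * Y2 s - X2 s * Y1 s) * p = 0" "(X1 s * Y2 s - X2 s * Y1 s) * q = 0" by algebra+
    then have "p = 0" "q = 0" using det[OF s] by simp_all
    then show ?thesis using r n by (simp add: p_def q_def algebra_simps)
  qed
  have "twisted_killing U a1 a2 X1 X2" "twisted_killing U a1 a2 Y1 Y2"
    unfolding twisted_killing_iff
  proof (safe)
    fix s assume "s \<in> U"
    note m = main[OF this, unfolded rX_def rY_def nX_def nY_def mX_def mY_def]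
    show "D1 X1 s = - a1 s * X1 s + c1 s * X2 s" "D2 X2 s = - c2 s * X1 s - a2 s * X2 s"
      "D1 X2 s + D2 X1 s = - (a1 s * X2 s + a2 s * X1 s) - c1 s * X1 s + c2 s * X2 s"
      "D1 Y1 s = - a1 s * Y1 s + c1 s * Y2 s" "D2 Y2 s = - c2 s * Y1 s - a2 s * Y2 s"
      "D1 Y2 s + D2 Y1 s = - (a1 s * Y2 s + a2 s * Y1 s) - c1 s * Y1 s + c2 s * Y2 s"
      using m by (simp_all add: algebra_simps)
  qed
  with sa show ?thesis using that by blast
qed

lemma cubic_of_twisted_killing:
  assumes "twisted_killing U a1 a2 X1 X2" "twisted_killing U a1 a2 Y1 Y2" "s \<in> U"
  shows "(Y1 s * u + Y2 s * v) * sym_derivative X1 X2 s u v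
        = (X1 s * u + X2 s * v) * sym_derivative Y1 Y2 s u v"
proof -
  have "sym_derivative X1 X2 s u v = - (a1 s * u + a2 s * v) * (X1 s * u + X2 s * v)"
    "sym_derivative Y1 Y2 s u v = - (a1 s * u + a2 s * v) * (Y1 s * u + Y2 s * v)"
    using assms unfolding twisted_killing_def by blast+
  then show ?thesis by algebra
qed

text \<open>Killing's equation prescribes three of the four derivatives of a field, and leaves
  open the rotation rate pX of X. Two independent fields interpolate: a unique one-form
  \<open>\<beta>\<close> has \<open>\<beta>(J X)\<close> and \<open>\<beta>(J Y)\<close> equal to
  the two rates.\<close>

lemma twisted_parallel_of_killing:
  assumes U: "open U" "U \<subseteq> S"
    and sm: "smooth_on U a1" "smooth_on U a2" "smooth_on U X1" "smooth_on U X2" "smooth_on U Y1" "smooth_on U Y2"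
    and det: "\<And>s. s \<in> U \<Longrightarrow> X1 s * Y2 s - X2 s * Y1 s \<noteq> 0"
    and X: "twisted_killing U a1 a2 X1 X2" and Y: "twisted_killing U a1 a2 Y1 Y2"
  obtains b1 b2 where "smooth_on U b1" "smooth_on U b2"
    "twisted_parallel U a1 a2 b1 b2 X1 X2" "twisted_parallel U a1 a2 b1 b2 Y1 Y2"
proof -
  define pX pY where "pX s = D1 X2 s + c1 s * X1 s + a1 s * X2 s" and "pY s = D1 Y2 s + c1 s * Y1 s + a1 s * Y2 s" for s
  define d where "d s = X1 s * Y2 s - X2 s * Y1 s" for s
  define b1 where "b1 s = (Y1 s * pX s - X1 s * pY s) / d s" for s
  define b2 where "b2 s = (pX s * Y2 s - pY s * X2 s) / d s" for s
  note D = smooth_D[OF U] and c = smooth_c[THEN smooth_on_subset[OF _ U(2)]]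
  have sd: "smooth_on U d" unfolding d_def[abs_def] by (intro smooth_intros sm U(1))
  have sp: "smooth_on U pX" "smooth_on U pY"
    unfolding pX_def[abs_def] pY_def[abs_def] by (intro smooth_intros D sm c U(1))+
  have dn: "d s \<noteq> 0" if "s \<in> U" for s using det[OF that] by (simp add: d_def)
  have "smooth_on U b1" "smooth_on U b2"
    unfolding b1_def[abs_def] b2_def[abs_def] using dn by (intro smooth_intros sd sp sm U(1); simp)+
  moreover have p: "pX s = b2 s * X1 s - b1 s * X2 s" "pY s = b2 s * Y1 s - b1 s * Y2 s" if "s \<in> U" for s
  proof -
    have "b1 s * d s = Y1 s * pX s - X1 s * pY s" "b2 s * d s = pX s * Y2 s - pY s * X2 s"
      using dn[OF that] by (simp_all add: b1_def b2_def)
    moreover have "d s = X1 s * Y2 s - X2 s * Y1 s" by (fact d_def)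
    ultimately have "d s * (pX s - (b2 s * X1 s - b1 s * X2 s)) = 0" "d s * (pY s - (b2 s * Y1 s - b1 s * Y2 s)) = 0"
      by algebra+
    then show "pX s = b2 s * X1 s - b1 s * X2 s" "pY s = b2 s * Y1 s - b1 s * Y2 s"
      using dn[OF that] by simp_all
  qed
  moreover have "twisted_parallel U a1 a2 b1 b2 X1 X2" "twisted_parallel U a1 a2 b1 b2 Y1 Y2"
    unfolding twisted_parallel_def
  proof (safe)
    fix s assume s: "s \<in> U"
    note w = X[unfolded twisted_killing_iff, rule_format, OF s] Y[unfolded twisted_killing_iff, rule_format, OF s]
      p[OF s, unfolded pX_def pY_def]
    show "D1 X1 s = - a1 s * X1 s + c1 s * X2 s" "D2 X2 s = - c2 s * X1 s - a2 s * X2 s"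
      "D1 Y1 s = - a1 s * Y1 s + c1 s * Y2 s" "D2 Y2 s = - c2 s * Y1 s - a2 s * Y2 s"
      using w by simp_all
    show "D1 X2 s = (b2 s - c1 s) * X1 s - (a1 s + b1 s) * X2 s"
      "D1 Y2 s = (b2 s - c1 s) * Y1 s - (a1 s + b1 s) * Y2 s"
      using w(3,4) by (simp_all add: algebra_simps)
    then show "D2 X1 s = - (a2 s + b2 s) * X1 s + (c2 s + b1 s) * X2 s"
      "D2 Y1 s = - (a2 s + b2 s) * Y1 s + (c2 s + b1 s) * Y2 s"
      using w(1,2) by (simp_all add: algebra_simps)
  qed
  ultimately show ?thesis using that by blast
qed

text \<open>The derivatives of m1 and m2 contribute to the derivative of the combination the
  tensor \<open>k (X \<otimes> Y - Y \<otimes> X)\<close>, which is skew-symmetric and disappears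
  from Killing's equation.\<close>

lemma killing_of_hamiltonian_pair:
  assumes U: "open U"
    and sm: "smooth_on U m1" "smooth_on U m2" "smooth_on U X1" "smooth_on U X2" "smooth_on U Y1" "smooth_on U Y2"
    and X: "twisted_killing U a1 a2 X1 X2" and Y: "twisted_killing U a1 a2 Y1 Y2"
    and m1: "\<And>s. s \<in> U \<Longrightarrow> D1 m1 s = - k s * Y1 s" "\<And>s. s \<in> U \<Longrightarrow> D2 m1 s = - k s * Y2 s"
    and m2: "\<And>s. s \<in> U \<Longrightarrow> D1 m2 s = k s * X1 s" "\<And>s. s \<in> U \<Longrightarrow> D2 m2 s = k s * X2 s"
  shows "twisted_killing U a1 a2 (\<lambda>s. m1 s * X1 s + m2 s * Y1 s) (\<lambda>s. m1 s * X2 s + m2 s * Y2 s)"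
  unfolding twisted_killing_iff
proof (intro ballI)
  fix s assume s: "s \<in> U"
  have d: "X1 differentiable at s" "X2 differentiable at s" "Y1 differentiable at s" "Y2 differentiable at s"
    "m1 differentiable at s" "m2 differentiable at s"
    using sm s by (auto intro: smooth_on_differentiable)
  note w = X[unfolded twisted_killing_iff, rule_format, OF s] Y[unfolded twisted_killing_iff, rule_format, OF s]
  show "D1 (\<lambda>s. m1 s * X1 s + m2 s * Y1 s) s = - a1 s * (m1 s * X1 s + m2 s * Y1 s) + c1 s * (m1 s * X2 s + m2 s * Y2 s) \<and>
      D2 (\<lambda>s. m1 s * X2 s + m2 s * Y2 s) s = - c2 s * (m1 s * X1 s + m2 s * Y1 s) - a2 s * (m1 s * X2 s + m2 s * Y2 s) \<and>
      D1 (\<lambda>s. m1 s * X2 s + m2 s * Y2 s) s + D2 (\<lambda>s. m1 s * X1 s + m2 s * Y1 s) s =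
      - (a1 s * (m1 s * X2 s + m2 s * Y2 s) + a2 s * (m1 s * X1 s + m2 s * Y1 s)) - c1 s * (m1 s * X1 s + m2 s * Y1 s)
      + c2 s * (m1 s * X2 s + m2 s * Y2 s)"
    using w by (simp only: along_simps d m1[OF s] m2[OF s]) (elim conjE, intro conjI; (algebra | simp add: algebra_simps))
qed

text \<open>For constant curvature \<open>\<beta>\<close> and \<open>\<alpha>\<close> are closed.
  Hence a function k with logarithmic differential \<open>\<alpha> + 2 \<beta>\<close> exists, and
  with this choice of k the prescribed differentials of m1 and m2 are closed too. By the preceding
  lemma \<open>m1 X + m2 Y\<close> is a further Killing field; it vanishes at s0 but its
  derivative there does not. This replaces the integration of the full flat system of rank three:
  two solutions being known, only quadratures remain.\<close>

lemma third_killing_field: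
  assumes U: "open U" "U \<subseteq> S" "s0 \<in> U" and K: "K constant_on U"
    and sm: "smooth_on U a1" "smooth_on U a2" "smooth_on U X1" "smooth_on U X2" "smooth_on U Y1" "smooth_on U Y2"
    and det: "\<And>s. s \<in> U \<Longrightarrow> X1 s * Y2 s - X2 s * Y1 s \<noteq> 0"
    and X: "twisted_killing U a1 a2 X1 X2" and Y: "twisted_killing U a1 a2 Y1 Y2"
  obtains r k m1 m2 where "r > 0" "ball s0 r \<subseteq> U" "smooth_on (ball s0 r) m1" "smooth_on (ball s0 r) m2"
    "m1 s0 = 0" "m2 s0 = 0" "\<And>s. s \<in> ball s0 r \<Longrightarrow> k s > (0::real)"
    "\<And>s. s \<in> ball s0 r \<Longrightarrow> D1 m1 s = - k s * Y1 s" "\<And>s. s \<in> ball s0 r \<Longrightarrow> D2 m1 s = - k s * Y2 s"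
    "\<And>s. s \<in> ball s0 r \<Longrightarrow> D1 m2 s = k s * X1 s" "\<And>s. s \<in> ball s0 r \<Longrightarrow> D2 m2 s = k s * X2 s"
proof -
  obtain b1 b2 where b: "smooth_on U b1" "smooth_on U b2"
    "twisted_parallel U a1 a2 b1 b2 X1 X2" "twisted_parallel U a1 a2 b1 b2 Y1 Y2"
    using twisted_parallel_of_killing[OF U(1,2) sm det X Y] by blast
  obtain r where r: "r > 0" "ball s0 r \<subseteq> U" using U(1,3) openE by blast
  let ?B = "ball s0 r"
  have B: "open ?B" "convex ?B" "s0 \<in> ?B" "?B \<subseteq> S" using r U(2) by auto
  have K0: "D1 K s = 0 \<and> D2 K s = 0" if "s \<in> ?B" for s
    using constant_K_iff[OF B(1,4,2)] constant_on_subset[OF K r(2)] that by blast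
  note ric = parallel_pair_riccati(1)[OF U(1,2) sm(1,2) b(1,2) sm(3-6) b(3,4) det]
  have da: "D1 a2 s - D2 a1 s + c1 s * a1 s + c2 s * a2 s = - skew_part b1 b2 s" if "s \<in> U" for s
    by (rule parallel_pair_riccati(2)[OF U(1,2) sm(1,2) b(1,2) sm(3-6) b(3,4) det that])
  have w0: "skew_part b1 b2 s = 0" if "s \<in> ?B" for s
    by (rule skew_part_vanishes[OF B(1,4) K0 riccati_form_subset[OF ric r(2)] that])
  have sm': "smooth_on ?B a1" "smooth_on ?B a2" "smooth_on ?B b1" "smooth_on ?B b2"
    "smooth_on ?B X1" "smooth_on ?B X2" "smooth_on ?B Y1" "smooth_on ?B Y2"
    using sm b(1,2) smooth_on_subset[OF _ r(2)] by blast+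
  have diff: "a1 differentiable at s" "a2 differentiable at s" "b1 differentiable at s" "b2 differentiable at s"
    "X1 differentiable at s" "X2 differentiable at s" "Y1 differentiable at s" "Y2 differentiable at s"
    if "s \<in> ?B" for s using sm' smooth_on_differentiable that by blast+
  have closed_ab: "D1 (\<lambda>s. a2 s + 2 * b2 s) s - D2 (\<lambda>s. a1 s + 2 * b1 s) s
      = - c1 s * (a1 s + 2 * b1 s) - c2 s * (a2 s + 2 * b2 s)" if s: "s \<in> ?B" for s
  proof -
    have sU: "s \<in> U" using s r(2) by blast
    show ?thesis
      using da[OF sU] riccati_formD[OF ric sU] w0[OF s]
      by (simp add: along_simps diff[OF s] algebra_simps)
  qed
  have sm_ab: "smooth_on ?B (\<lambda>s. a1 s + 2 * b1 s)" "smooth_on ?B (\<lambda>s. a2 s + 2 * b2 s)"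
    by (intro smooth_intros sm' B(1))+
  obtain h where h: "smooth_on ?B h" "\<And>s. s \<in> ?B \<Longrightarrow> D1 h s = a1 s + 2 * b1 s"
    "\<And>s. s \<in> ?B \<Longrightarrow> D2 h s = a2 s + 2 * b2 s" "h s0 = 0"
    by (rule poincare_frame[OF B sm_ab closed_ab]) (assumption | (rule that; assumption))+
  define k where "k s = exp (h s)" for s
  have k: "smooth_on ?B k" unfolding k_def[abs_def] using h(1) B(1) by (rule smooth_on_exp[rotated])
  have Dk: "D1 k s = k s * (a1 s + 2 * b1 s)" "D2 k s = k s * (a2 s + 2 * b2 s)" if "s \<in> ?B" for s
    unfolding k_def[abs_def] using that h(2,3) smooth_on_differentiable[OF h(1)] by (simp_all add: along_exp)
  have closed: "D1 (\<lambda>s. l * (k s * W2 s)) s - D2 (\<lambda>s. l * (k s * W1 s)) s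
      = - c1 s * (l * (k s * W1 s)) - c2 s * (l * (k s * W2 s))"
    if W: "twisted_parallel U a1 a2 b1 b2 W1 W2" "W1 differentiable at s" "W2 differentiable at s" and s: "s \<in> ?B"
    for W1 W2 s and l :: real
  proof -
    have "s \<in> U" using s r(2) by blast
    note w = W(1)[unfolded twisted_parallel_def, rule_format, OF this]
    show ?thesis
      using w by (simp add: along_simps W(2,3) smooth_on_differentiable[OF k s] Dk[OF s]) (simp add: algebra_simps)
  qed
  have smk: "smooth_on ?B (\<lambda>s. l * (k s * W s))" if "smooth_on ?B W" for W and l :: real
    by (intro smooth_intros B(1) k that)
  obtain m1 where m1: "smooth_on ?B m1" "\<And>s. s \<in> ?B \<Longrightarrow> D1 m1 s = - 1 * (k s * Y1 s)"
    "\<And>s. s \<in> ?B \<Longrightarrow> D2 m1 s = - 1 * (k s * Y2 s)" "m1 s0 = 0"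
    by (rule poincare_frame[OF B smk smk closed[OF b(4)], OF sm'(7,8) diff(7,8)]) (assumption | (rule that; assumption))+
  obtain m2 where m2: "smooth_on ?B m2" "\<And>s. s \<in> ?B \<Longrightarrow> D1 m2 s = 1 * (k s * X1 s)"
    "\<And>s. s \<in> ?B \<Longrightarrow> D2 m2 s = 1 * (k s * X2 s)" "m2 s0 = 0"
    by (rule poincare_frame[OF B smk smk closed[OF b(3)], OF sm'(5,6) diff(5,6)]) (assumption | (rule that; assumption))+
  show ?thesis
    by (rule that[OF r m1(1) m2(1) m1(4) m2(4), of k]) (use m1 m2 in \<open>auto simp: k_def\<close>)
qed

end

section \<open>The orthonormal frame of a metric\<close>

lemma pderiv_at_along: "pderiv_at i f s = along (\<lambda>_. axis i 1) f s"
  by (simp add: pderiv_at_def along_def)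

context
  fixes i :: 2
begin

lemmas pderiv_at_simps =
  along_add[of _ _ _ "\<lambda>_. axis i (1::real)", folded pderiv_at_along]
  along_diff[of _ _ _ "\<lambda>_. axis i (1::real)", folded pderiv_at_along]
  along_mult[of _ _ _ "\<lambda>_. axis i (1::real)", folded pderiv_at_along]
  along_uminus[of _ _ "\<lambda>_. axis i (1::real)", folded pderiv_at_along]
  along_power2[of _ _ "\<lambda>_. axis i (1::real)", folded pderiv_at_along]
  along_const[of "\<lambda>_. axis i (1::real)", folded pderiv_at_along]
  differentiable_add differentiable_diff differentiable_mult differentiable_minus differentiable_const

end

lemma pderiv_at_commute:
  assumes "open S" "s \<in> S" "smooth_on S f"
  shows "pderiv_at 1 (pderiv_at 2 f) s = pderiv_at 2 (pderiv_at 1 f) s"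
  unfolding pderiv_at_def using frechet_derivative_mixed_symmetric[OF assms] .

lemma matrix_inv_2:
  fixes A :: "real^2^2"
  assumes "det A \<noteq> 0"
  shows "matrix_inv A $ 1 $ 1 = A $ 2 $ 2 / det A" "matrix_inv A $ 1 $ 2 = - A $ 1 $ 2 / det A"
    "matrix_inv A $ 2 $ 1 = - A $ 2 $ 1 / det A" "matrix_inv A $ 2 $ 2 = A $ 1 $ 1 / det A"
proof -
  define B :: "real^2^2" where "B = vector [vector [A $ 2 $ 2 / det A, - A $ 1 $ 2 / det A],
    vector [- A $ 2 $ 1 / det A, A $ 1 $ 1 / det A]]"
  have e: "B $ 1 $ 1 = A $ 2 $ 2 / det A" "B $ 1 $ 2 = - A $ 1 $ 2 / det A"
    "B $ 2 $ 1 = - A $ 2 $ 1 / det A" "B $ 2 $ 2 = A $ 1 $ 1 / det A"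
    by (simp_all add: B_def)
  have d: "A $ 1 $ 1 * A $ 2 $ 2 - A $ 1 $ 2 * A $ 2 $ 1 \<noteq> 0" using assms by (simp add: det_2)
  have AB: "A ** B = mat 1" "B ** A = mat 1"
    using d unfolding matrix_matrix_mult_def mat_def vec_eq_iff
    by (auto simp: forall_2 UNIV_2 e det_2 divide_simps)
  have "matrix_inv A = X" if X: "A ** X = mat 1" "X ** A = mat 1" for X
    unfolding matrix_inv_def
  proof (rule some_equality)
    fix Y assume "A ** Y = mat 1 \<and> Y ** A = mat 1"
    then show "Y = X" using X by (metis matrix_mul_assoc matrix_mul_lid matrix_mul_rid)
  qed (use X in simp)
  then have "matrix_inv A = B" using AB by blast
  with e show "matrix_inv A $ 1 $ 1 = A $ 2 $ 2 / det A" "matrix_inv A $ 1 $ 2 = - A $ 1 $ 2 / det A"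
    "matrix_inv A $ 2 $ 1 = - A $ 2 $ 1 / det A" "matrix_inv A $ 2 $ 2 = A $ 1 $ 1 / det A" by simp_all
qed

locale riemannian_chart =
  fixes S :: "(real^2) set" and g :: "real^2 \<Rightarrow> real^2^2"
  assumes open_chart: "open S" and metric: "riemannian_metric_on S g"
begin

text \<open>The Gram-Schmidt process, applied to the coordinate coframe, writes the metric as
  \<open>(P dx + Q dy)\<^sup>2 + (R dy)\<^sup>2\<close>. The frame e1, e2 below is dual to the two
  one-forms in brackets. It exists on the whole chart and is given by explicit formulas, and takes
  the place of isothermal coordinates.\<close>

definition P :: "real^2 \<Rightarrow> real" where "P s = sqrt (g s $ 1 $ 1)"
definition Q :: "real^2 \<Rightarrow> real" where "Q s = g s $ 1 $ 2 / P s"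
definition R :: "real^2 \<Rightarrow> real" where "R s = sqrt (g s $ 2 $ 2 - (Q s)\<^sup>2)"

definition e1 :: "real^2 \<Rightarrow> real^2" where "e1 s = vector [1 / P s, 0]"
definition e2 :: "real^2 \<Rightarrow> real^2" where "e2 s = vector [- Q s / (P s * R s), 1 / R s]"

definition c1 :: "real^2 \<Rightarrow> real" where
  "c1 s = (pderiv_at 1 Q s - pderiv_at 2 P s) / (P s * R s)"
definition c2 :: "real^2 \<Rightarrow> real" where "c2 s = pderiv_at 1 R s / (P s * R s)"

lemma metric_sym: "s \<in> S \<Longrightarrow> g s $ 2 $ 1 = g s $ 1 $ 2"
proof -
  assume "s \<in> S"
  then have "transpose (g s) = g s" using metric by (simp add: riemannian_metric_on_def)
  then show ?thesis by (metis (no_types) transpose_def vec_lambda_beta)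
qed

lemma metric_pos: "s \<in> S \<Longrightarrow> v \<noteq> 0 \<Longrightarrow> v \<bullet> (g s *v v) > 0"
  using metric by (simp add: riemannian_metric_on_def)

lemma metric_form: "v \<bullet> (g s *v v) = g s $ 1 $ 1 * (v $ 1)\<^sup>2 + (g s $ 1 $ 2 + g s $ 2 $ 1) * (v $ 1 * v $ 2)
    + g s $ 2 $ 2 * (v $ 2)\<^sup>2"
  by (simp add: inner_vec_def matrix_vector_mult_def UNIV_2 power2_eq_square algebra_simps)

lemma metric_minors:
  assumes "s \<in> S"
  shows "g s $ 1 $ 1 > 0" "g s $ 1 $ 1 * g s $ 2 $ 2 - (g s $ 1 $ 2)\<^sup>2 > 0"
proof -
  have nz: "vector [x, y] \<noteq> (0 :: real^2)" if "x \<noteq> 0 \<or> y \<noteq> 0" for x y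
    using that by (auto simp: vec_eq_iff forall_2)
  show 1: "g s $ 1 $ 1 > 0"
    using metric_pos[OF assms nz[of 1 0]] unfolding metric_form by simp
  have "0 < g s $ 1 $ 1 * (g s $ 1 $ 1 * g s $ 2 $ 2 - (g s $ 1 $ 2)\<^sup>2)"
    using metric_pos[OF assms nz[of "- g s $ 1 $ 2" "g s $ 1 $ 1"]] 1
    unfolding metric_form metric_sym[OF assms] by (simp add: algebra_simps power2_eq_square)
  then show "g s $ 1 $ 1 * g s $ 2 $ 2 - (g s $ 1 $ 2)\<^sup>2 > 0"
    using 1 by (simp add: zero_less_mult_iff)
qed

lemma PR_pos:
  assumes "s \<in> S"
  shows "P s > 0" "g s $ 2 $ 2 - (Q s)\<^sup>2 > 0" "R s > 0"
proof -
  show 1: "P s > 0" using metric_minors[OF assms] by (simp add: P_def)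
  have "(P s)\<^sup>2 = g s $ 1 $ 1" using metric_minors(1)[OF assms] by (simp add: P_def)
  moreover have "P s * Q s = g s $ 1 $ 2" using 1 by (simp add: Q_def)
  ultimately have "(P s)\<^sup>2 * (g s $ 2 $ 2 - (Q s)\<^sup>2) = g s $ 1 $ 1 * g s $ 2 $ 2 - (g s $ 1 $ 2)\<^sup>2"
    by (metis power_mult_distrib right_diff_distrib)
  then have "(P s)\<^sup>2 * (g s $ 2 $ 2 - (Q s)\<^sup>2) > 0" using metric_minors(2)[OF assms] by simp
  then show 2: "g s $ 2 $ 2 - (Q s)\<^sup>2 > 0" using 1 by (simp add: zero_less_mult_iff)
  then show "R s > 0" by (simp add: R_def)
qed

lemma metric_PQR:
  assumes "s \<in> S"
  shows "g s $ 1 $ 1 = (P s)\<^sup>2" "g s $ 1 $ 2 = P s * Q s" "g s $ 2 $ 1 = P s * Q s"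
    "g s $ 2 $ 2 = (Q s)\<^sup>2 + (R s)\<^sup>2" "det (g s) = (P s * R s)\<^sup>2"
proof -
  show 1: "g s $ 1 $ 1 = (P s)\<^sup>2" using metric_minors(1)[OF assms] by (simp add: P_def)
  show 2: "g s $ 1 $ 2 = P s * Q s" using PR_pos(1)[OF assms] by (simp add: Q_def)
  show 3: "g s $ 2 $ 1 = P s * Q s" using 2 metric_sym[OF assms] by simp
  show 4: "g s $ 2 $ 2 = (Q s)\<^sup>2 + (R s)\<^sup>2" using PR_pos(2)[OF assms] by (simp add: R_def)
  show "det (g s) = (P s * R s)\<^sup>2"
    by (simp add: det_2 1 2 3 4) (simp add: algebra_simps power2_eq_square)
qed

lemma smooth_metric: "smooth_on S (\<lambda>s. g s $ i $ j)"
proof -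
  have "smooth_on S g" using metric by (simp add: riemannian_metric_on_def)
  moreover have "bounded_linear (\<lambda>A :: real^2^2. A $ i $ j)"
    by (intro bounded_linear_compose[OF bounded_linear_vec_nth bounded_linear_vec_nth])
  ultimately show ?thesis by (intro smooth_on_linear_comp[of "\<lambda>A. A $ i $ j"] open_chart)
qed

lemma smooth_PQR: "smooth_on S P" "smooth_on S Q" "smooth_on S R"
proof -
  show P: "smooth_on S P"
    unfolding P_def[abs_def] using metric_minors by (intro smooth_on_sqrt open_chart smooth_metric)
  show Q: "smooth_on S Q"
    unfolding Q_def[abs_def] using PR_pos by (intro smooth_intros open_chart smooth_metric P) force
  show "smooth_on S R"
    unfolding R_def[abs_def] using PR_pos by (intro smooth_on_sqrt smooth_intros open_chart smooth_metric Q) auto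
qed

lemma PQR_differentiable:
  "s \<in> S \<Longrightarrow> P differentiable at s" "s \<in> S \<Longrightarrow> Q differentiable at s" "s \<in> S \<Longrightarrow> R differentiable at s"
  using smooth_PQR smooth_on_differentiable by blast+

lemma along_e:
  assumes "f differentiable at s"
  shows "along e1 f s = pderiv_at 1 f s / P s"
    "along e2 f s = (pderiv_at 2 f s - Q s * along e1 f s) / R s"
  using along_components[OF assms, of e1] along_components[OF assms, of e2]
  by (simp_all add: e1_def e2_def diff_divide_distrib)

lemma pderiv_along_e:
  assumes "f differentiable at s" "s \<in> S"
  shows "pderiv_at 1 f s = P s * along e1 f s" "pderiv_at 2 f s = Q s * along e1 f s + R s * along e2 f s"
  using along_e[OF assms(1)] PR_pos[OF assms(2)] by (simp_all)

lemma smooth_c12: "smooth_on S c1" "smooth_on S c2"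
  unfolding c1_def[abs_def] c2_def[abs_def] using PR_pos
  by (intro smooth_intros open_chart smooth_on_pderiv_at smooth_PQR; force)+

lemma smooth_e12: "smooth_on S (\<lambda>s. e1 s $ i)" "smooth_on S (\<lambda>s. e2 s $ i)"
proof -
  have "smooth_on S (\<lambda>s. 1 / P s)" "smooth_on S (\<lambda>s. - Q s / (P s * R s))" "smooth_on S (\<lambda>s. 1 / R s)"
    using PR_pos by (intro smooth_intros open_chart smooth_PQR; force)+
  then have "smooth_on S (\<lambda>s. e1 s $ 1)" "smooth_on S (\<lambda>s. e1 s $ 2)"
    "smooth_on S (\<lambda>s. e2 s $ 1)" "smooth_on S (\<lambda>s. e2 s $ 2)"
    by (simp_all add: e1_def e2_def smooth_on_const)
  then show "smooth_on S (\<lambda>s. e1 s $ i)" "smooth_on S (\<lambda>s. e2 s $ i)"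
    using exhaust_2[of i] by auto
qed

lemma c_PR:
  assumes "s \<in> S"
  shows "pderiv_at 1 Q s = pderiv_at 2 P s + c1 s * (P s * R s)" "pderiv_at 1 R s = c2 s * (P s * R s)"
  using PR_pos[OF assms] by (simp_all add: c1_def c2_def)

sublocale moving_frame S e1 e2 c1 c2
proof
  show "open S" by (rule open_chart)
  show "smooth_on S (\<lambda>s. e1 s $ i)" "smooth_on S (\<lambda>s. e2 s $ i)" for i by (rule smooth_e12)+
  show "smooth_on S c1" "smooth_on S c2" by (rule smooth_c12)+
  show "e1 s $ 1 * e2 s $ 2 - e1 s $ 2 * e2 s $ 1 \<noteq> 0" if "s \<in> S" for s
    using PR_pos[OF that] by (simp add: e1_def e2_def)
next
  fix U s and f :: "real^2 \<Rightarrow> real"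
  assume U: "open U" "U \<subseteq> S" and f: "smooth_on U f" and s: "s \<in> U"
  have sS: "s \<in> S" using U s by blast
  have sm: "smooth_on U (along e1 f)" "smooth_on U (along e2 f)"
    using smooth_e12[THEN smooth_on_subset[OF _ U(2)]] f U(1) by (auto intro: smooth_on_along)
  have d: "f differentiable at t" "along e1 f differentiable at t" "along e2 f differentiable at t"
    if "t \<in> U" for t using sm f smooth_on_differentiable that by blast+
  have p: "pderiv_at 1 f t = P t * along e1 f t" "pderiv_at 2 f t = Q t * along e1 f t + R t * along e2 f t"
    if "t \<in> U" for t using pderiv_along_e[OF d(1)[OF that]] U(2) that by blast+
  have "pderiv_at 2 (pderiv_at 1 f) s = pderiv_at 2 (\<lambda>t. P t * along e1 f t) s"
    "pderiv_at 1 (pderiv_at 2 f) s = pderiv_at 1 (\<lambda>t. Q t * along e1 f t + R t * along e2 f t) s"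
    by (rule pderiv_at_cong[OF U(1) s], simp only: p)+
  then have "pderiv_at 1 (\<lambda>t. Q t * along e1 f t + R t * along e2 f t) s = pderiv_at 2 (\<lambda>t. P t * along e1 f t) s"
    using pderiv_at_commute[OF U(1) s f] by simp
  then have "P s * R s * (along e1 (along e2 f) s - along e2 (along e1 f) s)
      = P s * R s * (- c1 s * along e1 f s - c2 s * along e2 f s)"
    by (simp add: pderiv_at_simps d[OF s] PQR_differentiable[OF sS] c_PR[OF sS]
        pderiv_along_e[OF d(2)[OF s] sS] pderiv_along_e[OF d(3)[OF s] sS]) algebra
  then show "along e1 (along e2 f) s - along e2 (along e1 f) s = - c1 s * along e1 f s - c2 s * along e2 f s"
    using PR_pos[OF sS] by simp
qed

text \<open>Component a, in the frame, of the covariant derivative of the j-th coordinate field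
  along the i-th one: the derivative of the coefficients P, Q, 0, R of the coframe, corrected by
  the connection form, whose coordinate components are \<open>c1 P\<close> and \<open>c1 Q + c2
  R\<close>.\<close>

definition gam :: "2 \<Rightarrow> 2 \<Rightarrow> 2 \<Rightarrow> real^2 \<Rightarrow> real" where
  "gam a i j s =
    (if i = 1 then
       (if j = 1 then (if a = 1 then pderiv_at 1 P s else c1 s * P s * P s)
        else (if a = 1 then pderiv_at 1 Q s - c1 s * P s * R s else pderiv_at 1 R s + c1 s * P s * Q s))
     else
       (if j = 1 then (if a = 1 then pderiv_at 2 P s else (c1 s * Q s + c2 s * R s) * P s)
        else (if a = 1 then pderiv_at 2 Q s - (c1 s * Q s + c2 s * R s) * R s
              else pderiv_at 2 R s + (c1 s * Q s + c2 s * R s) * Q s)))"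

text \<open>The connection defined by c1 and c2 is the Levi-Civita connection; in coordinates this
  is a comparison of first derivatives of P, Q and R.\<close>

lemma christoffel_frame:
  assumes s: "s \<in> S"
  shows "christoffel g 2 i j s = gam 2 i j s / R s"
    "christoffel g 1 i j s = (gam 1 i j s - Q s * christoffel g 2 i j s) / P s"
proof -
  note pos = PR_pos[OF s] and d = PQR_differentiable[OF s]
  have dg: "pderiv_at i (\<lambda>t. g t $ 1 $ 1) s = 2 * P s * pderiv_at i P s"
    "pderiv_at i (\<lambda>t. g t $ 1 $ 2) s = P s * pderiv_at i Q s + pderiv_at i P s * Q s"
    "pderiv_at i (\<lambda>t. g t $ 2 $ 1) s = P s * pderiv_at i Q s + pderiv_at i P s * Q s"
    "pderiv_at i (\<lambda>t. g t $ 2 $ 2) s = 2 * Q s * pderiv_at i Q s + 2 * R s * pderiv_at i R s" for i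
  proof -
    have "pderiv_at i (\<lambda>t. g t $ 1 $ 1) s = pderiv_at i (\<lambda>t. (P t)\<^sup>2) s"
      "pderiv_at i (\<lambda>t. g t $ 1 $ 2) s = pderiv_at i (\<lambda>t. P t * Q t) s"
      "pderiv_at i (\<lambda>t. g t $ 2 $ 1) s = pderiv_at i (\<lambda>t. P t * Q t) s"
      "pderiv_at i (\<lambda>t. g t $ 2 $ 2) s = pderiv_at i (\<lambda>t. (Q t)\<^sup>2 + (R t)\<^sup>2) s"
      by (rule pderiv_at_cong[OF open_chart s], simp only: metric_PQR)+
    then show "pderiv_at i (\<lambda>t. g t $ 1 $ 1) s = 2 * P s * pderiv_at i P s"
      "pderiv_at i (\<lambda>t. g t $ 1 $ 2) s = P s * pderiv_at i Q s + pderiv_at i P s * Q s"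
      "pderiv_at i (\<lambda>t. g t $ 2 $ 1) s = P s * pderiv_at i Q s + pderiv_at i P s * Q s"
      "pderiv_at i (\<lambda>t. g t $ 2 $ 2) s = 2 * Q s * pderiv_at i Q s + 2 * R s * pderiv_at i R s"
      by (simp_all only: pderiv_at_simps d power2_eq_square) (simp_all add: algebra_simps)
  qed
  have inv: "matrix_inv (g s) $ 1 $ 1 = ((Q s)\<^sup>2 + (R s)\<^sup>2) / (P s * R s)\<^sup>2"
    "matrix_inv (g s) $ 1 $ 2 = - (P s * Q s) / (P s * R s)\<^sup>2"
    "matrix_inv (g s) $ 2 $ 1 = - (P s * Q s) / (P s * R s)\<^sup>2"
    "matrix_inv (g s) $ 2 $ 2 = (P s)\<^sup>2 / (P s * R s)\<^sup>2"
    using pos matrix_inv_2[of "g s"] by (simp_all add: metric_PQR[OF s])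
  show 2: "christoffel g 2 i j s = gam 2 i j s / R s"
    using pos exhaust_2[of i] exhaust_2[of j]
    by (auto simp: christoffel_def UNIV_2 inv dg gam_def c_PR[OF s] field_simps power2_eq_square)
  show "christoffel g 1 i j s = (gam 1 i j s - Q s * christoffel g 2 i j s) / P s"
    unfolding 2
    using pos exhaust_2[of i] exhaust_2[of j]
    by (auto simp: christoffel_def UNIV_2 inv dg gam_def c_PR[OF s] field_simps power2_eq_square)
qed

text \<open>Contracting the curvature tensor with the first row of the metric needs only its
  e1-component. The identities \<open>gam 1 = P \<Gamma>\<^sup>1 + Q \<Gamma>\<^sup>2\<close> and
  \<open>gam 2 = R \<Gamma>\<^sup>2\<close> are differentiated instead of the Christoffel symbols
  themselves; the terms quadratic in the connection then cancel, and the exterior derivative of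
  the connection form remains.\<close>

lemma gauss_curvature_frame:
  assumes s: "s \<in> S"
  shows "gauss_curvature g s = K s"
proof -
  note pos = PR_pos[OF s] and d = PQR_differentiable[OF s]
  have dp: "pderiv_at i P differentiable at s" "pderiv_at i Q differentiable at s" "pderiv_at i R differentiable at s" for i
    using smooth_PQR smooth_on_pderiv_at smooth_on_differentiable s by blast+
  have dc: "c1 differentiable at s" "c2 differentiable at s"
    using smooth_c12 smooth_on_differentiable s by blast+
  have sm: "smooth_on S (christoffel g k i j)" for k i j
  proof -
    have sg: "smooth_on S (gam a i j)" for a
      unfolding gam_def[abs_def] using exhaust_2[of i] exhaust_2[of j] exhaust_2[of a]
      by (auto intro!: smooth_intros open_chart smooth_PQR smooth_c12 smooth_on_pderiv_at)
    have "smooth_on S (\<lambda>s. gam 2 i j s / R s)" using pos PR_pos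
      by (intro smooth_intros sg open_chart smooth_PQR) force
    then have 2: "smooth_on S (christoffel g 2 i j)"
      by (rule smooth_on_cong[OF open_chart, rotated]) (simp add: christoffel_frame(1))
    have "smooth_on S (\<lambda>s. (gam 1 i j s - Q s * christoffel g 2 i j s) / P s)" using PR_pos
      by (intro smooth_intros sg 2 open_chart smooth_PQR) force
    then have 1: "smooth_on S (christoffel g 1 i j)"
      by (rule smooth_on_cong[OF open_chart, rotated]) (simp add: christoffel_frame(2))
    show ?thesis using 1 2 exhaust_2[of k] by auto
  qed
  have dG: "christoffel g k i j differentiable at s" for k i j
    using sm smooth_on_differentiable s by blast
  have gam: "gam 1 i j t = P t * christoffel g 1 i j t + Q t * christoffel g 2 i j t"
    "gam 2 i j t = R t * christoffel g 2 i j t" if "t \<in> S" for i j t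
    using PR_pos[OF that] by (simp_all add: christoffel_frame[OF that])
  have D22: "pderiv_at 1 (\<lambda>t. P t * christoffel g 1 2 2 t + Q t * christoffel g 2 2 2 t) s
      = pderiv_at 1 (\<lambda>s. pderiv_at 2 Q s - (c1 s * Q s + c2 s * R s) * R s) s"
    by (rule pderiv_at_cong[OF open_chart s]) (simp add: gam(1)[symmetric] gam_def)
  have D12: "pderiv_at 2 (\<lambda>t. P t * christoffel g 1 1 2 t + Q t * christoffel g 2 1 2 t) s
      = pderiv_at 2 (\<lambda>s. pderiv_at 1 Q s - c1 s * P s * R s) s"
    by (rule pderiv_at_cong[OF open_chart s]) (simp add: gam(1)[symmetric] gam_def)
  have g22: "gam 1 2 2 s = pderiv_at 2 Q s - (c1 s * Q s + c2 s * R s) * R s"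
    "gam 2 2 2 s = pderiv_at 2 R s + (c1 s * Q s + c2 s * R s) * Q s"
    "gam 1 1 2 s = pderiv_at 1 Q s - c1 s * P s * R s" "gam 2 1 2 s = pderiv_at 1 R s + c1 s * P s * Q s"
    "gam 1 1 1 s = pderiv_at 1 P s" "gam 1 2 1 s = pderiv_at 2 P s"
    by (simp_all add: gam_def)
  define r where "r l = riemann_curv g l 1 2 2 s" for l
  have "P s * r 1 + Q s * r 2 = - R s * (P s * R s) * (D1 c2 s - D2 c1 s + (c1 s)\<^sup>2 + (c2 s)\<^sup>2)"
    using D22 D12 pderiv_at_commute[OF open_chart s smooth_PQR(2)]
      gam[OF s, of 2 2] gam[OF s, of 1 2] gam[OF s, of 1 1] gam[OF s, of 2 1]
    unfolding r_def riemann_curv_def UNIV_2 g22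
    by (simp add: pderiv_at_simps d dp dc dG pderiv_along_e[OF dc(1) s] pderiv_along_e[OF dc(2) s]
        c_PR[OF s]) algebra
  moreover have "gauss_curvature g s = (P s * r 1 + Q s * r 2) / (P s * (R s)\<^sup>2)"
    using pos by (simp add: gauss_curvature_def UNIV_2 metric_PQR[OF s] r_def field_simps power2_eq_square)
  ultimately show ?thesis
    using pos by (simp add: K_def power2_eq_square)
qed

end

section \<open>The Poisson bracket with the geodesic Hamiltonian\<close>

lemma poisson_bracket_along:
  "poisson_bracket F G z =
     (\<Sum>i\<in>UNIV. along (\<lambda>_. (0, axis i 1)) F z * along (\<lambda>_. (axis i 1, 0)) G z
               - along (\<lambda>_. (axis i 1, 0)) F z * along (\<lambda>_. (0, axis i 1)) G z)"
  by (simp add: poisson_bracket_def along_def)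

lemma poisson_bracket_divide:
  assumes "F differentiable at z" "G differentiable at z" "G z \<noteq> 0"
  shows "poisson_bracket (\<lambda>z. F z / G z) H z
    = (poisson_bracket F H z * G z - F z * poisson_bracket G H z) / (G z)\<^sup>2"
  unfolding poisson_bracket_along UNIV_2 along_divide[OF assms]
  using assms(3) by (simp add: field_simps power2_eq_square)

lemma along_fst:
  fixes f :: "real^2 \<Rightarrow> real" and z :: "(real^2) \<times> (real^2)"
  assumes "f differentiable at (fst z)"
  shows "along (\<lambda>_. (h, k)) (\<lambda>z. f (fst z)) z = along (\<lambda>_. h) f (fst z)"
    and "(\<lambda>z. f (fst z)) differentiable at z"
proof -
  have "((\<lambda>z. f (fst z)) has_derivative (\<lambda>w. frechet_derivative f (at (fst z)) (fst w))) (at z)"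
    by (rule has_derivative_compose[OF bounded_linear_imp_has_derivative[OF bounded_linear_fst]
          differentiable_has_derivative[OF assms]])
  then show "along (\<lambda>_. (h, k)) (\<lambda>z. f (fst z)) z = along (\<lambda>_. h) f (fst z)"
    "(\<lambda>z. f (fst z)) differentiable at z"
    using along_eqI[of "\<lambda>z. f (fst z)" _ z "\<lambda>_. (h, k)"] by (auto simp: along_def intro: differentiableI)
qed

lemma along_snd:
  fixes z :: "(real^2) \<times> (real^2)"
  shows "along (\<lambda>_. (h, k)) (\<lambda>z. snd z $ i) z = k $ i" "(\<lambda>z :: (real^2) \<times> (real^2). snd z $ i) differentiable at z"
proof -
  have "((\<lambda>z. snd z $ i) has_derivative (\<lambda>w :: (real^2) \<times> (real^2). snd w $ i)) (at z)"
    by (intro bounded_linear_imp_has_derivative bounded_linear_compose[OF bounded_linear_vec_nth bounded_linear_snd])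
  then show "along (\<lambda>_. (h, k)) (\<lambda>z. snd z $ i) z = k $ i" "(\<lambda>z :: (real^2) \<times> (real^2). snd z $ i) differentiable at z"
    using along_eqI[of "\<lambda>z. snd z $ i" _ z "\<lambda>_. (h, k)"] by (auto intro: differentiableI)
qed

definition momentum :: "(real^2 \<Rightarrow> real) \<Rightarrow> (real^2 \<Rightarrow> real) \<Rightarrow> (real^2) \<times> (real^2) \<Rightarrow> real" where
  "momentum A B z = A (fst z) * snd z $ 1 + B (fst z) * snd z $ 2"

lemma along_momentum:
  assumes "A differentiable at s" "B differentiable at s"
  shows "along (\<lambda>_. (h, k)) (momentum A B) (s, v)
      = along (\<lambda>_. h) A s * v $ 1 + A s * k $ 1 + along (\<lambda>_. h) B s * v $ 2 + B s * k $ 2"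
    and "momentum A B differentiable at (s, v)"
  unfolding momentum_def[abs_def] using assms
  by (simp_all add: along_simps along_fst along_snd)

context riemannian_chart
begin

text \<open>The frame components of the field \<open>A \<partial>\<^sub>x + B
  \<partial>\<^sub>y\<close> are \<open>comp1 A B\<close> and \<open>comp2 B\<close>.\<close>

definition comp1 :: "(real^2 \<Rightarrow> real) \<Rightarrow> (real^2 \<Rightarrow> real) \<Rightarrow> real^2 \<Rightarrow> real" where
  "comp1 A B s = A s * P s + B s * Q s"
definition comp2 :: "(real^2 \<Rightarrow> real) \<Rightarrow> real^2 \<Rightarrow> real" where
  "comp2 B s = B s * R s"

text \<open>The momenta in the frame directions, i.e. the covector v evaluated on e1 and on
  e2.\<close>

definition frame_p :: "(real^2) \<times> (real^2) \<Rightarrow> real" where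
  "frame_p z = snd z $ 1 / P (fst z)"
definition frame_q :: "(real^2) \<times> (real^2) \<Rightarrow> real" where
  "frame_q z = (snd z $ 2 - Q (fst z) * frame_p z) / R (fst z)"

lemma momentum_frame:
  assumes "s \<in> S"
  shows "momentum A B (s, v) = comp1 A B s * frame_p (s, v) + comp2 B s * frame_q (s, v)"
  using PR_pos[OF assms] by (simp add: momentum_def comp1_def comp2_def frame_p_def frame_q_def field_simps)

lemma hamiltonian_frame:
  assumes "fst z \<in> S"
  shows "geodesic_hamiltonian g z = ((frame_p z)\<^sup>2 + (frame_q z)\<^sup>2) / 2"
proof -
  obtain s v where z: "z = (s, v)" "s \<in> S" using assms by (cases z) auto
  note pos = PR_pos[OF z(2)]
  have inv: "matrix_inv (g s) $ 1 $ 1 = ((Q s)\<^sup>2 + (R s)\<^sup>2) / (P s * R s)\<^sup>2"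
    "matrix_inv (g s) $ 1 $ 2 = - (P s * Q s) / (P s * R s)\<^sup>2"
    "matrix_inv (g s) $ 2 $ 1 = - (P s * Q s) / (P s * R s)\<^sup>2"
    "matrix_inv (g s) $ 2 $ 2 = (P s)\<^sup>2 / (P s * R s)\<^sup>2"
    using pos matrix_inv_2[of "g s"] by (simp_all add: metric_PQR[OF z(2)])
  show ?thesis
    using pos by (simp add: z geodesic_hamiltonian_def inner_vec_def matrix_vector_mult_def UNIV_2 inv
        frame_p_def frame_q_def field_simps power2_eq_square)
qed

lemma along_frame_pq:
  assumes s: "s \<in> S"
  shows "frame_p differentiable at (s, v)" "frame_q differentiable at (s, v)"
    and "along (\<lambda>_. (h, k)) frame_p (s, v) = (k $ 1 - along (\<lambda>_. h) P s * frame_p (s, v)) / P s"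
    and "along (\<lambda>_. (h, k)) frame_q (s, v) = (k $ 2 - along (\<lambda>_. h) Q s * frame_p (s, v)
        - Q s * along (\<lambda>_. (h, k)) frame_p (s, v) - along (\<lambda>_. h) R s * frame_q (s, v)) / R s"
proof -
  note pos = PR_pos[OF s] and d = PQR_differentiable[OF s]
  show p: "frame_p differentiable at (s, v)"
    unfolding frame_p_def[abs_def] using pos d by (intro differentiable_divide along_fst along_snd) auto
  show "frame_q differentiable at (s, v)"
    unfolding frame_q_def[abs_def] using pos d p
    by (intro differentiable_divide differentiable_diff differentiable_mult along_fst along_snd) auto
  show "along (\<lambda>_. (h, k)) frame_p (s, v) = (k $ 1 - along (\<lambda>_. h) P s * frame_p (s, v)) / P s"
    unfolding frame_p_def[abs_def] using pos d
    by (subst along_divide) (auto simp: along_fst along_snd field_simps power2_eq_square)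
  show "along (\<lambda>_. (h, k)) frame_q (s, v) = (k $ 2 - along (\<lambda>_. h) Q s * frame_p (s, v)
        - Q s * along (\<lambda>_. (h, k)) frame_p (s, v) - along (\<lambda>_. h) R s * frame_q (s, v)) / R s"
    unfolding frame_q_def[abs_def] using pos d p
    by (subst along_divide) (auto simp: along_simps along_fst along_snd field_simps power2_eq_square)
qed

lemma along_hamiltonian:
  assumes s: "s \<in> S"
  shows "along (\<lambda>_. (h, k)) (geodesic_hamiltonian g) (s, v)
    = frame_p (s, v) * along (\<lambda>_. (h, k)) frame_p (s, v) + frame_q (s, v) * along (\<lambda>_. (h, k)) frame_q (s, v)"
proof -
  have "along (\<lambda>_. (h, k)) (geodesic_hamiltonian g) (s, v)
      = along (\<lambda>_. (h, k)) (\<lambda>z. (1/2) * (frame_p z)\<^sup>2 + (1/2) * (frame_q z)\<^sup>2) (s, v)"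
    using s by (intro along_cong[of "S \<times> UNIV"]) (auto simp: open_Times open_chart hamiltonian_frame)
  then show ?thesis
    by (simp add: along_simps along_frame_pq(1,2)[OF s] del: times_divide_eq_left)
qed

text \<open>Both sides are polynomials in the frame momenta u and w. Multiplying by \<open>P
  R\<close> removes the denominators, and the derivatives of P, Q, R drop out up to the structure
  functions c1, c2.\<close>

lemma poisson_bracket_momentum:
  assumes s: "s \<in> S" and AB: "A differentiable at s" "B differentiable at s"
  shows "poisson_bracket (momentum A B) (geodesic_hamiltonian g) (s, v)
    = - sym_derivative (comp1 A B) (comp2 B) s (frame_p (s, v)) (frame_q (s, v))"
proof -
  note pos = PR_pos[OF s] and d = PQR_differentiable[OF s]
  define u w where "u = frame_p (s, v)" and "w = frame_q (s, v)"
  have v: "v $ 1 = P s * u" "v $ 2 = Q s * u + R s * w"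
    using pos by (simp_all add: u_def w_def frame_p_def frame_q_def)
  define Hx Hp where "Hx i = along (\<lambda>_. (axis i 1, 0)) (geodesic_hamiltonian g) (s, v)"
    and "Hp i = along (\<lambda>_. (0, axis i 1)) (geodesic_hamiltonian g) (s, v)" for i :: 2
  have along0: "along (\<lambda>_. 0) f s = 0" if "f differentiable at s" for f :: "real^2 \<Rightarrow> real"
    using along_components[OF that, of "\<lambda>_. 0"] by simp
  have Hx: "P s * R s * Hx i = - R s * pderiv_at i P s * u\<^sup>2
      + w * (- P s * pderiv_at i Q s * u + Q s * pderiv_at i P s * u - P s * pderiv_at i R s * w)" for i
    using pos unfolding Hx_def along_hamiltonian[OF s] along_frame_pq[OF s] u_def[symmetric] w_def[symmetric]
      pderiv_at_along[symmetric]
    by (simp add: field_simps power2_eq_square)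
  have Hp: "P s * R s * Hp 1 = R s * u - Q s * w" "P s * R s * Hp 2 = P s * w"
    using pos unfolding Hp_def along_hamiltonian[OF s] along_frame_pq[OF s] u_def[symmetric] w_def[symmetric]
    by (simp_all add: along0 d axis_def field_simps power2_eq_square)
  have pb: "poisson_bracket (momentum A B) (geodesic_hamiltonian g) (s, v)
    = A s * Hx 1 + B s * Hx 2 - (pderiv_at 1 A s * v $ 1 + pderiv_at 1 B s * v $ 2) * Hp 1
      - (pderiv_at 2 A s * v $ 1 + pderiv_at 2 B s * v $ 2) * Hp 2"
    unfolding poisson_bracket_along UNIV_2 Hx_def[symmetric] Hp_def[symmetric]
    by (simp add: along_momentum[OF AB] along0[OF AB(1)] along0[OF AB(2)] axis_def)
      (simp add: pderiv_at_along axis_def)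
  have W: "D1 (comp1 A B) s = A s * D1 P s + D1 A s * P s + B s * D1 Q s + D1 B s * Q s"
    "D2 (comp1 A B) s = A s * D2 P s + D2 A s * P s + B s * D2 Q s + D2 B s * Q s"
    "D1 (comp2 B) s = B s * D1 R s + D1 B s * R s" "D2 (comp2 B) s = B s * D2 R s + D2 B s * R s"
    unfolding comp1_def[abs_def] comp2_def[abs_def] by (simp_all add: along_simps AB d)
  have c: "P s * D1 Q s = Q s * D1 P s + R s * D2 P s + c1 s * (P s * R s)" "D1 R s = c2 s * R s"
    using c_PR[OF s] pos by (simp_all add: pderiv_along_e[OF d(1) s] pderiv_along_e[OF d(2) s] pderiv_along_e[OF d(3) s])
  have "P s * R s * poisson_bracket (momentum A B) (geodesic_hamiltonian g) (s, v)
      = A s * (P s * R s * Hx 1) + B s * (P s * R s * Hx 2)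
        - (pderiv_at 1 A s * v $ 1 + pderiv_at 1 B s * v $ 2) * (P s * R s * Hp 1)
        - (pderiv_at 2 A s * v $ 1 + pderiv_at 2 B s * v $ 2) * (P s * R s * Hp 2)"
    unfolding pb by (simp add: algebra_simps)
  also have "\<dots> = P s * R s * - sym_derivative (comp1 A B) (comp2 B) s u w"
    using c unfolding Hx Hp v sym_derivative_def W comp1_def comp2_def
      pderiv_along_e[OF AB(1) s] pderiv_along_e[OF AB(2) s]
      pderiv_along_e[OF d(1) s] pderiv_along_e[OF d(2) s] pderiv_along_e[OF d(3) s]
    by algebra
  finally have "P s * R s * poisson_bracket (momentum A B) (geodesic_hamiltonian g) (s, v)
      = P s * R s * - sym_derivative (comp1 A B) (comp2 B) s u w" .
  moreover have "P s * R s \<noteq> 0" using pos by simp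
  ultimately show ?thesis unfolding u_def w_def by (metis mult_left_cancel)
qed

lemma smooth_comp:
  assumes "open U" "U \<subseteq> S" "smooth_on U A" "smooth_on U B"
  shows "smooth_on U (comp1 A B)" "smooth_on U (comp2 B)"
  unfolding comp1_def[abs_def] comp2_def[abs_def] using assms smooth_PQR[THEN smooth_on_subset[OF _ assms(2)]]
  by (auto intro!: smooth_intros)

lemma comp_det: "comp1 A B s * comp2 E s - comp2 B s * comp1 C E s = P s * R s * (A s * E s - B s * C s)"
  by (simp add: comp1_def comp2_def algebra_simps)

text \<open>By the quotient rule the bracket of the fraction vanishes where the denominator is
  nonzero iff a cubic form in the momenta does; the zeros of the denominator are reached by
  continuity.\<close>

lemma integral_iff_cubic:
  assumes U: "open U" "U \<subseteq> S" and sm: "smooth_on U A" "smooth_on U B" "smooth_on U C" "smooth_on U E"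
    and det: "\<And>s. s \<in> U \<Longrightarrow> A s * E s - B s * C s \<noteq> 0"
  shows "frac_lin_integral_on U g A B C E \<longleftrightarrow> (\<forall>s\<in>U. \<forall>u w.
      (comp1 C E s * u + comp2 E s * w) * sym_derivative (comp1 A B) (comp2 B) s u w
      = (comp1 A B s * u + comp2 B s * w) * sym_derivative (comp1 C E) (comp2 E) s u w)"
proof -
  define G where "G s u w = (comp1 C E s * u + comp2 E s * w) * sym_derivative (comp1 A B) (comp2 B) s u w
      - (comp1 A B s * u + comp2 B s * w) * sym_derivative (comp1 C E) (comp2 E) s u w" for s u w
  have pb: "poisson_bracket (frac_lin A B C E) (geodesic_hamiltonian g) (s, v) = 0
      \<longleftrightarrow> G s (frame_p (s, v)) (frame_q (s, v)) = 0"
    if s: "s \<in> U" and nz: "C s * v $ 1 + E s * v $ 2 \<noteq> 0" for s v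
  proof -
    have sS: "s \<in> S" using s U(2) by blast
    have d: "A differentiable at s" "B differentiable at s" "C differentiable at s" "E differentiable at s"
      using sm s by (auto intro: smooth_on_differentiable)
    have "frac_lin A B C E = (\<lambda>z. momentum A B z / momentum C E z)"
      by (auto simp: frac_lin_def momentum_def)
    then have "poisson_bracket (frac_lin A B C E) (geodesic_hamiltonian g) (s, v)
        = - G s (frame_p (s, v)) (frame_q (s, v)) / (momentum C E (s, v))\<^sup>2"
      using poisson_bracket_divide[OF along_momentum(2)[OF d(1,2)] along_momentum(2)[OF d(3,4)], of v]
        nz poisson_bracket_momentum[OF sS d(1,2)] poisson_bracket_momentum[OF sS d(3,4)]
      by (simp add: momentum_frame[OF sS, symmetric] G_def) (simp add: momentum_def)
    then show ?thesis using nz by (simp add: momentum_def)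
  qed
  have "frac_lin_integral_on U g A B C E \<longleftrightarrow> (\<forall>s\<in>U. \<forall>u w. G s u w = 0)"
  proof
    assume I: "frac_lin_integral_on U g A B C E"
    have off: "G s u w = 0" if s: "s \<in> U" and nz: "comp1 C E s * u + comp2 E s * w \<noteq> 0" for s u w
    proof -
      have sS: "s \<in> S" using s U(2) by blast
      define v :: "real^2" where "v = vector [P s * u, Q s * u + R s * w]"
      have uw: "frame_p (s, v) = u" "frame_q (s, v) = w"
        using PR_pos[OF sS] by (simp_all add: v_def frame_p_def frame_q_def)
      have "C s * v $ 1 + E s * v $ 2 \<noteq> 0"
        using nz by (simp add: v_def comp1_def comp2_def algebra_simps)
      then show ?thesis
        using pb[OF s, of v] I s uw by (simp add: frac_lin_integral_on_def)
    qed
    show "\<forall>s\<in>U. \<forall>u w. G s u w = 0"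
    proof (intro ballI allI)
      fix s u w assume s: "s \<in> U"
      have sS: "s \<in> S" using s U(2) by blast
      let ?y1 = "comp1 C E s" and ?y2 = "comp2 E s"
      have "?y1 \<noteq> 0 \<or> ?y2 \<noteq> 0"
        using comp_det[of A B s E C] det[OF s] PR_pos[OF sS] by auto
      then have ypos: "?y1\<^sup>2 + ?y2\<^sup>2 \<noteq> 0" by (simp add: sum_power2_eq_zero_iff)
      show "G s u w = 0"
      proof (cases "?y1 * u + ?y2 * w = 0")
        case False
        then show ?thesis using off[OF s] by blast
      next
        case True
        \<comment> \<open>adding multiples of the coefficient vector moves off the zero line of
          the denominator\<close>
        have z: "G s (u + t * ?y1) (w + t * ?y2) = 0" if "t \<noteq> 0" for t
        proof (rule off[OF s])
          have "?y1 * (u + t * ?y1) + ?y2 * (w + t * ?y2) = t * (?y1\<^sup>2 + ?y2\<^sup>2)"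
            using True by (simp add: algebra_simps power2_eq_square)
          then show "?y1 * (u + t * ?y1) + ?y2 * (w + t * ?y2) \<noteq> 0" using that ypos by simp
        qed
        have "isCont (\<lambda>t. G s (u + t * ?y1) (w + t * ?y2)) 0"
          unfolding G_def sym_derivative_def by (intro continuous_intros)
        then have "((\<lambda>t. G s (u + t * ?y1) (w + t * ?y2)) \<longlongrightarrow> G s u w) (at 0)"
          by (simp add: isCont_def)
        moreover have "((\<lambda>t. G s (u + t * ?y1) (w + t * ?y2)) \<longlongrightarrow> 0) (at 0)"
          by (rule tendsto_eventually) (auto simp: eventually_at_filter z)
        ultimately show ?thesis by (rule LIM_unique)
      qed
    qed
  next
    assume "\<forall>s\<in>U. \<forall>u w. G s u w = 0"
    then show "frac_lin_integral_on U g A B C E"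
      unfolding frac_lin_integral_on_def using sm det pb by blast
  qed
  then show ?thesis by (simp add: G_def)
qed

lemma integral_imp_killing:
  assumes U: "open U" "U \<subseteq> S" and I: "frac_lin_integral_on U g A B C E"
  obtains a1 a2 where "smooth_on U a1" "smooth_on U a2"
    "twisted_killing U a1 a2 (comp1 A B) (comp2 B)" "twisted_killing U a1 a2 (comp1 C E) (comp2 E)"
proof -
  have sm: "smooth_on U A" "smooth_on U B" "smooth_on U C" "smooth_on U E"
    and det: "\<And>s. s \<in> U \<Longrightarrow> A s * E s - B s * C s \<noteq> 0"
    using I by (auto simp: frac_lin_integral_on_def)
  have "comp1 A B s * comp2 E s - comp2 B s * comp1 C E s \<noteq> 0" if "s \<in> U" for s
  proof -
    have "s \<in> S" using that U(2) by blast
    then show ?thesis unfolding comp_det using det[OF that] PR_pos by force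
  qed
  moreover have "\<And>s u v. s \<in> U \<Longrightarrow>
      (comp1 C E s * u + comp2 E s * v) * sym_derivative (comp1 A B) (comp2 B) s u v
      = (comp1 A B s * u + comp2 B s * v) * sym_derivative (comp1 C E) (comp2 E) s u v"
    using integral_iff_cubic[OF U sm det] I by blast
  ultimately show ?thesis
    using twisted_killing_of_cubic[OF U smooth_comp[OF U sm(1,2)] smooth_comp[OF U sm(3,4)]] that by blast
qed

lemma killing_imp_integral:
  assumes U: "open U" "U \<subseteq> S" and sm: "smooth_on U A" "smooth_on U B" "smooth_on U C" "smooth_on U E"
    and det: "\<And>s. s \<in> U \<Longrightarrow> A s * E s - B s * C s \<noteq> 0"
    and "twisted_killing U a1 a2 (comp1 A B) (comp2 B)" "twisted_killing U a1 a2 (comp1 C E) (comp2 E)"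
  shows "frac_lin_integral_on U g A B C E"
  using integral_iff_cubic[OF U sm det] cubic_of_twisted_killing[OF assms(8,9)] by blast

end

section \<open>Submanifolds\<close>

text \<open>In a flattening chart f the lines become curves in the linear subspace L, so the
  derivative of f, which is injective since f has a differentiable inverse, maps their directions
  into L.\<close>

lemma embedded_submanifold_tangent_lines:
  fixes M :: "'a::euclidean_space set" and \<Phi> :: "'b::euclidean_space \<Rightarrow> 'a"
  assumes M: "embedded_submanifold d M" and x: "x \<in> M" and \<Phi>: "linear \<Phi>" "inj \<Phi>"
    and lines: "\<And>b t. b \<in> Basis \<Longrightarrow> x + t *\<^sub>R \<Phi> b \<in> M"
  shows "DIM('b) \<le> d"
proof -
  obtain U V f h and L :: "'a set" where U: "x \<in> U" "diffeomorphism_on U V f h" "subspace L" "dim L = d"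
    "f ` (M \<inter> U) = V \<inter> L"
    using M x unfolding embedded_submanifold_def by (elim ballE[of _ _ x]) auto
  have oU: "open U" "open V" "homeomorphism U V f h" "smooth_on U f" "smooth_on V h"
    using U(2) by (auto simp: diffeomorphism_on_def)
  have fx: "f x \<in> V" using oU(3) U(1) by (auto simp: homeomorphism_def)
  define f' h' where "f' = frechet_derivative f (at x)" and "h' = frechet_derivative h (at (f x))"
  have f': "(f has_derivative f') (at x)"
    unfolding f'_def by (rule smooth_on_has_derivative[OF oU(4) U(1)])
  have h': "(h has_derivative h') (at (f x))"
    unfolding h'_def by (rule smooth_on_has_derivative[OF oU(5) fx])
  have "((\<lambda>y. h (f y)) has_derivative (\<lambda>v. h' (f' v))) (at x)"
    by (rule has_derivative_compose[OF f' h'])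
  moreover have "((\<lambda>y. h (f y)) has_derivative (\<lambda>v. v)) (at x)"
    by (rule has_derivative_transform_within_open[OF has_derivative_ident oU(1) U(1)])
      (use oU(3) in \<open>auto simp: homeomorphism_def\<close>)
  ultimately have hf: "h' (f' v) = v" for v
    using has_derivative_unique by (metis (no_types))
  have lin_f': "linear f'" by (rule has_derivative_linear[OF f'])
  have tangent: "f' (\<Phi> b) \<in> L" if b: "b \<in> Basis" for b
  proof -
    define c where "c t = f (x + t *\<^sub>R \<Phi> b)" for t
    have inL: "c t \<in> L" if "x + t *\<^sub>R \<Phi> b \<in> U" for t
      using U(5) lines[OF b, of t] that by (auto simp: c_def)
    have "((\<lambda>t. x + t *\<^sub>R \<Phi> b) has_derivative (\<lambda>t. t *\<^sub>R \<Phi> b)) (at 0)"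
      by (auto intro!: derivative_eq_intros)
    moreover have "(f has_derivative f') (at (x + 0 *\<^sub>R \<Phi> b))" using f' by simp
    ultimately have "(c has_derivative (\<lambda>t. f' (t *\<^sub>R \<Phi> b))) (at 0)"
      unfolding c_def[abs_def] by (rule has_derivative_compose)
    then have "((\<lambda>t. norm (c t - c 0 - t *\<^sub>R f' (\<Phi> b)) / norm t) \<longlongrightarrow> 0) (at 0)"
      unfolding has_derivative_at by (simp add: linear_cmul[OF lin_f'])
    moreover have "\<forall>\<^sub>F t in at 0. norm (c t - c 0 - t *\<^sub>R f' (\<Phi> b)) / norm t
        = norm ((c t - c 0) /\<^sub>R t - f' (\<Phi> b))"
      unfolding eventually_at_filter
    proof (intro always_eventually allI impI)
      fix t :: real assume t: "t \<noteq> 0"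
      have "(c t - c 0) /\<^sub>R t - f' (\<Phi> b) = (c t - c 0 - t *\<^sub>R f' (\<Phi> b)) /\<^sub>R t"
        using t by (simp add: scaleR_diff_right)
      then show "norm (c t - c 0 - t *\<^sub>R f' (\<Phi> b)) / norm t = norm ((c t - c 0) /\<^sub>R t - f' (\<Phi> b))"
        by (simp add: divide_inverse mult.commute)
    qed
    ultimately have "((\<lambda>t. norm ((c t - c 0) /\<^sub>R t - f' (\<Phi> b))) \<longlongrightarrow> 0) (at 0)"
      by (rule Lim_transform_eventually)
    then have lim: "((\<lambda>t. (c t - c 0) /\<^sub>R t) \<longlongrightarrow> f' (\<Phi> b)) (at 0)"
      unfolding tendsto_norm_zero_iff by (rule LIM_zero_cancel)
    have "continuous (at 0) (\<lambda>t. x + t *\<^sub>R \<Phi> b)" by (intro continuous_intros)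
    then have "((\<lambda>t. x + t *\<^sub>R \<Phi> b) \<longlongrightarrow> x) (at 0)" by (simp add: continuous_within)
    then have "\<forall>\<^sub>F t in at 0. x + t *\<^sub>R \<Phi> b \<in> U" using oU(1) U(1) by (rule topological_tendstoD)
    then have ev: "\<forall>\<^sub>F t in at 0. (c t - c 0) /\<^sub>R t \<in> L"
    proof eventually_elim
      case (elim t)
      then show ?case
        using inL[OF elim] inL[of 0] U(1) by (simp add: subspace_scale[OF U(3)] subspace_diff[OF U(3)])
    qed
    show ?thesis
      by (rule Lim_in_closed_set[OF closed_subspace[OF U(3)] ev _ lim]) simp
  qed
  have lin: "linear (f' \<circ> \<Phi>)" by (rule linear_compose[OF \<Phi>(1) lin_f'])
  have inj: "inj (f' \<circ> \<Phi>)"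
  proof (rule injI)
    fix a b assume "(f' \<circ> \<Phi>) a = (f' \<circ> \<Phi>) b"
    then have "h' (f' (\<Phi> a)) = h' (f' (\<Phi> b))" by simp
    then show "a = b" using \<Phi>(2) by (simp add: hf inj_eq)
  qed
  have "(f' \<circ> \<Phi>) ` UNIV \<subseteq> L"
  proof -
    have "(f' \<circ> \<Phi>) ` UNIV = (f' \<circ> \<Phi>) ` span Basis" by simp
    also have "\<dots> = span ((f' \<circ> \<Phi>) ` Basis)" by (rule linear_span_image[OF lin, symmetric])
    also have "\<dots> \<subseteq> L" by (rule span_minimal[OF _ U(3)]) (use tangent in auto)
    finally show ?thesis .
  qed
  then have "dim ((f' \<circ> \<Phi>) ` UNIV) \<le> d" unfolding U(4)[symmetric] by (rule dim_subset)
  moreover have "dim ((f' \<circ> \<Phi>) ` UNIV) = DIM('b)"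
    using dim_image_eq[OF lin, of UNIV] inj by simp
  ultimately show ?thesis by simp
qed

definition unimodular :: "real^4 \<Rightarrow> bool" where
  "unimodular F \<longleftrightarrow> F $ 1 * F $ 4 - F $ 2 * F $ 3 = 1"

text \<open>Near a point of the graph of T the other graphs are closed sets to be avoided. The
  chart subtracts T F from the second component and shears the coordinate k by q, the solution of
  the equation of SL(2) for that coordinate; q does not depend on the coordinate k, so that the
  inverse is the opposite shear.\<close>

lemma graph_chart:
  fixes \<T> :: "(real^4 \<Rightarrow> real^2^4) set" and q :: "real^4 \<Rightarrow> real" and i k :: 4
  defines "M \<equiv> {(F, T F) | F T. unimodular F \<and> T \<in> \<T>}"
  assumes fin: "finite \<T>" and lin: "\<And>T. T \<in> \<T> \<Longrightarrow> linear T" and T: "T \<in> \<T>"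
    and sep: "\<And>T T' F. T \<in> \<T> \<Longrightarrow> T' \<in> \<T> \<Longrightarrow> unimodular F \<Longrightarrow> T F = T' F \<Longrightarrow> T = T'"
    and F0: "unimodular F0" "F0 $ i \<noteq> 0" and ik: "i \<noteq> k"
    and q: "\<And>F. F $ i \<noteq> 0 \<Longrightarrow> unimodular F \<longleftrightarrow> F $ k = q F"
    and qk: "\<And>F r. q (F + r *\<^sub>R axis k 1) = q F"
    and qs: "smooth_on {z :: (real^4) \<times> (real^2^4). fst z $ i \<noteq> 0} (\<lambda>z. q (fst z))"
  shows "\<exists>U V f h (L :: ((real^4) \<times> (real^2^4)) set). (F0, T F0) \<in> U \<and> diffeomorphism_on U V f h \<and>
        subspace L \<and> dim L = 3 \<and> f ` (M \<inter> U) = V \<inter> L"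
proof -
  define W where "W = {z :: (real^4) \<times> (real^2^4). fst z $ i \<noteq> 0}"
  define Z where "Z = {z. \<forall>T'\<in>\<T> - {T}. snd z \<noteq> T' (fst z)}"
  define U where "U = W \<inter> Z"
  define f where "f z = (fst z - q (fst z) *\<^sub>R axis k 1, snd z - T (fst z))" for z
  define h where "h y = (fst y + q (fst y) *\<^sub>R axis k 1, snd y + T (fst y + q (fst y) *\<^sub>R axis k 1))" for y
  define V where "V = W \<inter> h -` Z"
  define L where "L = {y :: (real^4) \<times> (real^2^4). snd y = 0 \<and> fst y $ k = 0}"
  have blT: "bounded_linear T'" if "T' \<in> \<T>" for T' using lin[OF that] by (rule linear_conv_bounded_linear[THEN iffD1])
  have qk': "q (F - r *\<^sub>R axis k 1) = q F" for F r using qk[of F "- r"] by simp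
  have oW: "open W" unfolding W_def by (intro open_Collect_neq continuous_intros)
  have oZ: "open Z"
  proof -
    have "closed {z. snd z = T' (fst z)}" if "T' \<in> \<T>" for T'
      by (intro closed_Collect_eq continuous_intros bounded_linear.continuous_on[OF blT[OF that]])
    then have cl: "closed (\<Union>T'\<in>\<T> - {T}. {z. snd z = T' (fst z)})" using fin by (intro closed_UN) auto
    have Z: "Z = - (\<Union>T'\<in>\<T> - {T}. {z. snd z = T' (fst z)})" by (auto simp: Z_def)
    show ?thesis unfolding Z using cl by (rule open_Compl)
  qed
  have oU: "open U" unfolding U_def using oW oZ by (rule open_Int)
  have hW: "fst (h y) $ i = fst y $ i" "fst (f y) $ i = fst y $ i" for y
    using ik by (simp_all add: h_def f_def axis_def)
  have hf: "h (f z) = z" "f (h z) = z" for z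
    by (simp_all add: h_def f_def qk qk')
  have smf: "smooth_on W f"
  proof -
    have bl: "bounded_linear (\<lambda>z. (fst z, snd z - T (fst z)))"
      by (intro bounded_linear_Pair bounded_linear_fst bounded_linear_sub bounded_linear_snd
          bounded_linear_compose[OF blT[OF T]])
    have "smooth_on W (\<lambda>z. (fst z, snd z - T (fst z)) - q (fst z) *\<^sub>R (axis k 1, 0))"
      using qs unfolding W_def[symmetric]
      by (intro smooth_on_diff smooth_on_scaleR smooth_on_const smooth_on_linear[OF _ bl] oW)
    moreover have "f = (\<lambda>z. (fst z, snd z - T (fst z)) - q (fst z) *\<^sub>R (axis k 1, 0))"
      by (auto simp: f_def)
    ultimately show ?thesis by simp
  qed
  have smh: "smooth_on W h"
  proof -
    have bl: "bounded_linear (\<lambda>z. (fst z, snd z + T (fst z)))"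
      by (intro bounded_linear_Pair bounded_linear_fst bounded_linear_add bounded_linear_snd
          bounded_linear_compose[OF blT[OF T]])
    have "smooth_on W (\<lambda>z. (fst z, snd z + T (fst z)) + q (fst z) *\<^sub>R (axis k 1, T (axis k 1)))"
      using qs unfolding W_def[symmetric]
      by (intro smooth_on_add smooth_on_scaleR smooth_on_const smooth_on_linear[OF _ bl] oW)
    moreover have "h = (\<lambda>z. (fst z, snd z + T (fst z)) + q (fst z) *\<^sub>R (axis k 1, T (axis k 1)))"
      by (auto simp: h_def linear_add[OF lin[OF T]] linear_cmul[OF lin[OF T]])
    ultimately show ?thesis by simp
  qed
  have oV: "open V"
    unfolding V_def using continuous_open_preimage[OF smooth_on_continuous_on[OF smh] oW oZ] .
  have fU: "f ` U = V" and hV: "h ` V = U"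
  proof -
    have "f z \<in> V" if "z \<in> U" for z using that by (simp add: U_def V_def hf W_def hW)
    moreover have "h y \<in> U" if "y \<in> V" for y using that by (simp add: U_def V_def W_def hW)
    ultimately show "f ` U = V" "h ` V = U" using hf by (auto simp: image_iff) metis+
  qed
  have homeo: "homeomorphism U V f h"
    unfolding homeomorphism_def using hf fU hV smooth_on_continuous_on[OF smf] smooth_on_continuous_on[OF smh]
    by (auto simp: U_def V_def intro: continuous_on_subset)
  have "diffeomorphism_on U V f h"
    unfolding diffeomorphism_on_def using oU oV homeo smf smh
    by (auto simp: U_def V_def intro: smooth_on_subset)
  moreover have "(F0, T F0) \<in> U"
    using F0 sep[OF T _ F0(1)] by (auto simp: U_def W_def Z_def)
  moreover have sL: "subspace L"
    unfolding L_def by (auto simp: subspace_def)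
  moreover have "dim L = 3"
  proof -
    let ?d = "(\<lambda>j. (axis j 1 :: real^4, 0 :: real^2^4)) ` (UNIV - {k})"
    have d: "?d \<subseteq> Basis" by (auto simp: Basis_prod_def Basis_vec_def)
    have "inj_on (\<lambda>j. (axis j 1 :: real^4, 0 :: real^2^4)) (UNIV - {k})"
      by (auto simp: inj_on_def axis_eq_axis)
    then have card: "card ?d = 3" by (simp add: card_image card_Diff_singleton)
    have "L = {x. \<forall>i\<in>Basis. i \<notin> ?d \<longrightarrow> x \<bullet> i = 0}"
    proof (intro set_eqI iffI; clarify)
      fix a b i assume ab: "(a, b) \<in> L" and i: "i \<in> Basis" "i \<notin> ?d"
      then consider j where "i = (axis j 1, 0)" | u where "i = (0, u)"
        by (auto simp: Basis_prod_def Basis_vec_def)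
      then show "(a, b) \<bullet> i = 0"
      proof cases
        case 1
        then have "j = k" using i(2) by auto
        then show ?thesis using ab 1 by (simp add: L_def inner_axis)
      next
        case 2
        then show ?thesis using ab by (simp add: L_def)
      qed
    next
      fix a b assume *: "\<forall>i\<in>Basis. i \<notin> ?d \<longrightarrow> (a, b) \<bullet> i = 0"
      have "(axis k 1 :: real^4, 0 :: real^2^4) \<in> Basis" "(axis k 1 :: real^4, 0 :: real^2^4) \<notin> ?d"
        by (auto simp: Basis_prod_def Basis_vec_def axis_eq_axis)
      then have "a $ k = 0" using * by (auto simp: inner_axis)
      moreover have "b \<bullet> u = 0" if "u \<in> Basis" for u
      proof -
        have "(0, u) \<in> Basis" using that by (simp add: Basis_prod_def)
        moreover have "(0, u) \<notin> ?d" using that nonzero_Basis by auto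
        ultimately show ?thesis using * by force
      qed
      then have "b = 0" by (simp add: euclidean_eq_iff[of b])
      ultimately show "(a, b) \<in> L" by (simp add: L_def)
    qed
    then show ?thesis using dim_substandard[OF d] card by simp
  qed
  moreover have "f ` (M \<inter> U) = V \<inter> L"
  proof (intro set_eqI iffI)
    fix y assume "y \<in> f ` (M \<inter> U)"
    then obtain z where z: "z \<in> M" "z \<in> U" "y = f z" by auto
    then obtain F T' where F: "z = (F, T' F)" "unimodular F" "T' \<in> \<T>" by (auto simp: M_def)
    then have "T' = T" "F $ i \<noteq> 0" using z(2) by (auto simp: U_def Z_def W_def)
    then have "y \<in> L" using z(3) F q by (simp add: L_def f_def)
    then show "y \<in> V \<inter> L" using z fU by blast
  next
    fix y assume y: "y \<in> V \<inter> L"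
    define F where "F = fst y + q (fst y) *\<^sub>R axis k 1"
    have "h y \<in> U" using y hV by blast
    moreover have "h y = (F, T F)" using y by (simp add: h_def F_def L_def)
    moreover have "F $ i \<noteq> 0" using calculation by (simp add: U_def W_def)
    moreover have "F $ k = q F" using y by (simp add: F_def L_def qk)
    ultimately have "h y \<in> M \<inter> U" using q T by (auto simp: M_def)
    then show "y \<in> f ` (M \<inter> U)" using hf(2)[of y] by (metis imageI)
  qed
  ultimately show ?thesis by blast
qed

text \<open>A finite union of disjoint graphs over SL(2) has the dimension of SL(2). The equation
  of SL(2) is solved for the last coordinate where the first one is nonzero, and for the third
  where the second one is: one of them is nonzero everywhere.\<close>

lemma graphs_over_unimodular_submanifold:
  fixes \<T> :: "(real^4 \<Rightarrow> real^2^4) set"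
  assumes fin: "finite \<T>" and lin: "\<And>T. T \<in> \<T> \<Longrightarrow> linear T"
    and sep: "\<And>T T' F. T \<in> \<T> \<Longrightarrow> T' \<in> \<T> \<Longrightarrow> unimodular F \<Longrightarrow> T F = T' F \<Longrightarrow> T = T'"
  shows "embedded_submanifold 3 {(F, T F) | F T. unimodular F \<and> T \<in> \<T>}"
  unfolding embedded_submanifold_def
proof
  fix x assume "x \<in> {(F, T F) | F T. unimodular F \<and> T \<in> \<T>}"
  then obtain F T where x: "x = (F, T F)" "unimodular F" "T \<in> \<T>" by auto
  have oc: "open {z :: (real^4) \<times> (real^2^4). fst z $ i \<noteq> 0}" for i
    by (intro open_Collect_neq continuous_intros)
  have sc: "open O' \<Longrightarrow> smooth_on O' (\<lambda>z :: (real^4) \<times> (real^2^4). fst z $ i)" for O' i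
    by (intro smooth_on_linear bounded_linear_compose[OF bounded_linear_vec_nth bounded_linear_fst])
  have "F $ 1 \<noteq> 0 \<or> F $ 2 \<noteq> 0" using x(2) by (auto simp: unimodular_def)
  then show "\<exists>U V f h (L :: ((real^4) \<times> (real^2^4)) set). x \<in> U \<and> diffeomorphism_on U V f h \<and>
        subspace L \<and> dim L = 3 \<and> f ` ({(F, T F) | F T. unimodular F \<and> T \<in> \<T>} \<inter> U) = V \<inter> L"
  proof
    assume F1: "F $ 1 \<noteq> 0"
    have "smooth_on {z :: (real^4) \<times> (real^2^4). fst z $ 1 \<noteq> 0} (\<lambda>z. (1 + fst z $ 2 * fst z $ 3) / fst z $ 1)"
      using oc by (intro smooth_intros sc) auto
    then show ?thesis
      unfolding x(1)
      by (intro graph_chart[OF fin lin x(3) sep x(2) F1, where k=4 and q="\<lambda>F. (1 + F $ 2 * F $ 3) / F $ 1"])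
        (auto simp: unimodular_def axis_def field_simps)
  next
    assume F2: "F $ 2 \<noteq> 0"
    have "smooth_on {z :: (real^4) \<times> (real^2^4). fst z $ 2 \<noteq> 0} (\<lambda>z. (fst z $ 1 * fst z $ 4 - 1) / fst z $ 2)"
      using oc by (intro smooth_intros sc) auto
    then show ?thesis
      unfolding x(1)
      by (intro graph_chart[OF fin lin x(3) sep x(2) F2, where k=3 and q="\<lambda>F. (F $ 1 * F $ 4 - 1) / F $ 2"])
        (auto simp: unimodular_def axis_def field_simps)
  qed
qed

section \<open>One-jets of normalized integrals\<close>

lemma vector_4:
  "(vector [x, y, z, w] :: 'a::zero^4) $ 1 = x" "(vector [x, y, z, w] :: 'a::zero^4) $ 2 = y"
  "(vector [x, y, z, w] :: 'a::zero^4) $ 3 = z" "(vector [x, y, z, w] :: 'a::zero^4) $ 4 = w"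
  unfolding vector_def by simp_all

lemma vector_4_eq_iff:
  "(F :: 'a::zero^4) = vector [x, y, z, w] \<longleftrightarrow> F $ 1 = x \<and> F $ 2 = y \<and> F $ 3 = z \<and> F $ 4 = w"
  by (auto simp: vec_eq_iff forall_4 vector_4)

lemma vector_4_add:
  "vector [x, y, z, w] + vector [x', y', z', w'] = (vector [x + x', y + y', z + z', w + w'] :: 'a::real_vector^4)"
  by (simp add: vector_4_eq_iff vector_4)

lemma vector_4_scaleR:
  "t *\<^sub>R vector [x, y, z, w] = (vector [t *\<^sub>R x, t *\<^sub>R y, t *\<^sub>R z, t *\<^sub>R w] :: 'a::real_vector^4)"
  by (simp add: vector_4_eq_iff vector_4)

definition gradient :: "(real^2 \<Rightarrow> real) \<Rightarrow> real^2 \<Rightarrow> real^2" where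
  "gradient f s = vector [pderiv_at 1 f s, pderiv_at 2 f s]"

lemma gradient_nth: "gradient f s $ j = pderiv_at j f s"
  using exhaust_2[of j] by (auto simp: gradient_def)

lemma jet1_vector:
  assumes "A differentiable at s" "B differentiable at s" "C differentiable at s" "E differentiable at s"
  shows "jet1 s (\<lambda>s. vector [A s, B s, C s, E s])
    = (vector [A s, B s, C s, E s], vector [gradient A s, gradient B s, gradient C s, gradient E s])"
proof -
  let ?D = "\<lambda>f. frechet_derivative f (at s)"
  have v: "vector [x, y, z, w] = x *\<^sub>R axis 1 1 + y *\<^sub>R axis 2 1 + z *\<^sub>R axis 3 1 + w *\<^sub>R (axis 4 1 :: real^4)" for x y z w
    by (simp add: vec_eq_iff forall_4 vector_4 axis_def)
  note d = assms[THEN differentiable_has_derivative]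
  have "((\<lambda>s. vector [A s, B s, C s, E s] :: real^4) has_derivative
      (\<lambda>h. vector [?D A h, ?D B h, ?D C h, ?D E h])) (at s)"
    unfolding v by (intro has_derivative_add has_derivative_scaleR_left d)
  then have "frechet_derivative (\<lambda>s. vector [A s, B s, C s, E s] :: real^4) (at s)
      = (\<lambda>h. vector [?D A h, ?D B h, ?D C h, ?D E h])"
    by (rule frechet_derivative_at[symmetric])
  then show ?thesis
    by (simp add: jet1_def vec_eq_iff forall_4 matrix_def vector_4 gradient_nth pderiv_at_def)
qed

lemma (in moving_frame) twisted_parallel_combination:
  assumes W: "twisted_parallel U a1 a2 b1 b2 W1 W2" and Z: "twisted_parallel U a1 a2 b1 b2 Z1 Z2"
    and sm: "smooth_on U W1" "smooth_on U W2" "smooth_on U Z1" "smooth_on U Z2"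
  shows "twisted_parallel U a1 a2 b1 b2 (\<lambda>s. m * W1 s + n * Z1 s) (\<lambda>s. m * W2 s + n * Z2 s)"
  unfolding twisted_parallel_def
proof (intro ballI)
  fix s assume s: "s \<in> U"
  have d: "W1 differentiable at s" "W2 differentiable at s" "Z1 differentiable at s" "Z2 differentiable at s"
    using sm s by (auto intro: smooth_on_differentiable)
  note w = W[unfolded twisted_parallel_def, rule_format, OF s] Z[unfolded twisted_parallel_def, rule_format, OF s]
  have e: "along e (\<lambda>s. m * W1 s + n * Z1 s) s = m * along e W1 s + n * along e Z1 s"
    "along e (\<lambda>s. m * W2 s + n * Z2 s) s = m * along e W2 s + n * along e Z2 s" for e
    by (simp_all add: along_simps d)
  show "D1 (\<lambda>s. m * W1 s + n * Z1 s) s = - a1 s * (m * W1 s + n * Z1 s) + c1 s * (m * W2 s + n * Z2 s) \<and>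
      D1 (\<lambda>s. m * W2 s + n * Z2 s) s = (b2 s - c1 s) * (m * W1 s + n * Z1 s) - (a1 s + b1 s) * (m * W2 s + n * Z2 s) \<and>
      D2 (\<lambda>s. m * W1 s + n * Z1 s) s = - (a2 s + b2 s) * (m * W1 s + n * Z1 s) + (c2 s + b1 s) * (m * W2 s + n * Z2 s) \<and>
      D2 (\<lambda>s. m * W2 s + n * Z2 s) s = - c2 s * (m * W1 s + n * Z1 s) - a2 s * (m * W2 s + n * Z2 s)"
    unfolding e using w by (elim conjE, intro conjI; (algebra | simp add: algebra_simps))
qed

context riemannian_chart
begin

text \<open>The derivative of the logarithm of the area density \<open>P R\<close> along the
  frame.\<close>

definition log_area :: "2 \<Rightarrow> real^2 \<Rightarrow> real" where
  "log_area i s = (if i = 1 then D1 (\<lambda>s. P s * R s) s else D2 (\<lambda>s. P s * R s) s) / (P s * R s)"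

text \<open>The gradients of the coefficients A, B of a normalized twisted parallel field,
  computed from their values x, y and the value b of \<open>\<beta>\<close>. Normalization fixes
  the frame determinant of the pair as the area density, hence \<open>2 \<alpha> + \<beta>\<close>
  as minus its logarithmic differential; so a1 and a2 are determined by b. The remaining lines
  solve the equations of a parallel field for the derivatives of B and A, and pass from frame to
  coordinate derivatives.\<close>

definition jet_row :: "real^2 \<Rightarrow> real \<times> real \<Rightarrow> real \<Rightarrow> real \<Rightarrow> (real^2) \<times> (real^2)" where
  "jet_row s b x y = (let
      a1 = - (fst b + log_area 1 s) / 2; a2 = - (snd b + log_area 2 s) / 2;
      W1 = x * P s + y * Q s; W2 = y * R s;
      d1W1 = - a1 * W1 + c1 s * W2; d1W2 = (snd b - c1 s) * W1 - (a1 + fst b) * W2;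
      d2W1 = - (a2 + snd b) * W1 + (c2 s + fst b) * W2; d2W2 = - c2 s * W1 - a2 * W2;
      d1B = (d1W2 - y * D1 R s) / R s; d2B = (d2W2 - y * D2 R s) / R s;
      d1A = (d1W1 - x * D1 P s - y * D1 Q s - Q s * d1B) / P s;
      d2A = (d2W1 - x * D2 P s - y * D2 Q s - Q s * d2B) / P s
    in (vector [P s * d1A, Q s * d1A + R s * d2A], vector [P s * d1B, Q s * d1B + R s * d2B]))"

definition jet_map :: "real^2 \<Rightarrow> real \<times> real \<Rightarrow> real^4 \<Rightarrow> real^2^4" where
  "jet_map s b F = vector [fst (jet_row s b (F $ 1) (F $ 2)), snd (jet_row s b (F $ 1) (F $ 2)),
     fst (jet_row s b (F $ 3) (F $ 4)), snd (jet_row s b (F $ 3) (F $ 4))]"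

lemma jet_row_linear:
  "jet_row s b (x + x') (y + y') = jet_row s b x y + jet_row s b x' y'"
  "jet_row s b (r * x) (r * y) = r *\<^sub>R jet_row s b x y"
proof -
  have eqI: "(vector [p, q] :: real^2, vector [p', q'] :: real^2) = (vector [u, v] + vector [w, z], vector [u', v'] + vector [w', z'])"
    if "p = u + w" "q = v + z" "p' = u' + w'" "q' = v' + z'" for p q p' q' u v w z u' v' w' z' :: real
    using that by (simp add: vec_eq_iff forall_2)
  have eqI': "(vector [p, q] :: real^2, vector [p', q'] :: real^2) = (r *\<^sub>R vector [u, v], r *\<^sub>R vector [u', v'])"
    if "p = r * u" "q = r * v" "p' = r * u'" "q' = r * v'" for p q p' q' u v u' v' r :: real
    using that by (simp add: vec_eq_iff forall_2)
  show "jet_row s b (x + x') (y + y') = jet_row s b x y + jet_row s b x' y'"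
    unfolding jet_row_def Let_def divide_inverse add_Pair by (rule eqI; algebra)
  show "jet_row s b (r * x) (r * y) = r *\<^sub>R jet_row s b x y"
    unfolding jet_row_def Let_def divide_inverse scaleR_Pair by (rule eqI'; algebra)
qed

lemma linear_jet_map: "linear (jet_map s b)"
  by (rule linearI) (simp_all add: jet_map_def jet_row_linear vec_eq_iff forall_4 vector_4)

lemma jet_row_eq:
  assumes U: "open U" "U \<subseteq> S" and s: "s \<in> U" and AB: "smooth_on U A" "smooth_on U B"
    and W: "twisted_parallel U a1 a2 b1 b2 (comp1 A B) (comp2 B)"
    and a: "a1 s = - (b1 s + log_area 1 s) / 2" "a2 s = - (b2 s + log_area 2 s) / 2"
  shows "jet_row s (b1 s, b2 s) (A s) (B s) = (gradient A s, gradient B s)"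
proof -
  have sS: "s \<in> S" using s U(2) by blast
  have d: "A differentiable at s" "B differentiable at s" using AB s smooth_on_differentiable by blast+
  note dP = PQR_differentiable[OF sS] and pos = PR_pos[OF sS]
  note w = W[unfolded twisted_parallel_def, rule_format, OF s]
  have e: "along e (comp1 A B) s = A s * along e P s + along e A s * P s + B s * along e Q s + along e B s * Q s"
    "along e (comp2 B) s = B s * along e R s + along e B s * R s" for e
    unfolding comp1_def[abs_def] comp2_def[abs_def] by (simp_all add: along_simps d dP)
  define a1' a2' where "a1' = - (b1 s + log_area 1 s) / 2" and "a2' = - (b2 s + log_area 2 s) / 2"
  have dB: "D1 B s = ((b2 s - c1 s) * (A s * P s + B s * Q s) - (a1' + b1 s) * (B s * R s) - B s * D1 R s) / R s"
    "D2 B s = (- c2 s * (A s * P s + B s * Q s) - a2' * (B s * R s) - B s * D2 R s) / R s"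
    using w pos unfolding e a comp1_def comp2_def a1'_def a2'_def by (simp_all add: eq_divide_eq)
  have dA: "D1 A s = (- a1' * (A s * P s + B s * Q s) + c1 s * (B s * R s) - A s * D1 P s - B s * D1 Q s - Q s * D1 B s) / P s"
    "D2 A s = (- (a2' + b2 s) * (A s * P s + B s * Q s) + (c2 s + b1 s) * (B s * R s) - A s * D2 P s - B s * D2 Q s - Q s * D2 B s) / P s"
    using w pos unfolding e a comp1_def comp2_def a1'_def a2'_def by (simp_all add: eq_divide_eq algebra_simps)
  show ?thesis
    unfolding jet_row_def Let_def fst_conv snd_conv a1'_def[symmetric] a2'_def[symmetric]
      dB[symmetric] dA[symmetric] gradient_def pderiv_along_e[OF d(1) sS] pderiv_along_e[OF d(2) sS] ..
qed

text \<open>In the difference of the rows for b and b' only terms linear in \<open>b - b'\<close>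
  remain; two independent rows suffice to see that they vanish only for \<open>b =
  b'\<close>.\<close>

lemma jet_row_inj:
  assumes s: "s \<in> S" and nz: "x * w - y * z \<noteq> 0"
    and eq: "jet_row s b x y = jet_row s b' x y" "jet_row s b z w = jet_row s b' z w"
  shows "b = b'"
proof -
  note pos = PR_pos[OF s]
  define d1 d2 where "d1 = fst b - fst b'" and "d2 = snd b - snd b'"
  have key: "d1 * (x * P s + y * Q s) = 0 \<and> d2 * (x * P s + y * Q s) = d1 / 2 * (y * R s)"
    if "jet_row s b x y = jet_row s b' x y" for x y
  proof -
    let ?w1 = "x * P s + y * Q s" and ?w2 = "y * R s"
    let ?B = "\<lambda>b. ((snd b - c1 s) * ?w1 - (- (fst b + log_area 1 s) / 2 + fst b) * ?w2 - y * D1 R s) / R s"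
    let ?A = "\<lambda>b. (- (- (fst b + log_area 1 s) / 2) * ?w1 + c1 s * ?w2 - x * D1 P s - y * D1 Q s - Q s * ?B b) / P s"
    have "fst (jet_row s b x y) $ 1 = fst (jet_row s b' x y) $ 1" "snd (jet_row s b x y) $ 1 = snd (jet_row s b' x y) $ 1"
      using that by simp_all
    then have 0: "P s * ?A b = P s * ?A b'" "P s * ?B b = P s * ?B b'"
      by (simp_all only: jet_row_def Let_def fst_conv snd_conv vector_2)
    then have B: "?B b = ?B b'" using pos by simp
    from 0(1) have A: "?A b = ?A b'" using pos by simp
    from B have 1: "(snd b - c1 s) * ?w1 - (- (fst b + log_area 1 s) / 2 + fst b) * ?w2
        = (snd b' - c1 s) * ?w1 - (- (fst b' + log_area 1 s) / 2 + fst b') * ?w2" using pos by simp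
    from A have "- (- (fst b + log_area 1 s) / 2) * ?w1 - Q s * ?B b = - (- (fst b' + log_area 1 s) / 2) * ?w1 - Q s * ?B b'"
      using pos by simp
    then have "- (- (fst b + log_area 1 s) / 2) * ?w1 = - (- (fst b' + log_area 1 s) / 2) * ?w1"
      unfolding B by simp
    then show ?thesis using 1 by (simp add: d1_def d2_def field_simps)
  qed
  note k = key[OF eq(1)] key[OF eq(2)]
  have "x * P s + y * Q s \<noteq> 0 \<or> z * P s + w * Q s \<noteq> 0"
  proof (rule ccontr)
    assume "\<not> ?thesis"
    then have "P s * (x * w - y * z) = 0" by algebra
    then show False using pos nz by simp
  qed
  then have "d1 = 0" "d2 = 0" using k by auto
  then show ?thesis by (simp add: d1_def d2_def prod_eq_iff)
qed

definition normalized_germ where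
  "normalized_germ s0 U A B C E \<longleftrightarrow> open U \<and> s0 \<in> U \<and> U \<subseteq> S \<and> frac_lin_integral_on U g A B C E \<and> normalized_on U A B C E"

lemma integral_jets_eq:
  "integral_jets S g s0 = {jet1 s0 (\<lambda>s. vector [A s, B s, C s, E s]) | A B C E. \<exists>U. normalized_germ s0 U A B C E}"
  by (simp add: integral_jets_def normalized_germ_def)

lemma normalized_germ_smooth:
  assumes "normalized_germ s0 U A B C E"
  shows "open U" "s0 \<in> U" "U \<subseteq> S" "smooth_on U A" "smooth_on U B" "smooth_on U C" "smooth_on U E"
    "\<And>s. s \<in> U \<Longrightarrow> A s * E s - B s * C s = 1"
    "\<And>s. s \<in> U \<Longrightarrow> comp1 A B s * comp2 E s - comp2 B s * comp1 C E s = P s * R s"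
    "\<And>s. s \<in> U \<Longrightarrow> comp1 A B s * comp2 E s - comp2 B s * comp1 C E s \<noteq> 0"
proof -
  show *: "open U" "s0 \<in> U" "U \<subseteq> S" "smooth_on U A" "smooth_on U B" "smooth_on U C" "smooth_on U E"
    "\<And>s. s \<in> U \<Longrightarrow> A s * E s - B s * C s = 1"
    using assms by (auto simp: normalized_germ_def frac_lin_integral_on_def normalized_on_def)
  then show "\<And>s. s \<in> U \<Longrightarrow> comp1 A B s * comp2 E s - comp2 B s * comp1 C E s = P s * R s"
    by (simp add: comp_det)
  moreover have "P s * R s \<noteq> 0" if "s \<in> U" for s using PR_pos[of s] that *(3) by auto
  ultimately show "\<And>s. s \<in> U \<Longrightarrow> comp1 A B s * comp2 E s - comp2 B s * comp1 C E s \<noteq> 0" by simp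
qed

text \<open>By normalization the frame determinant of the pair is \<open>P R\<close> on all of U.
  Differentiating this identity expresses \<open>\<alpha>\<close> by \<open>\<beta>\<close>, in
  the form used for the rows of a jet.\<close>

lemma jet1_normalized_germ:
  assumes I: "normalized_germ s0 U A B C E"
    and X: "twisted_parallel U a1 a2 b1 b2 (comp1 A B) (comp2 B)"
    and Y: "twisted_parallel U a1 a2 b1 b2 (comp1 C E) (comp2 E)"
  shows "jet1 s0 (\<lambda>s. vector [A s, B s, C s, E s])
    = (vector [A s0, B s0, C s0, E s0], jet_map s0 (b1 s0, b2 s0) (vector [A s0, B s0, C s0, E s0]))"
proof -
  note G = normalized_germ_smooth[OF I]
  have sS: "s0 \<in> S" using G by blast
  note sm = smooth_comp[OF G(1,3,4,5)] smooth_comp[OF G(1,3,6,7)]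
  have d: "comp1 A B differentiable at s0" "comp2 B differentiable at s0"
    "comp1 C E differentiable at s0" "comp2 E differentiable at s0"
    using sm G(2) smooth_on_differentiable by blast+
  note x = X[unfolded twisted_parallel_def, rule_format, OF G(2)] Y[unfolded twisted_parallel_def, rule_format, OF G(2)]
  have cg: "along e (\<lambda>s. P s * R s) s0
      = along e (\<lambda>s. comp1 A B s * comp2 E s - comp2 B s * comp1 C E s) s0" for e
    by (rule along_cong[OF G(1,2)]) (simp add: G(9))
  have "D1 (\<lambda>s. P s * R s) s0 = - (2 * a1 s0 + b1 s0) * (P s0 * R s0)"
    "D2 (\<lambda>s. P s * R s) s0 = - (2 * a2 s0 + b2 s0) * (P s0 * R s0)"
    unfolding cg G(9)[OF G(2), symmetric] using x
    by (simp_all add: along_simps d) (simp_all add: algebra_simps)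
  then have a: "a1 s0 = - (b1 s0 + log_area 1 s0) / 2" "a2 s0 = - (b2 s0 + log_area 2 s0) / 2"
    using PR_pos[OF sS] by (simp_all add: log_area_def)
  have "jet1 s0 (\<lambda>s. vector [A s, B s, C s, E s])
    = (vector [A s0, B s0, C s0, E s0], vector [gradient A s0, gradient B s0, gradient C s0, gradient E s0])"
    using G(2,4-7) by (intro jet1_vector) (auto intro: smooth_on_differentiable)
  then show ?thesis
    using jet_row_eq[OF G(1,3,2,4,5) X a] jet_row_eq[OF G(1,3,2,6,7) Y a]
    by (simp add: jet_map_def vector_4)
qed

lemma normalized_germ_parallel:
  assumes I: "normalized_germ s0 U A B C E"
  obtains a1 a2 b1 b2 where "smooth_on U a1" "smooth_on U a2" "smooth_on U b1" "smooth_on U b2"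
    "twisted_killing U a1 a2 (comp1 A B) (comp2 B)" "twisted_killing U a1 a2 (comp1 C E) (comp2 E)"
    "twisted_parallel U a1 a2 b1 b2 (comp1 A B) (comp2 B)" "twisted_parallel U a1 a2 b1 b2 (comp1 C E) (comp2 E)"
proof -
  note G = normalized_germ_smooth[OF I]
  note sm = smooth_comp[OF G(1,3,4,5)] smooth_comp[OF G(1,3,6,7)]
  have fl: "frac_lin_integral_on U g A B C E" using I by (simp add: normalized_germ_def)
  obtain a1 a2 where a: "smooth_on U a1" "smooth_on U a2"
    "twisted_killing U a1 a2 (comp1 A B) (comp2 B)" "twisted_killing U a1 a2 (comp1 C E) (comp2 E)"
    using integral_imp_killing[OF G(1,3) fl] by blast
  obtain b1 b2 where "smooth_on U b1" "smooth_on U b2"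
    "twisted_parallel U a1 a2 b1 b2 (comp1 A B) (comp2 B)" "twisted_parallel U a1 a2 b1 b2 (comp1 C E) (comp2 E)"
    using twisted_parallel_of_killing[OF G(1,3) a(1,2) sm G(10) a(3,4)] by blast
  then show ?thesis using that a by blast
qed

lemma comp_combination:
  "comp1 (\<lambda>s. m * A s + n * C s) (\<lambda>s. m * B s + n * E s) = (\<lambda>s. m * comp1 A B s + n * comp1 C E s)"
  "comp2 (\<lambda>s. m * B s + n * E s) = (\<lambda>s. m * comp2 B s + n * comp2 E s)"
  by (simp_all add: fun_eq_iff comp1_def comp2_def algebra_simps)

text \<open>Real unimodular combinations, i.e. Moebius transformations of the integral, since the
  twisted Killing equation is linear.\<close>

lemma normalized_germ_combination:
  assumes I: "normalized_germ s0 U A B C E" and m: "m11 * m22 - m12 * m21 = 1"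
  shows "normalized_germ s0 U (\<lambda>s. m11 * A s + m12 * C s) (\<lambda>s. m11 * B s + m12 * E s)
    (\<lambda>s. m21 * A s + m22 * C s) (\<lambda>s. m21 * B s + m22 * E s)"
proof -
  note G = normalized_germ_smooth[OF I]
  note sm = smooth_comp[OF G(1,3,4,5)] smooth_comp[OF G(1,3,6,7)]
  obtain a1 a2 where a: "twisted_killing U a1 a2 (comp1 A B) (comp2 B)" "twisted_killing U a1 a2 (comp1 C E) (comp2 E)"
    using normalized_germ_parallel[OF I] by blast
  have det: "(m11 * A s + m12 * C s) * (m21 * B s + m22 * E s) - (m11 * B s + m12 * E s) * (m21 * A s + m22 * C s) = 1"
    if "s \<in> U" for s
  proof -
    have "(m11 * A s + m12 * C s) * (m21 * B s + m22 * E s) - (m11 * B s + m12 * E s) * (m21 * A s + m22 * C s)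
      = (m11 * m22 - m12 * m21) * (A s * E s - B s * C s)" by (simp add: algebra_simps)
    then show ?thesis using m G(8)[OF that] by simp
  qed
  have "frac_lin_integral_on U g (\<lambda>s. m11 * A s + m12 * C s) (\<lambda>s. m11 * B s + m12 * E s)
    (\<lambda>s. m21 * A s + m22 * C s) (\<lambda>s. m21 * B s + m22 * E s)"
  proof (rule killing_imp_integral[OF G(1,3)])
    show "twisted_killing U a1 a2 (comp1 (\<lambda>s. m11 * A s + m12 * C s) (\<lambda>s. m11 * B s + m12 * E s)) (comp2 (\<lambda>s. m11 * B s + m12 * E s))"
      "twisted_killing U a1 a2 (comp1 (\<lambda>s. m21 * A s + m22 * C s) (\<lambda>s. m21 * B s + m22 * E s)) (comp2 (\<lambda>s. m21 * B s + m22 * E s))"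
      unfolding comp_combination by (rule twisted_killing_add[OF a G(1) sm])+
  qed (auto intro!: smooth_intros G simp: det)
  then show ?thesis using G det by (simp add: normalized_germ_def normalized_on_def)
qed

definition beta_values :: "real^2 \<Rightarrow> (real \<times> real) set" where
  "beta_values s0 = {(b1 s0, b2 s0) | b1 b2. \<exists>U A B C E a1 a2. normalized_germ s0 U A B C E
     \<and> smooth_on U a1 \<and> smooth_on U a2 \<and> smooth_on U b1 \<and> smooth_on U b2
     \<and> twisted_parallel U a1 a2 b1 b2 (comp1 A B) (comp2 B) \<and> twisted_parallel U a1 a2 b1 b2 (comp1 C E) (comp2 E)}"

lemma beta_values_riccati:
  "beta_values s0 \<subseteq> {(b1 s0, b2 s0) | b1 b2. \<exists>U. open U \<and> s0 \<in> U \<and> U \<subseteq> S \<and> riccati_form U b1 b2}"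
proof
  fix b assume "b \<in> beta_values s0"
  then obtain b1 b2 U A B C E a1 a2 where b: "b = (b1 s0, b2 s0)" "normalized_germ s0 U A B C E"
    "smooth_on U a1" "smooth_on U a2" "smooth_on U b1" "smooth_on U b2"
    "twisted_parallel U a1 a2 b1 b2 (comp1 A B) (comp2 B)" "twisted_parallel U a1 a2 b1 b2 (comp1 C E) (comp2 E)"
    unfolding beta_values_def by blast
  note G = normalized_germ_smooth[OF b(2)]
  have "riccati_form U b1 b2"
    by (rule parallel_pair_riccati(1)[OF G(1,3) b(3-6) smooth_comp[OF G(1,3,4,5)] smooth_comp[OF G(1,3,6,7)] b(7,8) G(10)])
  then show "b \<in> {(b1 s0, b2 s0) | b1 b2. \<exists>U. open U \<and> s0 \<in> U \<and> U \<subseteq> S \<and> riccati_form U b1 b2}"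
    using b(1) G(1-3) by blast
qed

text \<open>Over each value of \<open>\<beta>\<close> lies one full orbit of SL(2): a unimodular
  combination of a given germ attains any unimodular 0-jet without changing
  \<open>\<beta>\<close>.\<close>

lemma integral_jets_graphs:
  "integral_jets S g s0 = {(F, T F) | F T. unimodular F \<and> T \<in> jet_map s0 ` beta_values s0}"
proof (intro set_eqI iffI)
  fix j assume "j \<in> integral_jets S g s0"
  then obtain A B C E U where j: "j = jet1 s0 (\<lambda>s. vector [A s, B s, C s, E s])" and I: "normalized_germ s0 U A B C E"
    unfolding integral_jets_eq by blast
  note G = normalized_germ_smooth[OF I]
  obtain a1 a2 b1 b2 where b: "smooth_on U a1" "smooth_on U a2" "smooth_on U b1" "smooth_on U b2"
    "twisted_parallel U a1 a2 b1 b2 (comp1 A B) (comp2 B)" "twisted_parallel U a1 a2 b1 b2 (comp1 C E) (comp2 E)"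
    by (rule normalized_germ_parallel[OF I])
  have "(b1 s0, b2 s0) \<in> beta_values s0"
    unfolding beta_values_def using I b by blast
  moreover have "unimodular (vector [A s0, B s0, C s0, E s0])"
    using G(2,8) by (simp add: unimodular_def vector_4)
  ultimately show "j \<in> {(F, T F) | F T. unimodular F \<and> T \<in> jet_map s0 ` beta_values s0}"
    unfolding j jet1_normalized_germ[OF I b(5,6)] by blast
next
  fix j assume "j \<in> {(F, T F) | F T. unimodular F \<and> T \<in> jet_map s0 ` beta_values s0}"
  then obtain F b where F: "j = (F, jet_map s0 b F)" "unimodular F" "b \<in> beta_values s0" by blast
  then obtain b1 b2 U A B C E a1 a2 where b: "b = (b1 s0, b2 s0)" "normalized_germ s0 U A B C E"
    "twisted_parallel U a1 a2 b1 b2 (comp1 A B) (comp2 B)" "twisted_parallel U a1 a2 b1 b2 (comp1 C E) (comp2 E)"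
    unfolding beta_values_def by blast
  note G = normalized_germ_smooth[OF b(2)]
  note sm = smooth_comp[OF G(1,3,4,5)] smooth_comp[OF G(1,3,6,7)]
  define m11 m12 m21 m22 where "m11 = F $ 1 * E s0 - F $ 2 * C s0" and "m12 = F $ 2 * A s0 - F $ 1 * B s0"
    and "m21 = F $ 3 * E s0 - F $ 4 * C s0" and "m22 = F $ 4 * A s0 - F $ 3 * B s0"
  have d: "A s0 * E s0 - B s0 * C s0 = 1" using G(2,8) by blast
  have uF: "F $ 1 * F $ 4 - F $ 2 * F $ 3 = 1" using F(2) by (simp add: unimodular_def)
  have m: "m11 * m22 - m12 * m21 = 1"
    using d uF unfolding m11_def m12_def m21_def m22_def by algebra
  have FF: "F = vector [m11 * A s0 + m12 * C s0, m11 * B s0 + m12 * E s0, m21 * A s0 + m22 * C s0, m21 * B s0 + m22 * E s0]"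
    unfolding vector_4_eq_iff m11_def m12_def m21_def m22_def using d by (intro conjI; algebra)
  note I = normalized_germ_combination[OF b(2) m]
  have jet: "jet1 s0 (\<lambda>s. vector [m11 * A s + m12 * C s, m11 * B s + m12 * E s, m21 * A s + m22 * C s, m21 * B s + m22 * E s]) = j"
    unfolding F(1) b(1) FF
    by (rule jet1_normalized_germ[OF I, of a1 a2 b1 b2])
      (unfold comp_combination, (rule twisted_parallel_combination[OF b(3,4) sm])+)
  show "j \<in> integral_jets S g s0"
    unfolding integral_jets_eq by (intro CollectI exI conjI, rule jet[symmetric], rule I)
qed

lemma dimension_three_if_nonconstant:
  assumes s0: "s0 \<in> S" and nc: "\<not> (\<exists>U. open U \<and> s0 \<in> U \<and> U \<subseteq> S \<and> K constant_on U)"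
  shows "integrals_have_dim S g s0 3"
  unfolding integrals_have_dim_def integral_jets_graphs
proof (rule graphs_over_unimodular_submanifold)
  show "finite (jet_map s0 ` beta_values s0)"
    using finite_subset[OF beta_values_riccati finite_riccati_values[OF s0 nc]] by (rule finite_imageI)
  show "linear T" if "T \<in> jet_map s0 ` beta_values s0" for T
    using that linear_jet_map by blast
  fix T T' F assume T: "T \<in> jet_map s0 ` beta_values s0" "T' \<in> jet_map s0 ` beta_values s0"
    and F: "unimodular F" "T F = T' F"
  obtain b b' where b: "T = jet_map s0 b" "T' = jet_map s0 b'" using T by blast
  have "jet_map s0 b F $ i = jet_map s0 b' F $ i" for i using F(2) b by simp
  from this[of 1] this[of 2] this[of 3] this[of 4]
  have "jet_row s0 b (F $ 1) (F $ 2) = jet_row s0 b' (F $ 1) (F $ 2)"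
    "jet_row s0 b (F $ 3) (F $ 4) = jet_row s0 b' (F $ 3) (F $ 4)"
    by (simp_all add: jet_map_def vector_4 prod_eq_iff)
  then have "b = b'"
    using jet_row_inj[OF s0, of "F $ 1" "F $ 4" "F $ 2" "F $ 3"] F(1) by (simp add: unimodular_def)
  then show "T = T'" using b by simp
qed

lemma normalize_killing_pair:
  assumes U: "open U" "U \<subseteq> S" "s0 \<in> U"
    and sm: "smooth_on U A" "smooth_on U B" "smooth_on U C" "smooth_on U E"
    and det: "\<And>s. s \<in> U \<Longrightarrow> A s * E s - B s * C s > 0"
    and X: "twisted_killing U a1 a2 (comp1 A B) (comp2 B)" and Y: "twisted_killing U a1 a2 (comp1 C E) (comp2 E)"
  defines "f \<equiv> \<lambda>s. 1 / sqrt (A s * E s - B s * C s)"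
  shows "normalized_germ s0 U (\<lambda>s. f s * A s) (\<lambda>s. f s * B s) (\<lambda>s. f s * C s) (\<lambda>s. f s * E s)"
proof -
  have "sqrt (A s * E s - B s * C s) \<noteq> 0" if "s \<in> U" for s using det[OF that] by simp
  then have sf: "smooth_on U f"
    unfolding f_def using U(1) by (intro smooth_intros smooth_on_sqrt sm det)
  have fpos: "f s \<noteq> 0" if "s \<in> U" for s using det[OF that] by (simp add: f_def)
  have c: "comp1 (\<lambda>s. f s * A s) (\<lambda>s. f s * B s) = (\<lambda>s. f s * comp1 A B s)"
    "comp2 (\<lambda>s. f s * B s) = (\<lambda>s. f s * comp2 B s)" for A B
    by (simp_all add: fun_eq_iff comp1_def comp2_def algebra_simps)
  have d1: "f s * A s * (f s * E s) - f s * B s * (f s * C s) = 1" if "s \<in> U" for s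
  proof -
    have "f s * A s * (f s * E s) - f s * B s * (f s * C s) = (f s)\<^sup>2 * (A s * E s - B s * C s)"
      by (simp add: algebra_simps power2_eq_square)
    then show ?thesis using det[OF that] by (simp add: f_def power_divide)
  qed
  note sc = smooth_comp[OF U(1,2) sm(1,2)] smooth_comp[OF U(1,2) sm(3,4)]
  have "frac_lin_integral_on U g (\<lambda>s. f s * A s) (\<lambda>s. f s * B s) (\<lambda>s. f s * C s) (\<lambda>s. f s * E s)"
  proof (rule killing_imp_integral[OF U(1,2)])
    show "twisted_killing U (\<lambda>s. a1 s - D1 f s / f s) (\<lambda>s. a2 s - D2 f s / f s)
        (comp1 (\<lambda>s. f s * A s) (\<lambda>s. f s * B s)) (comp2 (\<lambda>s. f s * B s))"
      "twisted_killing U (\<lambda>s. a1 s - D1 f s / f s) (\<lambda>s. a2 s - D2 f s / f s)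
        (comp1 (\<lambda>s. f s * C s) (\<lambda>s. f s * E s)) (comp2 (\<lambda>s. f s * E s))"
      unfolding c by (rule twisted_killing_scale[OF X sf sc(1,2) fpos] twisted_killing_scale[OF Y sf sc(3,4) fpos]; assumption)+
  qed (auto intro!: smooth_intros sm sf U simp: d1)
  then show ?thesis using U d1 by (simp add: normalized_germ_def normalized_on_def)
qed

lemma normalized_germ_subset:
  assumes "normalized_germ s0 U A B C E" "open V" "s0 \<in> V" "V \<subseteq> U"
  shows "normalized_germ s0 V A B C E"
  using assms unfolding normalized_germ_def frac_lin_integral_on_def normalized_on_def
  by (auto intro: smooth_on_subset)

lemma normalized_germ_exists:
  assumes s0: "s0 \<in> U" and U: "open U" "U \<subseteq> S" and I: "frac_lin_integral_on U g A B C E"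
  shows "\<exists>V A B C E. normalized_germ s0 V A B C E"
proof -
  have sm: "smooth_on U A" "smooth_on U B" "smooth_on U C" "smooth_on U E"
    and det: "\<And>s. s \<in> U \<Longrightarrow> A s * E s - B s * C s \<noteq> 0"
    using I by (auto simp: frac_lin_integral_on_def)
  obtain a1 a2 where a: "twisted_killing U a1 a2 (comp1 A B) (comp2 B)" "twisted_killing U a1 a2 (comp1 C E) (comp2 E)"
    using integral_imp_killing[OF U I] by blast
  \<comment> \<open>changing the sign of the numerator makes the determinant positive near
    s0\<close>
  define \<sigma> where "\<sigma> = sgn (A s0 * E s0 - B s0 * C s0)"
  define V where "V = {s \<in> U. \<sigma> * (A s * E s - B s * C s) > 0}"
  have "continuous_on U (\<lambda>s. \<sigma> * (A s * E s - B s * C s))"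
    using sm[THEN smooth_on_continuous_on] by (intro continuous_intros)
  from open_superlevel[OF U(1) this] have oV: "open V" by (simp add: V_def)
  have VU: "V \<subseteq> U" by (auto simp: V_def)
  have s0V: "s0 \<in> V" using s0 det[OF s0] by (simp add: V_def \<sigma>_def sgn_if)
  have VS: "V \<subseteq> S" using VU U(2) by blast
  note smV = sm[THEN smooth_on_subset[OF _ VU]]
  note aV = a[THEN twisted_killing_subset[OF _ VU]]
  note sc = smooth_comp[OF oV VS smV(1,2)] smooth_comp[OF oV VS smV(3,4)]
  let ?A = "\<lambda>s. \<sigma> * A s + 0 * C s" and ?B = "\<lambda>s. \<sigma> * B s + 0 * E s"
  have X: "twisted_killing V a1 a2 (comp1 ?A ?B) (comp2 ?B)"
    unfolding comp_combination by (rule twisted_killing_add[OF aV oV sc])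
  have pos: "?A s * E s - ?B s * C s > 0" if "s \<in> V" for s
    using that by (simp add: V_def algebra_simps)
  have "smooth_on V ?A" "smooth_on V ?B" by (intro smooth_intros oV smV)+
  from normalize_killing_pair[OF oV VS s0V this smV(3,4) pos X aV(2)]
  show ?thesis by (intro exI)
qed

lemma gradient_mult:
  assumes "f differentiable at s" "h differentiable at s"
  shows "gradient (\<lambda>s. f s * h s) s = f s *\<^sub>R gradient h s + h s *\<^sub>R gradient f s"
  using assms by (simp add: vec_eq_iff gradient_nth pderiv_at_simps)

lemma combination_jet:
  assumes I: "normalized_germ s0 U A B C E" and m: "m11 * m22 - m12 * m21 = 1"
  shows "(vector [m11 * A s0 + m12 * C s0, m11 * B s0 + m12 * E s0, m21 * A s0 + m22 * C s0, m21 * B s0 + m22 * E s0],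
      vector [m11 *\<^sub>R gradient A s0 + m12 *\<^sub>R gradient C s0, m11 *\<^sub>R gradient B s0 + m12 *\<^sub>R gradient E s0,
        m21 *\<^sub>R gradient A s0 + m22 *\<^sub>R gradient C s0, m21 *\<^sub>R gradient B s0 + m22 *\<^sub>R gradient E s0])
    \<in> integral_jets S g s0"
proof -
  note G = normalized_germ_smooth[OF I]
  have d: "A differentiable at s0" "B differentiable at s0" "C differentiable at s0" "E differentiable at s0"
    using G(2,4-7) by (auto intro: smooth_on_differentiable)
  have comb: "gradient (\<lambda>s. m * f s + n * h s) s0 = m *\<^sub>R gradient f s0 + n *\<^sub>R gradient h s0"
    if "f differentiable at s0" "h differentiable at s0" for f h m n
    using that by (simp add: vec_eq_iff gradient_nth pderiv_at_simps)
  have "jet1 s0 (\<lambda>s. vector [m11 * A s + m12 * C s, m11 * B s + m12 * E s, m21 * A s + m22 * C s, m21 * B s + m22 * E s])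
      \<in> integral_jets S g s0"
    unfolding integral_jets_eq
    by (intro CollectI exI conjI, rule refl, rule normalized_germ_combination[OF I m])
  then show ?thesis
    using d by (simp add: jet1_vector comb)
qed

text \<open>The pair \<open>(X + t Z, Y)\<close> with \<open>Z = m1 X + m2 Y\<close> has
  determinant \<open>1 + t m1\<close>. Since m1 and m2 vanish at s0, the 0-jet there does not
  change, and the gradients of the normalized coefficients are affine functions of t.\<close>

lemma deformation_jet:
  assumes I: "normalized_germ s0 U A B C E"
    and a: "twisted_killing U a1 a2 (comp1 A B) (comp2 B)" "twisted_killing U a1 a2 (comp1 C E) (comp2 E)"
    and m: "smooth_on U m1" "smooth_on U m2" "m1 s0 = 0" "m2 s0 = 0"
    and D: "\<And>s. s \<in> U \<Longrightarrow> D1 m1 s = - k s * comp1 C E s" "\<And>s. s \<in> U \<Longrightarrow> D2 m1 s = - k s * comp2 E s"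
      "\<And>s. s \<in> U \<Longrightarrow> D1 m2 s = k s * comp1 A B s" "\<And>s. s \<in> U \<Longrightarrow> D2 m2 s = k s * comp2 B s"
  shows "(vector [A s0, B s0, C s0, E s0],
      vector [gradient A s0 + t *\<^sub>R ((A s0 / 2) *\<^sub>R gradient m1 s0 + C s0 *\<^sub>R gradient m2 s0),
        gradient B s0 + t *\<^sub>R ((B s0 / 2) *\<^sub>R gradient m1 s0 + E s0 *\<^sub>R gradient m2 s0),
        gradient C s0 - t *\<^sub>R ((C s0 / 2) *\<^sub>R gradient m1 s0),
        gradient E s0 - t *\<^sub>R ((E s0 / 2) *\<^sub>R gradient m1 s0)]) \<in> integral_jets S g s0"
    (is "?jet \<in> _")
proof -
  note G = normalized_germ_smooth[OF I]
  define V where "V = {s \<in> U. 1 + t * m1 s > 0}"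
  have "continuous_on U (\<lambda>s. 1 + t * m1 s)"
    using m(1)[THEN smooth_on_continuous_on] by (intro continuous_intros)
  from open_superlevel[OF G(1) this] have oV: "open V" by (simp add: V_def)
  have V: "V \<subseteq> U" "V \<subseteq> S" "s0 \<in> V" using G(2,3) m(3) by (auto simp: V_def)
  note smV = G(4-7)[THEN smooth_on_subset[OF _ V(1)]] m(1,2)[THEN smooth_on_subset[OF _ V(1)]]
  note aV = a[THEN twisted_killing_subset[OF _ V(1)]]
  note sc = smooth_comp[OF oV V(2) smV(1,2)] smooth_comp[OF oV V(2) smV(3,4)]
  define A' B' where "A' s = A s + t * (m1 s * A s + m2 s * C s)" and "B' s = B s + t * (m1 s * B s + m2 s * E s)" for s
  have det': "A' s * E s - B' s * C s = 1 + t * m1 s" if "s \<in> U" for s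
  proof -
    have "A' s * E s - B' s * C s = (1 + t * m1 s) * (A s * E s - B s * C s)"
      by (simp add: A'_def B'_def algebra_simps)
    then show ?thesis using G(8)[OF that] by simp
  qed
  have Z: "twisted_killing V a1 a2 (\<lambda>s. m1 s * comp1 A B s + m2 s * comp1 C E s) (\<lambda>s. m1 s * comp2 B s + m2 s * comp2 E s)"
    by (rule killing_of_hamiltonian_pair[OF oV smV(5,6) sc aV, of k]) (use D V(1) in auto)
  have cA: "comp1 A' B' = (\<lambda>s. 1 * comp1 A B s + t * (m1 s * comp1 A B s + m2 s * comp1 C E s))"
    "comp2 B' = (\<lambda>s. 1 * comp2 B s + t * (m1 s * comp2 B s + m2 s * comp2 E s))"
    by (simp_all add: fun_eq_iff comp1_def comp2_def A'_def B'_def algebra_simps)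
  have X': "twisted_killing V a1 a2 (comp1 A' B') (comp2 B')"
    unfolding cA by (rule twisted_killing_add[OF aV(1) Z oV]; intro smooth_intros oV smV sc)
  have smA': "smooth_on V A'" "smooth_on V B'"
    unfolding A'_def[abs_def] B'_def[abs_def] by (intro smooth_intros oV smV)+
  define f where "f s = 1 / sqrt (A' s * E s - B' s * C s)" for s
  have pos: "A' s * E s - B' s * C s > 0" if "s \<in> V" for s
    using det'[of s] that V(1) by (auto simp: V_def)
  have germ: "normalized_germ s0 V (\<lambda>s. f s * A' s) (\<lambda>s. f s * B' s) (\<lambda>s. f s * C s) (\<lambda>s. f s * E s)"
    unfolding f_def[abs_def]
    by (rule normalize_killing_pair[OF oV V(2,3) smA' smV(3,4) pos X' aV(2)])
  have d: "A differentiable at s0" "B differentiable at s0" "C differentiable at s0" "E differentiable at s0"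
    "m1 differentiable at s0" "m2 differentiable at s0" "A' differentiable at s0" "B' differentiable at s0"
    using V(3) smV smA' by (auto intro: smooth_on_differentiable)
  have "sqrt (A' s * E s - B' s * C s) \<noteq> 0" if "s \<in> V" for s using pos[OF that] by simp
  then have "smooth_on V f"
    unfolding f_def[abs_def] by (intro smooth_intros smooth_on_sqrt oV smA' smV pos)
  then have df: "f differentiable at s0" using V(3) by (rule smooth_on_differentiable)
  have f0: "f s0 = 1" using det'[of s0] G(2) m(3) by (simp add: f_def)
  have "pderiv_at i f s0 = - (t / 2) * pderiv_at i m1 s0" for i
  proof -
    have d1: "(\<lambda>s. 1 + t * m1 s) differentiable at s0" using d(5) by (simp add: along_simps)
    have posm: "1 + t * m1 s > 0" if "s \<in> V" for s using that by (simp add: V_def)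
    have ds: "(\<lambda>s. sqrt (1 + t * m1 s)) differentiable at s0"
      by (rule smooth_on_differentiable[OF smooth_on_sqrt[OF oV _ posm] V(3)])
        (intro smooth_intros oV smV)
    have "pderiv_at i f s0 = pderiv_at i (\<lambda>s. 1 / sqrt (1 + t * m1 s)) s0"
      by (rule pderiv_at_cong[OF oV V(3)]) (use det' V(1) in \<open>auto simp: f_def\<close>)
    also have "\<dots> = - (t / 2) * pderiv_at i m1 s0"
      unfolding pderiv_at_along using ds d1 d(5) m(3)
      by (subst along_divide) (auto simp: along_simps along_sqrt)
    finally show ?thesis .
  qed
  then have gf: "gradient f s0 = - (t / 2) *\<^sub>R gradient m1 s0"
    by (simp add: vec_eq_iff gradient_nth)
  have gA: "gradient A' s0 = gradient A s0 + t *\<^sub>R (A s0 *\<^sub>R gradient m1 s0 + C s0 *\<^sub>R gradient m2 s0)"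
    "gradient B' s0 = gradient B s0 + t *\<^sub>R (B s0 *\<^sub>R gradient m1 s0 + E s0 *\<^sub>R gradient m2 s0)"
    unfolding A'_def[abs_def] B'_def[abs_def] using d m(3,4)
    by (simp_all add: vec_eq_iff gradient_nth pderiv_at_simps)
  have A0: "A' s0 = A s0" "B' s0 = B s0" using m(3,4) by (simp_all add: A'_def B'_def)
  have "jet1 s0 (\<lambda>s. vector [f s * A' s, f s * B' s, f s * C s, f s * E s]) \<in> integral_jets S g s0"
    unfolding integral_jets_eq by (intro CollectI exI conjI, rule refl, rule germ)
  moreover have "jet1 s0 (\<lambda>s. vector [f s * A' s, f s * B' s, f s * C s, f s * E s]) = ?jet"
    using d df by (simp add: jet1_vector gradient_mult f0 gf gA A0)
      (simp add: vec_eq_iff forall_4 vector_4 algebra_simps)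
  ultimately show ?thesis by simp
qed

text \<open>Four lines with independent directions pass through the jet of the given germ: three
  tangent to its SL(2)-orbit, with independent 0-jets, and the deformation by the third Killing
  field, with vanishing 0-jet.\<close>

lemma not_dimension_three_if_constant:
  assumes I: "normalized_germ s0 U A B C E" and K: "K constant_on U"
  shows "\<not> integrals_have_dim S g s0 3"
proof
  assume dim3: "integrals_have_dim S g s0 3"
  note G = normalized_germ_smooth[OF I]
  have sS: "s0 \<in> S" using G by blast
  obtain a1 a2 where a: "smooth_on U a1" "smooth_on U a2"
    "twisted_killing U a1 a2 (comp1 A B) (comp2 B)" "twisted_killing U a1 a2 (comp1 C E) (comp2 E)"
    using normalized_germ_parallel[OF I] by blast
  obtain r k m1 m2 where r: "r > 0" "ball s0 r \<subseteq> U" and m: "smooth_on (ball s0 r) m1" "smooth_on (ball s0 r) m2"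
    "m1 s0 = 0" "m2 s0 = 0" and k: "\<And>s. s \<in> ball s0 r \<Longrightarrow> k s > (0::real)"
    and D: "\<And>s. s \<in> ball s0 r \<Longrightarrow> D1 m1 s = - k s * comp1 C E s" "\<And>s. s \<in> ball s0 r \<Longrightarrow> D2 m1 s = - k s * comp2 E s"
    "\<And>s. s \<in> ball s0 r \<Longrightarrow> D1 m2 s = k s * comp1 A B s" "\<And>s. s \<in> ball s0 r \<Longrightarrow> D2 m2 s = k s * comp2 B s"
    by (rule third_killing_field[OF G(1,3,2) K a(1,2) smooth_comp[OF G(1,3,4,5)] smooth_comp[OF G(1,3,6,7)] G(10) a(3,4)])
      (assumption | (rule that; assumption))+
  have sB: "s0 \<in> ball s0 r" using r(1) by simp
  note IB = normalized_germ_subset[OF I open_ball sB r(2)]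
  note line = deformation_jet[OF IB a(3,4)[THEN twisted_killing_subset[OF _ r(2)]] m D]
  define w where "w = (vector [(A s0 / 2) *\<^sub>R gradient m1 s0 + C s0 *\<^sub>R gradient m2 s0,
        (B s0 / 2) *\<^sub>R gradient m1 s0 + E s0 *\<^sub>R gradient m2 s0,
        - (C s0 / 2) *\<^sub>R gradient m1 s0, - (E s0 / 2) *\<^sub>R gradient m1 s0] :: real^2^4)"
  have det: "A s0 * E s0 - B s0 * C s0 = 1" using G(2,8) by blast
  have w: "w \<noteq> 0"
  proof
    assume "w = 0"
    then have "w $ 3 = 0" "w $ 4 = 0" by simp_all
    then have "gradient m1 s0 = 0" using det by (auto simp: w_def vector_4)
    then have p: "pderiv_at 1 m1 s0 = 0" "pderiv_at 2 m1 s0 = 0"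
      unfolding gradient_nth[symmetric] by simp_all
    have "m1 differentiable at s0" using m(1) sB by (rule smooth_on_differentiable)
    from along_e[OF this] have "D1 m1 s0 = 0" "D2 m1 s0 = 0" using p by simp_all
    then have "comp1 C E s0 = 0" "comp2 E s0 = 0" using D(1,2)[OF sB] k[OF sB] by simp_all
    then show False using G(10)[OF G(2)] by simp
  qed
  define j0 where "j0 = (vector [A s0, B s0, C s0, E s0] :: real^4,
    vector [gradient A s0, gradient B s0, gradient C s0, gradient E s0] :: real^2^4)"
  \<comment> \<open>directions of the nilpotent matrices ((0,1),(0,0)), ((0,0),(1,0)) and
    ((1,-1),(1,-1)): they span sl(2), and 1 + t N is unimodular for each such N, so that the
    curves in the orbit are straight lines\<close>
  define v1 where "v1 = (vector [C s0, E s0, 0, 0] :: real^4, vector [gradient C s0, gradient E s0, 0, 0] :: real^2^4)"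
  define v2 where "v2 = (vector [0, 0, A s0, B s0] :: real^4, vector [0, 0, gradient A s0, gradient B s0] :: real^2^4)"
  define v3 where "v3 = (vector [A s0 - C s0, B s0 - E s0, A s0 - C s0, B s0 - E s0] :: real^4,
    vector [gradient A s0 - gradient C s0, gradient B s0 - gradient E s0,
      gradient A s0 - gradient C s0, gradient B s0 - gradient E s0] :: real^2^4)"
  define \<Phi> where "\<Phi> c = c $ 1 *\<^sub>R v1 + c $ 2 *\<^sub>R v2 + c $ 3 *\<^sub>R v3 + c $ 4 *\<^sub>R (0, w)" for c :: "real^4"
  have lin: "linear \<Phi>"
    by (rule linearI) (simp_all add: \<Phi>_def scaleR_add_left scaleR_add_right)
  have "inj \<Phi>"
    unfolding linear_injective_0[OF lin]
  proof (intro allI impI)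
    fix c assume 0: "\<Phi> c = 0"
    then have "fst (\<Phi> c) $ i = 0" for i by simp
    from this[of 1] this[of 2] this[of 3] this[of 4]
    have e: "c $ 1 * C s0 + c $ 3 * (A s0 - C s0) = 0" "c $ 1 * E s0 + c $ 3 * (B s0 - E s0) = 0"
      "c $ 2 * A s0 + c $ 3 * (A s0 - C s0) = 0" "c $ 2 * B s0 + c $ 3 * (B s0 - E s0) = 0"
      by (simp_all add: \<Phi>_def v1_def v2_def v3_def vector_4)
    have c: "c $ 1 = 0" "c $ 2 = 0" "c $ 3 = 0" using e det by algebra+
    then have "c $ 4 *\<^sub>R w = 0" using 0 by (simp add: \<Phi>_def zero_prod_def)
    then have "c $ 4 = 0" using w by simp
    then show "c = 0" using c by (simp add: vec_eq_iff forall_4)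
  qed
  have jets: "j0 + t *\<^sub>R v1 \<in> integral_jets S g s0" "j0 + t *\<^sub>R v2 \<in> integral_jets S g s0"
    "j0 + t *\<^sub>R v3 \<in> integral_jets S g s0" "j0 + t *\<^sub>R (0, w) \<in> integral_jets S g s0" for t
  proof -
    note comb = combination_jet[OF I] and vec = vector_4_add vector_4_scaleR
    show "j0 + t *\<^sub>R v1 \<in> integral_jets S g s0"
      using comb[of 1 1 t 0] by (simp add: j0_def v1_def vec)
    show "j0 + t *\<^sub>R v2 \<in> integral_jets S g s0"
      using comb[of 1 1 0 t] by (simp add: j0_def v2_def vec add.commute)
    show "j0 + t *\<^sub>R v3 \<in> integral_jets S g s0"
      using comb[of "1 + t" "1 - t" "- t" t] by (simp add: j0_def v3_def vec algebra_simps)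
    show "j0 + t *\<^sub>R (0, w) \<in> integral_jets S g s0"
      using line[of t] by (simp add: j0_def w_def vec)
  qed
  have "j0 \<in> integral_jets S g s0" using jets(1)[of 0] by simp
  moreover have "j0 + t *\<^sub>R \<Phi> b \<in> integral_jets S g s0" if bB: "b \<in> Basis" for b t
  proof -
    obtain i where b: "b = axis i 1" using bB by (auto simp: Basis_vec_def)
    have "\<Phi> b = v1 \<or> \<Phi> b = v2 \<or> \<Phi> b = v3 \<or> \<Phi> b = (0, w)"
      using exhaust_4[of i] by (auto simp: b \<Phi>_def axis_def simp flip: zero_prod_def)
    then show ?thesis using jets[of t] by auto
  qed
  ultimately have "DIM(real^4) \<le> 3"
    using dim3 unfolding integrals_have_dim_def
    by (rule embedded_submanifold_tangent_lines[OF _ _ lin \<open>inj \<Phi>\<close>, rotated])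
  then show False by simp
qed

end

theorem theorem8:
  fixes S :: "(real^2) set" and g :: "real^2 \<Rightarrow> real^2^2" and s0 :: "real^2"
  assumes "open S" and "riemannian_metric_on S g" and "s0 \<in> S"
    and "\<exists>U A B C E. open U \<and> s0 \<in> U \<and> U \<subseteq> S \<and> frac_lin_integral_on U g A B C E"
  shows "integrals_have_dim S g s0 3 \<longleftrightarrow>
    \<not> (\<exists>U. open U \<and> s0 \<in> U \<and> U \<subseteq> S \<and> gauss_curvature g constant_on U)"
proof -
  interpret riemannian_chart S g
    using assms(1,2) by unfold_locales
  have K: "gauss_curvature g constant_on U \<longleftrightarrow> K constant_on U" if "U \<subseteq> S" for U
  proof -
    have eq: "gauss_curvature g s = K s" if "s \<in> U" for s
      by (rule gauss_curvature_frame[OF subsetD[OF \<open>U \<subseteq> S\<close> that]])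
    show ?thesis
      unfolding constant_on_def by (intro arg_cong[where f=Ex] ext ball_cong refl) (simp only: eq)
  qed
  show ?thesis
  proof
    assume dim3: "integrals_have_dim S g s0 3"
    show "\<not> (\<exists>U. open U \<and> s0 \<in> U \<and> U \<subseteq> S \<and> gauss_curvature g constant_on U)"
    proof
      assume "\<exists>U. open U \<and> s0 \<in> U \<and> U \<subseteq> S \<and> gauss_curvature g constant_on U"
      then obtain U where U: "open U" "s0 \<in> U" "K constant_on U" using K by blast
      obtain W A B C E where "open W" "s0 \<in> W" "W \<subseteq> S" "frac_lin_integral_on W g A B C E"
        using assms(4) by (elim exE conjE)
      then have "\<exists>V A B C E. normalized_germ s0 V A B C E"
        by (intro normalized_germ_exists)
      then obtain V A B C E where V: "normalized_germ s0 V A B C E"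
        by (elim exE)
      have "normalized_germ s0 (U \<inter> V) A B C E"
        using normalized_germ_smooth(1,2)[OF V] U by (intro normalized_germ_subset[OF V]) auto
      moreover have "K constant_on (U \<inter> V)" using U(3) by (rule constant_on_subset) simp
      ultimately show False using not_dimension_three_if_constant dim3 by blast
    qed
  next
    assume "\<not> (\<exists>U. open U \<and> s0 \<in> U \<and> U \<subseteq> S \<and> gauss_curvature g constant_on U)"
    then show "integrals_have_dim S g s0 3"
      using dimension_three_if_nonconstant[OF assms(3)] K by blast
  qed
qed

end
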